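(* Let $R$ be a polynomial ring over a field, let $\mathcal G=\{g_1,\dots,g_m\}$ be a finite indexed set of nonzero polynomials of $R$, and let term orders on $R$ and $R^m$ be compatible. Let $\mathcal G_n=\{g_1,\dots,g_m,g_{m+1},\dots,g_n\}\supseteq\mathcal G$ (with basis elements $e_1,\dots,e_n$) be the minimal signature Gröbner basis computed by the signature basis algorithm SB, run with the S-pair elimination criteria listed in the context, on input $\mathcal G$. Let $H\subseteq R^m$ be the initial submodule of the module of syzygies of $\mathcal G$, i.e. the submodule generated by the terms $\mathfrak s(u)$ for all $u\in R^m$ with $\overline u=0$. Then the S-pairs that SB reduces are exactly accounted for as follows: (1) SB reduces one S-pair for each element of $\mathcal G_n\setminus\mathcal G$ (that is, for each index $i$ with $m<i\le n$); (2) SB reduces one S-pair for each minimal generator of $H$ that is not (up to a nonzero scalar) the signature of any regular Koszul syzygy $\mathcal K(i,j)$, $1\le i,j\le n$, among the elements of $\mathcal G_n$; (3) SB reduces no other S-pairs.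
   Context: Notation. A monomial is a nonzero polynomial with exactly one term (coefficient allowed); terms of $R$ and $R^m$ carry nonzero coefficients. Let $e_1,\dots,e_m$ also denote the standard basis of $R^m$ and $\overline u:=\sum_{i=1}^m u_ig_i$ for $u\in R^m$. Term orders $\le$ on $R$ and on $R^m$ ignore coefficients, satisfy $0<t$ for all terms $t$, and are compatible: $a\le b\iff ae_i\le be_i$ for all monomials $a,b$ and $1\le i\le m$. For terms, $a\simeq b$ means $a=sb$ with $s$ a nonzero field element. A term $S$ of $R^m$ divides a term $T$ of $R^m$ if $T=aS$ for a monomial $a$. $\operatorname{in}(f)$ is the $\le$-maximal term of $f\in R$ (coefficient included), $\operatorname{in}(0)=0$. For $u\in R^m$ the signature $\mathfrak s(u)$ is the $\le$-maximal term of $u$ (coefficient included), $\mathfrak s(0)=0$. An extension $\mathcal G_n=\{g_1,\dots,g_n\}$, $n\ge m$, consists of nonzero polynomials of $\langle\mathcal G\rangle$ extending $\mathcal G$, together with an $R$-linear map $\phi:R^n\to R^m$ with $\phi(e_i)=e_i$ for $i\le m$ and $\overline u=\overline{\phi(u)}$, where $\overline u:=\sum_{i=1}^n u_ig_i$ for $u\in R^n$. For $u\in R^n$ put $\mathfrak s(u):=\mathfrak s(\phi(u))$. A syzygy is a $u$ in $R^n$ or $R^m$ with $\overline u=0$. Reduction. For a monomial $a$, $ae_i$ $\mathfrak s$-reduces a term $t$ of $\overline u$ ($u\in R^n$) if $\operatorname{in}(\overline{ae_i})=t$ and $\mathfrak s(ae_i)\le\mathfrak s(u)$; the outcome is $u-ae_i$.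 The step is singular if $\mathfrak s(ae_i)\simeq\mathfrak s(u)$ and regular if $\mathfrak s(ae_i)<\mathfrak s(u)$. An element is regular reduced if no term of its image can be regular reduced, regular top reducible if the lead term of its image can be regular reduced, and singular top reducible if the lead term of its image can be reduced by a singular step. The result of regular reducing $u$ is obtained by performing regular steps until the element is regular reduced. $\mathcal G_n$ is a signature Gröbner basis if every $u\in R^n$ $\mathfrak s$-reduces to an element with image $0$. S-pairs and Koszul syzygies. With $d=\gcd(\operatorname{in}(g_i),\operatorname{in}(g_j))$, $\mathcal S(i,j):=\frac{\operatorname{in}(g_j)}{d}e_i-\frac{\operatorname{in}(g_i)}{d}e_j$; it is regular if the signatures of its two summands are not related by $\simeq$. Only regular S-pairs are considered. $\mathcal K(i,j):=g_je_i-g_ie_j$; it is regular if $\mathfrak s(g_je_i)\not\simeq\mathfrak s(g_ie_j)$, and then its signature is (up to scalar) the larger of $\operatorname{in}(g_i)\mathfrak s(e_j)$ and $\operatorname{in}(g_j)\mathfrak s(e_i)$. Algorithm SB. Start with $n=m$, all regular S-pairs of $\mathcal G$, and no known syzygy signatures. While S-pairs remain, take the S-pairs of $\le$-minimal signature $T$ (up to $\simeq$) and remove them. Eliminate all S-pairs of signature $T$, without reducing any, if one of the following holds: (a) signature criterion: some known syzygy signature divides $T$; (b) Koszul criterion (including the case of an S-pair of signature $T$ between two basis elements with relatively prime lead terms): $T\simeq\mathfrak s(\mathcal K(i,j))$ for a regular Koszul syzygy among the current basis elements; in this case $T$ becomes a known syzygy signature; (c) singular criterion: an element with $\le$-minimal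 lead term $\operatorname{in}(\overline{te_i})$ among the elements $te_i$ ($t$ a monomial, $e_i$ a current basis element) with $\mathfrak s(te_i)=T$ is not regular top reducible. Otherwise exactly one S-pair of signature $T$ is reduced (the other S-pairs of signature $T$ are eliminated as duplicates): let $p'$ be the result of regular reducing it. If $\overline{p'}=0$, $T$ becomes a known syzygy signature. If $\overline{p'}\neq0$ and $p'$ is not singular top reducible, replace $n$ by $n+1$, set $\phi(e_n):=\phi(p')$ and $g_n:=\overline{p'}$ for the new $n$, and add all regular S-pairs $\mathcal S(i,n)$, $i<n$. The algorithm ends when no S-pairs remain. "SB reduces an S-pair" means that a reduction is actually carried out in this step. The basis is called minimal because elements that are singular top reducible are never added. *)

theory Defs
  imports Complex_Main "HOL-Library.Poly_Mapping"
begin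

section \<open>Polynomials and free modules\<close>

text \<open>
  The polynomial ring over the field \<open>'k\<close> in the variables \<open>'v\<close> is
  \<open>('v \<Rightarrow>\<^sub>0 nat) \<Rightarrow>\<^sub>0 'k\<close>, power products being written additively as exponent vectors.
  All free modules live in one type of finitely supported families; the free module of
  rank \<open>n\<close> is the set of families supported in \<open>{1..n}\<close>. Hence
  \<open>Poly_Mapping.single i 1\<close> is the basis element \<open>e\<^sub>i\<close> and \<open>Poly_Mapping.single i a\<close> is \<open>a e\<^sub>i\<close>.
\<close>

type_synonym ('v, 'k) pol = "('v \<Rightarrow>\<^sub>0 nat) \<Rightarrow>\<^sub>0 'k"
type_synonym ('v, 'k) fvec = "nat \<Rightarrow>\<^sub>0 ('v, 'k) pol"

definition free_module :: "nat \<Rightarrow> ('v, 'k::field) fvec set" where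
  "free_module n = {u. Poly_Mapping.keys u \<subseteq> {1..n}}"

definition vscale :: "('v, 'k::field) pol \<Rightarrow> ('v, 'k) fvec \<Rightarrow> ('v, 'k) fvec" where
  "vscale a u = Poly_Mapping.map ((*) a) u"

lemma lookup_vscale: "Poly_Mapping.lookup (vscale a u) i = a * Poly_Mapping.lookup u i"
  by (simp add: vscale_def Poly_Mapping.map.rep_eq when_def)

lemma module_vscale: "module vscale"
  by (rule module.intro)
    (auto intro!: poly_mapping_eqI simp: lookup_vscale lookup_add algebra_simps)

definition monomials :: "('v, 'k::field) pol set" where
  "monomials = {Poly_Mapping.single x c | x c. c \<noteq> 0}"

definition module_terms :: "nat \<Rightarrow> ('v, 'k::field) fvec set" where
  "module_terms m = {Poly_Mapping.single i a | i a. i \<in> {1..m} \<and> a \<in> monomials}"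

definition terms_of :: "('v, 'k::field) pol \<Rightarrow> ('v, 'k) pol set" where
  "terms_of f = {Poly_Mapping.single x (Poly_Mapping.lookup f x) | x. x \<in> Poly_Mapping.keys f}"

definition vterms_of :: "('v, 'k::field) fvec \<Rightarrow> ('v, 'k) fvec set" where
  "vterms_of u = {Poly_Mapping.single i t | i t.
     i \<in> Poly_Mapping.keys u \<and> t \<in> terms_of (Poly_Mapping.lookup u i)}"

section \<open>Term orders, lead terms, signatures\<close>

text \<open>
  The notions common to the ring and to the module take the scalar multiplication as an
  argument: it is \<open>(*)\<close> for the ring and \<open>vscale\<close> for the module.
\<close>

definition simeq :: "(('v, 'k::field) pol \<Rightarrow> 'a \<Rightarrow> 'a) \<Rightarrow> 'a \<Rightarrow> 'a \<Rightarrow> bool" where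
  "simeq scale s t \<longleftrightarrow> (\<exists>c. c \<noteq> 0 \<and> s = scale (Poly_Mapping.single 0 c) t)"

definition strict_of :: "('a \<Rightarrow> 'a \<Rightarrow> bool) \<Rightarrow> 'a \<Rightarrow> 'a \<Rightarrow> bool" where
  "strict_of le s t \<longleftrightarrow> le s t \<and> \<not> le t s"

text \<open>
  A term order ignores coefficients, so on terms it is only a total preorder whose associated
  equivalence is equality up to a nonzero scalar.
\<close>

definition term_order_on ::
  "(('v, 'k::field) pol \<Rightarrow> 'a::zero \<Rightarrow> 'a) \<Rightarrow> 'a set \<Rightarrow> ('a \<Rightarrow> 'a \<Rightarrow> bool) \<Rightarrow> bool" where
  "term_order_on scale TT le \<longleftrightarrow>
     reflp_on (insert 0 TT) le \<and> transp_on (insert 0 TT) le \<and> totalp_on (insert 0 TT) le \<and>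
     (\<forall>s\<in>TT. \<forall>t\<in>TT. le s t \<and> le t s \<longleftrightarrow> simeq scale s t) \<and>
     (\<forall>a\<in>monomials. \<forall>s\<in>TT. \<forall>t\<in>TT. le s t \<longrightarrow> le (scale a s) (scale a t)) \<and>
     wfp_on TT (strict_of le) \<and>
     (\<forall>t\<in>TT. strict_of le 0 t)"

definition compatible_orders ::
  "nat \<Rightarrow> (('v, 'k::field) pol \<Rightarrow> ('v, 'k) pol \<Rightarrow> bool) \<Rightarrow>
    (('v, 'k) fvec \<Rightarrow> ('v, 'k) fvec \<Rightarrow> bool) \<Rightarrow> bool" where
  "compatible_orders m leR leM \<longleftrightarrow>
     (\<forall>a\<in>monomials. \<forall>b\<in>monomials. \<forall>i\<in>{1..m}.
        leR a b \<longleftrightarrow> leM (Poly_Mapping.single i a) (Poly_Mapping.single i b))"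

definition max_term :: "('a \<Rightarrow> 'a \<Rightarrow> bool) \<Rightarrow> 'a::zero set \<Rightarrow> 'a" where
  "max_term le A = (if A = {} then 0 else (THE t. t \<in> A \<and> (\<forall>s\<in>A. le s t)))"

definition lead_term ::
  "(('v, 'k::field) pol \<Rightarrow> ('v, 'k) pol \<Rightarrow> bool) \<Rightarrow> ('v, 'k) pol \<Rightarrow> ('v, 'k) pol" where
  "lead_term leR f = max_term leR (terms_of f)"

definition signature ::
  "(('v, 'k::field) fvec \<Rightarrow> ('v, 'k) fvec \<Rightarrow> bool) \<Rightarrow> ('v, 'k) fvec \<Rightarrow> ('v, 'k) fvec" where
  "signature leM u = max_term leM (vterms_of u)"

definition term_dvd :: "('v, 'k::field) fvec \<Rightarrow> ('v, 'k) fvec \<Rightarrow> bool" where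
  "term_dvd S T \<longleftrightarrow> (\<exists>a\<in>monomials. T = vscale a S)"

definition poly_image :: "(nat \<Rightarrow> ('v, 'k::field) pol) \<Rightarrow> ('v, 'k) fvec \<Rightarrow> ('v, 'k) pol" where
  "poly_image g u = (\<Sum>i\<in>Poly_Mapping.keys u. Poly_Mapping.lookup u i * g i)"

text \<open>Only meaningful if \<open>t\<close> is a monomial.\<close>

definition expo :: "('v, 'k::field) pol \<Rightarrow> 'v \<Rightarrow>\<^sub>0 nat" where
  "expo t = (THE x. Poly_Mapping.keys t = {x})"

definition coef :: "('v, 'k::field) pol \<Rightarrow> 'k" where
  "coef t = Poly_Mapping.lookup t (expo t)"

text \<open>Subtraction of exponent vectors is truncated, so this is the pointwise minimum.\<close>

definition pp_gcd :: "('v \<Rightarrow>\<^sub>0 nat) \<Rightarrow> ('v \<Rightarrow>\<^sub>0 nat) \<Rightarrow> ('v \<Rightarrow>\<^sub>0 nat)" where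
  "pp_gcd x y = x - (x - y)"

lemma lookup_pp_gcd:
  "Poly_Mapping.lookup (pp_gcd x y) v = min (Poly_Mapping.lookup x v) (Poly_Mapping.lookup y v)"
  by (simp add: pp_gcd_def lookup_minus)

definition term_gcd :: "('v, 'k::field) pol \<Rightarrow> ('v, 'k) pol \<Rightarrow> ('v, 'k) pol" where
  "term_gcd s t = Poly_Mapping.single (pp_gcd (expo s) (expo t)) 1"

text \<open>The quotient of two terms; only meaningful if \<open>d\<close> divides \<open>t\<close>.\<close>

definition term_div :: "('v, 'k::field) pol \<Rightarrow> ('v, 'k) pol \<Rightarrow> ('v, 'k) pol" where
  "term_div t d = Poly_Mapping.single (expo t - expo d) (coef t / coef d)"

section \<open>Extended bases and reduction\<close>

text \<open>
  A basis \<open>g\<^sub>1, \<dots>, g\<^sub>n\<close> extending the input, together with the values \<open>\<phi>(e\<^sub>i)\<close>, which determine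
  the linear map \<open>\<phi>\<close>. Values of the two functions outside \<open>{1..n}\<close> are irrelevant.
\<close>

record (overloaded) ('v, 'k) ext_basis =
  bsize :: nat
  bgen :: "nat \<Rightarrow> ('v \<Rightarrow>\<^sub>0 nat) \<Rightarrow>\<^sub>0 ('k::zero)"
  bphi :: "nat \<Rightarrow> nat \<Rightarrow>\<^sub>0 ('v \<Rightarrow>\<^sub>0 nat) \<Rightarrow>\<^sub>0 ('k::zero)"

definition phi :: "('v, 'k::field) ext_basis \<Rightarrow> ('v, 'k) fvec \<Rightarrow> ('v, 'k) fvec" where
  "phi B u = (\<Sum>i\<in>Poly_Mapping.keys u. vscale (Poly_Mapping.lookup u i) (bphi B i))"

definition sig ::
  "(('v, 'k::field) fvec \<Rightarrow> ('v, 'k) fvec \<Rightarrow> bool) \<Rightarrow> ('v, 'k) ext_basis \<Rightarrow>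
    ('v, 'k) fvec \<Rightarrow> ('v, 'k) fvec" where
  "sig leM B u = signature leM (phi B u)"

text \<open>\<open>a e\<^sub>i\<close> reduces the term \<open>t\<close> of the image of \<open>u\<close>.\<close>

definition s_reduces ::
  "(('v, 'k::field) pol \<Rightarrow> ('v, 'k) pol \<Rightarrow> bool) \<Rightarrow>
   (('v, 'k) fvec \<Rightarrow> ('v, 'k) fvec \<Rightarrow> bool) \<Rightarrow> ('v, 'k) ext_basis \<Rightarrow>
   ('v, 'k) pol \<Rightarrow> nat \<Rightarrow> ('v, 'k) fvec \<Rightarrow> ('v, 'k) pol \<Rightarrow> bool" where
  "s_reduces leR leM B a i u t \<longleftrightarrow>
     a \<in> monomials \<and> i \<in> {1..bsize B} \<and> t \<in> terms_of (poly_image (bgen B) u) \<and>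
     lead_term leR (poly_image (bgen B) (Poly_Mapping.single i a)) = t \<and>
     leM (sig leM B (Poly_Mapping.single i a)) (sig leM B u)"

definition regular_reduces ::
  "(('v, 'k::field) pol \<Rightarrow> ('v, 'k) pol \<Rightarrow> bool) \<Rightarrow>
   (('v, 'k) fvec \<Rightarrow> ('v, 'k) fvec \<Rightarrow> bool) \<Rightarrow> ('v, 'k) ext_basis \<Rightarrow>
   ('v, 'k) pol \<Rightarrow> nat \<Rightarrow> ('v, 'k) fvec \<Rightarrow> ('v, 'k) pol \<Rightarrow> bool" where
  "regular_reduces leR leM B a i u t \<longleftrightarrow>
     s_reduces leR leM B a i u t \<and>
     strict_of leM (sig leM B (Poly_Mapping.single i a)) (sig leM B u)"

definition singular_reduces ::
  "(('v, 'k::field) pol \<Rightarrow> ('v, 'k) pol \<Rightarrow> bool) \<Rightarrow>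
   (('v, 'k) fvec \<Rightarrow> ('v, 'k) fvec \<Rightarrow> bool) \<Rightarrow> ('v, 'k) ext_basis \<Rightarrow>
   ('v, 'k) pol \<Rightarrow> nat \<Rightarrow> ('v, 'k) fvec \<Rightarrow> ('v, 'k) pol \<Rightarrow> bool" where
  "singular_reduces leR leM B a i u t \<longleftrightarrow>
     s_reduces leR leM B a i u t \<and>
     simeq vscale (sig leM B (Poly_Mapping.single i a)) (sig leM B u)"

definition regular_step ::
  "(('v, 'k::field) pol \<Rightarrow> ('v, 'k) pol \<Rightarrow> bool) \<Rightarrow>
   (('v, 'k) fvec \<Rightarrow> ('v, 'k) fvec \<Rightarrow> bool) \<Rightarrow> ('v, 'k) ext_basis \<Rightarrow>
   ('v, 'k) fvec \<Rightarrow> ('v, 'k) fvec \<Rightarrow> bool" where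
  "regular_step leR leM B u u' \<longleftrightarrow>
     (\<exists>a i t. regular_reduces leR leM B a i u t \<and> u' = u - Poly_Mapping.single i a)"

definition regular_reduced ::
  "(('v, 'k::field) pol \<Rightarrow> ('v, 'k) pol \<Rightarrow> bool) \<Rightarrow>
   (('v, 'k) fvec \<Rightarrow> ('v, 'k) fvec \<Rightarrow> bool) \<Rightarrow> ('v, 'k) ext_basis \<Rightarrow>
   ('v, 'k) fvec \<Rightarrow> bool" where
  "regular_reduced leR leM B u \<longleftrightarrow> \<not> (\<exists>a i t. regular_reduces leR leM B a i u t)"

definition regular_top_reducible ::
  "(('v, 'k::field) pol \<Rightarrow> ('v, 'k) pol \<Rightarrow> bool) \<Rightarrow>
   (('v, 'k) fvec \<Rightarrow> ('v, 'k) fvec \<Rightarrow> bool) \<Rightarrow> ('v, 'k) ext_basis \<Rightarrow>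
   ('v, 'k) fvec \<Rightarrow> bool" where
  "regular_top_reducible leR leM B u \<longleftrightarrow>
     (\<exists>a i. regular_reduces leR leM B a i u (lead_term leR (poly_image (bgen B) u)))"

definition singular_top_reducible ::
  "(('v, 'k::field) pol \<Rightarrow> ('v, 'k) pol \<Rightarrow> bool) \<Rightarrow>
   (('v, 'k) fvec \<Rightarrow> ('v, 'k) fvec \<Rightarrow> bool) \<Rightarrow> ('v, 'k) ext_basis \<Rightarrow>
   ('v, 'k) fvec \<Rightarrow> bool" where
  "singular_top_reducible leR leM B u \<longleftrightarrow>
     (\<exists>a i. singular_reduces leR leM B a i u (lead_term leR (poly_image (bgen B) u)))"

text \<open>Regular reduction is not deterministic: \<open>p'\<close> is one possible result for \<open>u\<close>.\<close>

definition regular_reduction_result ::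
  "(('v, 'k::field) pol \<Rightarrow> ('v, 'k) pol \<Rightarrow> bool) \<Rightarrow>
   (('v, 'k) fvec \<Rightarrow> ('v, 'k) fvec \<Rightarrow> bool) \<Rightarrow> ('v, 'k) ext_basis \<Rightarrow>
   ('v, 'k) fvec \<Rightarrow> ('v, 'k) fvec \<Rightarrow> bool" where
  "regular_reduction_result leR leM B u p' \<longleftrightarrow>
     (regular_step leR leM B)\<^sup>*\<^sup>* u p' \<and> regular_reduced leR leM B p'"

section \<open>S-pairs and Koszul syzygies\<close>

definition spair_left ::
  "(('v, 'k::field) pol \<Rightarrow> ('v, 'k) pol \<Rightarrow> bool) \<Rightarrow> ('v, 'k) ext_basis \<Rightarrow>
    nat \<times> nat \<Rightarrow> ('v, 'k) fvec" where
  "spair_left leR B = (\<lambda>(i, j).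
     let s = lead_term leR (bgen B i); t = lead_term leR (bgen B j)
     in Poly_Mapping.single i (term_div t (term_gcd s t)))"

definition spair_right ::
  "(('v, 'k::field) pol \<Rightarrow> ('v, 'k) pol \<Rightarrow> bool) \<Rightarrow> ('v, 'k) ext_basis \<Rightarrow>
    nat \<times> nat \<Rightarrow> ('v, 'k) fvec" where
  "spair_right leR B = (\<lambda>(i, j).
     let s = lead_term leR (bgen B i); t = lead_term leR (bgen B j)
     in Poly_Mapping.single j (term_div s (term_gcd s t)))"

definition spair ::
  "(('v, 'k::field) pol \<Rightarrow> ('v, 'k) pol \<Rightarrow> bool) \<Rightarrow> ('v, 'k) ext_basis \<Rightarrow>
    nat \<times> nat \<Rightarrow> ('v, 'k) fvec" where
  "spair leR B p = spair_left leR B p - spair_right leR B p"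

definition regular_spair ::
  "(('v, 'k::field) pol \<Rightarrow> ('v, 'k) pol \<Rightarrow> bool) \<Rightarrow>
   (('v, 'k) fvec \<Rightarrow> ('v, 'k) fvec \<Rightarrow> bool) \<Rightarrow> ('v, 'k) ext_basis \<Rightarrow> nat \<times> nat \<Rightarrow> bool" where
  "regular_spair leR leM B p \<longleftrightarrow>
     \<not> simeq vscale (sig leM B (spair_left leR B p)) (sig leM B (spair_right leR B p))"

definition koszul :: "('v, 'k::field) ext_basis \<Rightarrow> nat \<Rightarrow> nat \<Rightarrow> ('v, 'k) fvec" where
  "koszul B i j = Poly_Mapping.single i (bgen B j) - Poly_Mapping.single j (bgen B i)"

definition regular_koszul ::
  "(('v, 'k::field) fvec \<Rightarrow> ('v, 'k) fvec \<Rightarrow> bool) \<Rightarrow> ('v, 'k) ext_basis \<Rightarrow>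
    nat \<Rightarrow> nat \<Rightarrow> bool" where
  "regular_koszul leM B i j \<longleftrightarrow>
     \<not> simeq vscale (sig leM B (Poly_Mapping.single i (bgen B j)))
                    (sig leM B (Poly_Mapping.single j (bgen B i)))"

definition koszul_signature ::
  "(('v, 'k::field) fvec \<Rightarrow> ('v, 'k) fvec \<Rightarrow> bool) \<Rightarrow> ('v, 'k) ext_basis \<Rightarrow>
    ('v, 'k) fvec \<Rightarrow> bool" where
  "koszul_signature leM B T \<longleftrightarrow>
     (\<exists>i\<in>{1..bsize B}. \<exists>j\<in>{1..bsize B}.
        regular_koszul leM B i j \<and> simeq vscale T (sig leM B (koszul B i j)))"

section \<open>The algorithm SB\<close>

text \<open>
  S-pairs are represented by their indices \<open>(i, j)\<close> with \<open>i < j\<close>; exchanging the indices only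
  changes the sign. The field \<open>syzs\<close> contains the known syzygy signatures, and
  \<open>reductions\<close> records, in chronological order, the S-pairs for which a reduction is carried
  out, each with the result of regular reducing it.
\<close>

record (overloaded) ('v, 'k) sb_state =
  basis :: "('v, 'k::zero) ext_basis"
  pairs :: "(nat \<times> nat) set"
  syzs :: "(nat \<Rightarrow>\<^sub>0 ('v \<Rightarrow>\<^sub>0 nat) \<Rightarrow>\<^sub>0 ('k::zero)) set"
  reductions :: "((nat \<times> nat) \<times> (nat \<Rightarrow>\<^sub>0 ('v \<Rightarrow>\<^sub>0 nat) \<Rightarrow>\<^sub>0 ('k::zero))) list"

definition input_basis :: "nat \<Rightarrow> (nat \<Rightarrow> ('v, 'k::field) pol) \<Rightarrow> ('v, 'k) ext_basis" where
  "input_basis m g = \<lparr>bsize = m, bgen = g, bphi = (\<lambda>i. Poly_Mapping.single i 1)\<rparr>"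

definition add_element ::
  "('v, 'k::field) ext_basis \<Rightarrow> ('v, 'k) fvec \<Rightarrow> ('v, 'k) ext_basis" where
  "add_element B p =
     \<lparr>bsize = Suc (bsize B),
      bgen = (bgen B)(Suc (bsize B) := poly_image (bgen B) p),
      bphi = (bphi B)(Suc (bsize B) := phi B p)\<rparr>"

definition sb_init ::
  "(('v, 'k::field) pol \<Rightarrow> ('v, 'k) pol \<Rightarrow> bool) \<Rightarrow>
   (('v, 'k) fvec \<Rightarrow> ('v, 'k) fvec \<Rightarrow> bool) \<Rightarrow> nat \<Rightarrow> (nat \<Rightarrow> ('v, 'k) pol) \<Rightarrow>
   ('v, 'k) sb_state" where
  "sb_init leR leM m g =
     \<lparr>basis = input_basis m g,
      pairs = {(i, j) | i j. 1 \<le> i \<and> i < j \<and> j \<le> m \<and>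
                 regular_spair leR leM (input_basis m g) (i, j)},
      syzs = {},
      reductions = []\<rparr>"

definition minimal_pair ::
  "(('v, 'k::field) pol \<Rightarrow> ('v, 'k) pol \<Rightarrow> bool) \<Rightarrow>
   (('v, 'k) fvec \<Rightarrow> ('v, 'k) fvec \<Rightarrow> bool) \<Rightarrow> ('v, 'k) sb_state \<Rightarrow> nat \<times> nat \<Rightarrow> bool" where
  "minimal_pair leR leM st p \<longleftrightarrow> p \<in> pairs st \<and>
     (\<forall>q\<in>pairs st. leM (sig leM (basis st) (spair leR (basis st) p))
                       (sig leM (basis st) (spair leR (basis st) q)))"

definition remaining_pairs ::
  "(('v, 'k::field) pol \<Rightarrow> ('v, 'k) pol \<Rightarrow> bool) \<Rightarrow>
   (('v, 'k) fvec \<Rightarrow> ('v, 'k) fvec \<Rightarrow> bool) \<Rightarrow> ('v, 'k) sb_state \<Rightarrow>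
   ('v, 'k) fvec \<Rightarrow> (nat \<times> nat) set" where
  "remaining_pairs leR leM st T =
     {q \<in> pairs st. \<not> simeq vscale (sig leM (basis st) (spair leR (basis st) q)) T}"

definition signature_criterion :: "('v, 'k::field) fvec set \<Rightarrow> ('v, 'k) fvec \<Rightarrow> bool" where
  "signature_criterion S T \<longleftrightarrow> (\<exists>s\<in>S. term_dvd s T)"

text \<open>
  The case of relatively prime lead terms is contained in \<open>koszul_signature\<close>: then the
  S-pair and the Koszul syzygy of the two basis elements have the same signature up to \<open>\<simeq>\<close>.
\<close>

definition singular_criterion ::
  "(('v, 'k::field) pol \<Rightarrow> ('v, 'k) pol \<Rightarrow> bool) \<Rightarrow>
   (('v, 'k) fvec \<Rightarrow> ('v, 'k) fvec \<Rightarrow> bool) \<Rightarrow> ('v, 'k) ext_basis \<Rightarrow>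
   ('v, 'k) fvec \<Rightarrow> bool" where
  "singular_criterion leR leM B T \<longleftrightarrow>
     (\<exists>t\<in>monomials. \<exists>i\<in>{1..bsize B}.
        sig leM B (Poly_Mapping.single i t) = T \<and>
        (\<forall>t'\<in>monomials. \<forall>i'\<in>{1..bsize B}. sig leM B (Poly_Mapping.single i' t') = T \<longrightarrow>
           leR (lead_term leR (poly_image (bgen B) (Poly_Mapping.single i t)))
               (lead_term leR (poly_image (bgen B) (Poly_Mapping.single i' t')))) \<and>
        \<not> regular_top_reducible leR leM B (Poly_Mapping.single i t))"

definition eliminated ::
  "(('v, 'k::field) pol \<Rightarrow> ('v, 'k) pol \<Rightarrow> bool) \<Rightarrow>
   (('v, 'k) fvec \<Rightarrow> ('v, 'k) fvec \<Rightarrow> bool) \<Rightarrow> ('v, 'k) sb_state \<Rightarrow>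
   ('v, 'k) fvec \<Rightarrow> bool" where
  "eliminated leR leM st T \<longleftrightarrow>
     signature_criterion (syzs st) T \<or> koszul_signature leM (basis st) T \<or>
     singular_criterion leR leM (basis st) T"

text \<open>
  One pass of the loop. The pair \<open>p\<close> provides the minimal signature \<open>T\<close>, and it is also
  the pair that is reduced, if any; as \<open>p\<close> ranges over all pairs of minimal signature, every
  choice of the reduced pair is covered. All pairs of signature \<open>T\<close> are removed.
\<close>

inductive sb_step ::
  "(('v, 'k::field) pol \<Rightarrow> ('v, 'k) pol \<Rightarrow> bool) \<Rightarrow>
   (('v, 'k) fvec \<Rightarrow> ('v, 'k) fvec \<Rightarrow> bool) \<Rightarrow>
   ('v, 'k) sb_state \<Rightarrow> ('v, 'k) sb_state \<Rightarrow> bool"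
  for leR leM where
  eliminate:
    "sb_step leR leM st
       (st\<lparr>pairs := remaining_pairs leR leM st T,
           syzs := (if koszul_signature leM (basis st) T then insert T (syzs st)
                    else syzs st)\<rparr>)"
    if "minimal_pair leR leM st p" "T = sig leM (basis st) (spair leR (basis st) p)"
      "eliminated leR leM st T"
| to_zero:
    "sb_step leR leM st
       (st\<lparr>pairs := remaining_pairs leR leM st T,
           syzs := insert T (syzs st),
           reductions := reductions st @ [(p, p')]\<rparr>)"
    if "minimal_pair leR leM st p" "T = sig leM (basis st) (spair leR (basis st) p)"
      "\<not> eliminated leR leM st T"
      "regular_reduction_result leR leM (basis st) (spair leR (basis st) p) p'"
      "poly_image (bgen (basis st)) p' = 0"
| singular:
    "sb_step leR leM st
       (st\<lparr>pairs := remaining_pairs leR leM st T,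
           reductions := reductions st @ [(p, p')]\<rparr>)"
    if "minimal_pair leR leM st p" "T = sig leM (basis st) (spair leR (basis st) p)"
      "\<not> eliminated leR leM st T"
      "regular_reduction_result leR leM (basis st) (spair leR (basis st) p) p'"
      "poly_image (bgen (basis st)) p' \<noteq> 0"
      "singular_top_reducible leR leM (basis st) p'"
| new_element:
    "sb_step leR leM st
       (st\<lparr>basis := B',
           pairs := remaining_pairs leR leM st T \<union>
             {(i, bsize B') | i. 1 \<le> i \<and> i < bsize B' \<and> regular_spair leR leM B' (i, bsize B')},
           reductions := reductions st @ [(p, p')]\<rparr>)"
    if "minimal_pair leR leM st p" "T = sig leM (basis st) (spair leR (basis st) p)"
      "\<not> eliminated leR leM st T"
      "regular_reduction_result leR leM (basis st) (spair leR (basis st) p) p'"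
      "poly_image (bgen (basis st)) p' \<noteq> 0"
      "\<not> singular_top_reducible leR leM (basis st) p'"
      "B' = add_element (basis st) p'"

definition sb_computes ::
  "(('v, 'k::field) pol \<Rightarrow> ('v, 'k) pol \<Rightarrow> bool) \<Rightarrow>
   (('v, 'k) fvec \<Rightarrow> ('v, 'k) fvec \<Rightarrow> bool) \<Rightarrow> nat \<Rightarrow> (nat \<Rightarrow> ('v, 'k) pol) \<Rightarrow>
   ('v, 'k) sb_state \<Rightarrow> bool" where
  "sb_computes leR leM m g st \<longleftrightarrow>
     (sb_step leR leM)\<^sup>*\<^sup>* (sb_init leR leM m g) st \<and> pairs st = {}"

section \<open>The initial submodule of the syzygies\<close>

definition initial_syzygies ::
  "(('v, 'k::field) fvec \<Rightarrow> ('v, 'k) fvec \<Rightarrow> bool) \<Rightarrow> nat \<Rightarrow> (nat \<Rightarrow> ('v, 'k) pol) \<Rightarrow>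
   ('v, 'k) fvec set" where
  "initial_syzygies leM m g =
     module.span vscale {signature leM u | u. u \<in> free_module m \<and> poly_image g u = 0}"

text \<open>
  The minimal generators of a submodule generated by terms are the elements of its minimal
  generating sets consisting of terms; these sets agree up to nonzero scalars.
\<close>

definition minimal_generator :: "nat \<Rightarrow> ('v, 'k::field) fvec set \<Rightarrow> ('v, 'k) fvec \<Rightarrow> bool" where
  "minimal_generator m H T \<longleftrightarrow>
     (\<exists>X. X \<subseteq> module_terms m \<and> module.span vscale X = H \<and>
          (\<forall>Y. Y \<subset> X \<longrightarrow> module.span vscale Y \<noteq> H) \<and> T \<in> X)"

section \<open>What a reduction accounts for\<close>

text \<open>
  For an entry \<open>(p, p')\<close> of \<open>reductions\<close> and the final basis \<open>B\<close>. Steps of the algorithm do not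
  change existing basis elements, so the signature of \<open>p\<close> with respect to the final basis is the
  one it had when it was reduced.
\<close>

definition yields_element ::
  "('v, 'k::field) ext_basis \<Rightarrow> (nat \<times> nat) \<times> ('v, 'k) fvec \<Rightarrow> nat \<Rightarrow> bool" where
  "yields_element B r i \<longleftrightarrow>
     phi B (snd r) = phi B (Poly_Mapping.single i 1) \<and> poly_image (bgen B) (snd r) = bgen B i"

definition yields_syzygy ::
  "(('v, 'k::field) pol \<Rightarrow> ('v, 'k) pol \<Rightarrow> bool) \<Rightarrow>
   (('v, 'k) fvec \<Rightarrow> ('v, 'k) fvec \<Rightarrow> bool) \<Rightarrow> ('v, 'k) ext_basis \<Rightarrow>
   (nat \<times> nat) \<times> ('v, 'k) fvec \<Rightarrow> ('v, 'k) fvec \<Rightarrow> bool" where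
  "yields_syzygy leR leM B r T \<longleftrightarrow>
     simeq vscale (sig leM B (spair leR B (fst r))) T \<and> poly_image (bgen B) (snd r) = 0"

end

theory Submission
  imports Defs
begin

text \<open>
  Two elements of equal signature \<open>S\<close> can be rescaled so that their difference has smaller
  signature. Hence, if the basis is a signature Groebner basis below \<open>S\<close> and the two images have
  different lead terms, the larger lead term can be reduced regularly. Apply this to an element
  and to the multiple of a basis element of signature \<open>S\<close> with the least lead term. If that
  multiple is regular top reducible, the reducer yields an S-pair whose signature divides \<open>S\<close>; an
  S-pair that has been dealt with either has a signature divisible by a known syzygy signature or
  contradicts the choice of the multiple. By induction the basis is a signature Groebner basis
  below the pending S-pairs, and every initial syzygy term there is divisible by a known one.

  Consequently a reduction to zero at signature \<open>T\<close> that passes the criteria makes \<open>T\<close> a minimal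
  generator, a nonzero result is never singular top reducible, and \<open>T\<close> stays different from all
  later Koszul signatures because signatures strictly increase. Conversely, at the end every
  minimal generator is a known syzygy signature, that is, a Koszul signature or a reduction to zero.
\<close>

section \<open>Maximal exponents\<close>

text \<open>Term orders ignore coefficients, so on terms they are only preorders, and signatures
  matter only up to a scalar. The argument therefore moves to exponents: a module term becomes a
  pair of index and power product, \<open>\<simeq>\<close> becomes equality, divisibility becomes
  \<open>shift\<close>, and both orders become well-founded linear orders, on all power products and
  on the pairs with index in \<open>{1..m}\<close>. This locale abstracts from the two, with
  \<open>D\<close> as the carrier. The criteria discard S-pairs without reducing them, so no
  standard representation of such a pair is at hand, and meanwhile the basis grows. Each treated
  pair instead leaves a certificate (\<open>resolved\<close>) that survives enlarging the basis and
  the set of known syzygies. What has to be re-proved as the basis grows is that a reduction to zero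
  does not become a Koszul signature: a Koszul signature involving a new element is at least the
  signature of that element, which exceeds all signatures reduced earlier. The same strict growth
  turns each of the claimed counts into a unique position in the list.\<close>

locale well_linear_on =
  fixes D :: "'i set" and le :: "'i \<Rightarrow> 'i \<Rightarrow> bool"
  assumes total: "p \<in> D \<Longrightarrow> q \<in> D \<Longrightarrow> le p q \<or> le q p"
    and antisym: "p \<in> D \<Longrightarrow> q \<in> D \<Longrightarrow> le p q \<Longrightarrow> le q p \<Longrightarrow> p = q"
    and trans: "p \<in> D \<Longrightarrow> q \<in> D \<Longrightarrow> r \<in> D \<Longrightarrow> le p q \<Longrightarrow> le q r \<Longrightarrow> le p r"
    and wf: "wfp_on D (\<lambda>p q. le p q \<and> p \<noteq> q)"
begin

definition lt :: "'i \<Rightarrow> 'i \<Rightarrow> bool" where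
  "lt p q \<longleftrightarrow> le p q \<and> p \<noteq> q"

definition greater :: "'i \<Rightarrow> 'i \<Rightarrow> 'i" where
  "greater p q = (if le p q then q else p)"

definition top :: "('i \<Rightarrow> 'c::zero) \<Rightarrow> 'i" where
  "top f = (THE p. f p \<noteq> 0 \<and> (\<forall>q. f q \<noteq> 0 \<longrightarrow> le q p))"

definition fin_on :: "('i \<Rightarrow> 'c::zero) \<Rightarrow> bool" where
  "fin_on f \<longleftrightarrow> finite {p. f p \<noteq> 0} \<and> {p. f p \<noteq> 0} \<subseteq> D"

lemma refl: "p \<in> D \<Longrightarrow> le p p"
  using total by blast

lemma not_le: "p \<in> D \<Longrightarrow> q \<in> D \<Longrightarrow> \<not> le p q \<longleftrightarrow> lt q p"
  unfolding lt_def using total antisym by blast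

lemma not_lt: "p \<in> D \<Longrightarrow> q \<in> D \<Longrightarrow> \<not> lt p q \<longleftrightarrow> le q p"
  using not_le by blast

lemma le_lt_trans: "p \<in> D \<Longrightarrow> q \<in> D \<Longrightarrow> r \<in> D \<Longrightarrow> le p q \<Longrightarrow> lt q r \<Longrightarrow> lt p r"
  unfolding lt_def using trans antisym by blast

lemma lt_le_trans: "p \<in> D \<Longrightarrow> q \<in> D \<Longrightarrow> r \<in> D \<Longrightarrow> lt p q \<Longrightarrow> le q r \<Longrightarrow> lt p r"
  unfolding lt_def using trans antisym by blast

lemma lt_irrefl [simp]: "\<not> lt p p"
  by (simp add: lt_def)

lemma lt_imp_le: "lt p q \<Longrightarrow> le p q"
  by (simp add: lt_def)

lemma cases_order:
  assumes "p \<in> D" "q \<in> D"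
  obtains "lt p q" | "p = q" | "lt q p"
  using total[OF assms] unfolding lt_def by blast

lemma induct_lt [consumes 1, case_names less]:
  assumes "p \<in> D" and "\<And>q. q \<in> D \<Longrightarrow> (\<And>r. r \<in> D \<Longrightarrow> lt r q \<Longrightarrow> P r) \<Longrightarrow> P q"
  shows "P p"
  using wf assms(1)
proof (induction rule: wfp_on_induct)
  case (less p)
  show ?case by (rule assms(2)[OF less(1)]) (simp add: less lt_def)
qed (rule assms(1))

lemma ex_least:
  assumes "A \<subseteq> D" "A \<noteq> {}"
  shows "\<exists>p\<in>A. \<forall>q\<in>A. le p q"
proof -
  obtain p where "p \<in> A" "\<forall>q. lt q p \<longrightarrow> q \<notin> A"
    using wf assms unfolding wfp_on_iff_ex_minimal lt_def by blast
  then show ?thesis using not_lt assms by blast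
qed

lemma ex_greatest:
  assumes "finite A" "A \<noteq> {}" "A \<subseteq> D"
  shows "\<exists>p\<in>A. \<forall>q\<in>A. le q p"
  using assms
proof (induction rule: finite_ne_induct)
  case (singleton x)
  then show ?case using refl by simp
next
  case (insert x A)
  then obtain p where p: "p \<in> A" "\<forall>q\<in>A. le q p" by blast
  have D: "x \<in> D" "p \<in> D" "A \<subseteq> D" using insert.prems p(1) by blast+
  show ?case
  proof (cases "le x p")
    case True
    with p show ?thesis by blast
  next
    case False
    then have "le p x" using total[OF D(1,2)] by blast
    then have "le q x" if "q \<in> A" for q
      using trans[of q p x] p(2) D that by blast
    with refl[OF D(1)] show ?thesis by blast
  qed
qed

lemma top_eqI:
  assumes "fin_on f" "f p \<noteq> 0" "\<And>q. f q \<noteq> 0 \<Longrightarrow> le q p"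
  shows "top f = p"
  unfolding top_def
proof (rule the_equality)
  fix q assume q: "f q \<noteq> 0 \<and> (\<forall>r. f r \<noteq> 0 \<longrightarrow> le r q)"
  moreover have "p \<in> D" "q \<in> D" using assms q by (auto simp: fin_on_def)
  ultimately show "q = p" using assms antisym by blast
qed (use assms in blast)

lemma ex_top:
  assumes "fin_on f" "f q \<noteq> 0"
  shows "f (top f) \<noteq> 0 \<and> le q (top f)"
proof -
  obtain p where p: "f p \<noteq> 0" "\<forall>q. f q \<noteq> 0 \<longrightarrow> le q p"
    using ex_greatest[of "{p. f p \<noteq> 0}"] assms unfolding fin_on_def by blast
  then have "top f = p" using assms by (intro top_eqI) auto
  with p assms show ?thesis by blast
qed

lemmas top_nonzero = ex_top[THEN conjunct1]
  and le_top = ex_top[THEN conjunct2]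

text \<open>Terms strictly below the top neither move it nor touch its coefficient. Lead exponents
  in the ring and signature exponents in the module both rest on this.\<close>

lemma top_combine:
  fixes f g h :: "'i \<Rightarrow> 'c::field"
  assumes f: "fin_on f" "f p \<noteq> 0" and h: "fin_on h" and a: "a \<noteq> 0"
    and g: "\<And>q. g q \<noteq> 0 \<Longrightarrow> lt q (top f)" and eq: "\<And>q. h q = a * f q + b * g q"
  shows "top h = top f" and "h (top f) = a * f (top f)"
proof -
  have "g (top f) = 0" using g by fastforce
  then show *: "h (top f) = a * f (top f)" using eq by simp
  show "top h = top f"
  proof (rule top_eqI[OF h])
    show "h (top f) \<noteq> 0" using * a top_nonzero[OF f] by simp
    fix q assume "h q \<noteq> 0"
    then have "f q \<noteq> 0 \<or> g q \<noteq> 0" using eq by auto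
    then show "le q (top f)" using le_top[OF f(1)] g lt_imp_le by blast
  qed
qed

text \<open>With a common top and a vanishing coefficient there, every remaining position lies
  strictly below. This is how a signature gets lowered.\<close>

lemma lt_top_cancel:
  fixes f g h :: "'i \<Rightarrow> 'c::field"
  assumes f: "fin_on f" and g: "fin_on g" and h: "fin_on h" "h p \<noteq> 0"
    and tops: "top f = top g" and eq: "\<And>q. h q = a * f q + b * g q" and "h (top f) = 0"
  shows "lt (top h) (top f)"
proof -
  have "h (top h) \<noteq> 0" by (rule top_nonzero[OF h])
  moreover from this have "le (top h) (top f)"
    using eq[of "top h"] le_top[OF f, of "top h"] le_top[OF g, of "top h"] tops
    by (cases "f (top h) = 0") auto
  ultimately show ?thesis using assms by (auto simp: lt_def)
qed

end

text \<open>Splitting off the entries at \<open>x\<close> and \<open>y\<close> writes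
  \<open>f * g\<close> as the product of these entries plus two products whose supports avoid
  \<open>x + y\<close>. Uniqueness of the decomposition takes the place of an order, so one
  statement serves scalars, lead terms and signatures.\<close>

lemma lookup_mult_unique_sum:
  fixes f g :: "'a::monoid_add \<Rightarrow>\<^sub>0 'c::ring_1"
  assumes "\<And>x' y'. x' \<in> Poly_Mapping.keys f \<Longrightarrow> y' \<in> Poly_Mapping.keys g \<Longrightarrow> x' + y' = x + y
            \<Longrightarrow> x' = x \<and> y' = y"
  shows "Poly_Mapping.lookup (f * g) (x + y) = Poly_Mapping.lookup f x * Poly_Mapping.lookup g y"
proof -
  let ?sx = "Poly_Mapping.single x (Poly_Mapping.lookup f x)"
  let ?sy = "Poly_Mapping.single y (Poly_Mapping.lookup g y)"
  let ?f = "f - ?sx" and ?g = "g - ?sy"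
  have f: "z \<in> Poly_Mapping.keys f \<and> z \<noteq> x" if "z \<in> Poly_Mapping.keys ?f" for z
    using that by (auto simp: in_keys_iff lookup_minus lookup_single when_def split: if_splits)
  have g: "z \<in> Poly_Mapping.keys g \<and> z \<noteq> y" if "z \<in> Poly_Mapping.keys ?g" for z
    using that by (auto simp: in_keys_iff lookup_minus lookup_single when_def split: if_splits)
  have 1: "x + y \<notin> Poly_Mapping.keys (?f * g)"
  proof
    assume "x + y \<in> Poly_Mapping.keys (?f * g)"
    then obtain x' y' where "x' \<in> Poly_Mapping.keys ?f" "y' \<in> Poly_Mapping.keys g" "x' + y' = x + y"
      using keys_mult[of ?f g] by auto
    then show False using f assms by blast
  qed
  have 2: "x + y \<notin> Poly_Mapping.keys (?sx * ?g)"
  proof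
    assume "x + y \<in> Poly_Mapping.keys (?sx * ?g)"
    then obtain x' y' where "x' \<in> Poly_Mapping.keys ?sx" "y' \<in> Poly_Mapping.keys ?g" "x' + y' = x + y"
      using keys_mult[of ?sx ?g] by auto
    moreover from this have "x' \<in> Poly_Mapping.keys f" by (auto simp: in_keys_iff lookup_single when_def split: if_splits)
    ultimately show False using g assms by blast
  qed
  have "f * g = ?sx * ?sy + ?sx * ?g + ?f * g"
    unfolding right_diff_distrib left_diff_distrib by simp
  from arg_cong[OF this, of "\<lambda>h. Poly_Mapping.lookup h (x + y)"]
  have "Poly_Mapping.lookup (f * g) (x + y) =
      Poly_Mapping.lookup (?sx * ?sy) (x + y) + Poly_Mapping.lookup (?sx * ?g) (x + y) +
      Poly_Mapping.lookup (?f * g) (x + y)"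
    unfolding lookup_add .
  also have "Poly_Mapping.lookup (?f * g) (x + y) = 0"
    using 1 unfolding in_keys_iff by blast
  also have "Poly_Mapping.lookup (?sx * ?g) (x + y) = 0"
    using 2 unfolding in_keys_iff by blast
  finally show ?thesis unfolding mult_single by simp
qed

section \<open>Terms and their exponents\<close>

text \<open>Keeping the exponent pair apart from the coefficient turns \<open>\<simeq>\<close> into
  equality of pairs.\<close>

definition mterm :: "nat \<times> ('v \<Rightarrow>\<^sub>0 nat) \<Rightarrow> 'k::field \<Rightarrow> ('v, 'k) fvec" where
  "mterm p c = Poly_Mapping.single (fst p) (Poly_Mapping.single (snd p) c)"

text \<open>On exponent pairs this is multiplication by the power product \<open>x\<close>; a term
  divides another exactly when the pair of the second is a \<open>shift\<close> of the pair of the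
  first.\<close>

definition shift :: "nat \<times> ('v \<Rightarrow>\<^sub>0 nat) \<Rightarrow> ('v \<Rightarrow>\<^sub>0 nat) \<Rightarrow> nat \<times> ('v \<Rightarrow>\<^sub>0 nat)" where
  "shift p x = (fst p, snd p + x)"

definition mdom :: "nat \<Rightarrow> (nat \<times> ('v \<Rightarrow>\<^sub>0 nat)) set" where
  "mdom m = {1..m} \<times> UNIV"

definition vcoef :: "('v, 'k::field) fvec \<Rightarrow> nat \<times> ('v \<Rightarrow>\<^sub>0 nat) \<Rightarrow> 'k" where
  "vcoef u p = Poly_Mapping.lookup (Poly_Mapping.lookup u (fst p)) (snd p)"

lemma shift_0 [simp]: "shift p 0 = p"
  and shift_shift [simp]: "shift (shift p x) y = shift p (x + y)"
  and shift_inject [simp]: "shift p x = shift p y \<longleftrightarrow> x = y"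
  and shift_inject_left [simp]: "shift p x = shift q x \<longleftrightarrow> p = q"
  and shift_in_mdom [simp]: "shift p x \<in> mdom m \<longleftrightarrow> p \<in> mdom m"
  by (auto simp: shift_def mdom_def algebra_simps prod_eq_iff mem_Times_iff)

lemma monomials_iff: "a \<in> monomials \<longleftrightarrow> (\<exists>x c. c \<noteq> 0 \<and> a = Poly_Mapping.single x c)"
  by (auto simp: monomials_def)

lemma single_eq_iff:
  assumes "c \<noteq> 0"
  shows "Poly_Mapping.single x c = Poly_Mapping.single y d \<longleftrightarrow> x = y \<and> c = d"
proof
  assume *: "Poly_Mapping.single x c = Poly_Mapping.single y d"
  then have "Poly_Mapping.lookup (Poly_Mapping.single y d) x = c" by (metis lookup_single_eq)
  with assms show "x = y \<and> c = d" by (auto simp: lookup_single when_def split: if_splits)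
qed auto

lemma single_in_monomials [simp]: "Poly_Mapping.single x c \<in> monomials \<longleftrightarrow> c \<noteq> 0"
  unfolding monomials_iff by (metis single_eq_iff single_zero)

lemma mterm_eq_iff: "c \<noteq> 0 \<Longrightarrow> mterm p c = mterm q d \<longleftrightarrow> p = q \<and> c = d"
  unfolding mterm_def
  by (subst single_eq_iff) (auto simp: single_eq_iff prod_eq_iff dest: arg_cong[of _ _ Poly_Mapping.keys])

lemma mterm_eq_0_iff [simp]: "mterm p c = 0 \<longleftrightarrow> c = 0"
  unfolding mterm_def by (metis keys_eq_empty keys_single insert_not_empty single_zero)

lemma module_terms_iff: "t \<in> module_terms m \<longleftrightarrow> (\<exists>p c. p \<in> mdom m \<and> c \<noteq> 0 \<and> t = mterm p c)"
  by (fastforce simp: module_terms_def mdom_def mterm_def monomials_iff)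

lemma mterm_in_module_terms: "c \<noteq> 0 \<Longrightarrow> mterm p c \<in> module_terms m \<longleftrightarrow> p \<in> mdom m"
  by (metis module_terms_iff mterm_eq_iff)

lemma vscale_single_single:
  "vscale a (Poly_Mapping.single i b) = Poly_Mapping.single i (a * b)"
  by (rule poly_mapping_eqI) (simp add: lookup_vscale lookup_single when_def)

lemma vscale_mterm:
  "vscale (Poly_Mapping.single x c) (mterm p d) = mterm (shift p x) (c * d)"
  by (simp add: mterm_def shift_def vscale_single_single mult_single add.commute)

lemma simeq_single_iff:
  "c \<noteq> 0 \<Longrightarrow> d \<noteq> 0 \<Longrightarrow> simeq (*) (Poly_Mapping.single x c) (Poly_Mapping.single y d) \<longleftrightarrow> x = y"
  unfolding simeq_def mult_single
  by (auto simp: single_eq_iff intro!: exI[of _ "c / d"])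

lemma simeq_mterm_iff:
  "c \<noteq> 0 \<Longrightarrow> d \<noteq> 0 \<Longrightarrow> simeq vscale (mterm p c) (mterm q d) \<longleftrightarrow> p = q"
  unfolding simeq_def vscale_mterm
  by (auto simp: mterm_eq_iff intro!: exI[of _ "c / d"])

lemma term_dvd_mterm_iff:
  assumes "c \<noteq> 0" "d \<noteq> 0"
  shows "term_dvd (mterm p c) (mterm q d) \<longleftrightarrow> (\<exists>x. q = shift p x)"
proof
  assume "\<exists>x. q = shift p x"
  then obtain x where "q = shift p x" ..
  then have "mterm q d = vscale (Poly_Mapping.single x (d / c)) (mterm p c)"
    using assms by (simp add: vscale_mterm)
  moreover have "Poly_Mapping.single x (d / c) \<in> monomials" using assms by simp
  ultimately show "term_dvd (mterm p c) (mterm q d)" unfolding term_dvd_def by blast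
qed (use assms in \<open>auto simp: term_dvd_def monomials_iff vscale_mterm mterm_eq_iff\<close>)

section \<open>Coefficients of module elements at exponent pairs\<close>

lemma vcoef_add: "vcoef (u + v) p = vcoef u p + vcoef v p"
  and vcoef_diff: "vcoef (u - v) p = vcoef u p - vcoef v p"
  and vcoef_0 [simp]: "vcoef 0 p = 0"
  by (simp_all add: vcoef_def lookup_add lookup_minus)

lemma vcoef_mterm: "vcoef (mterm p c) q = (if q = p then c else 0)"
  by (auto simp: vcoef_def mterm_def lookup_single when_def prod_eq_iff)

lemma lookup_single_0_mult:
  fixes f :: "('v, 'k::field) pol"
  shows "Poly_Mapping.lookup (Poly_Mapping.single 0 c * f) x = c * Poly_Mapping.lookup f x"
proof -
  \<comment> \<open>Writing the exponent as \<open>0 + x\<close> exposes its only decomposition, as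
    the left factor has no exponent but \<open>0\<close>.\<close>
  have "Poly_Mapping.lookup (Poly_Mapping.single 0 c * f) (0 + x) =
      Poly_Mapping.lookup (Poly_Mapping.single 0 c) (0 :: 'v \<Rightarrow>\<^sub>0 nat) * Poly_Mapping.lookup f x"
    by (rule lookup_mult_unique_sum) (auto split: if_splits)
  then show ?thesis by simp
qed

lemma vcoef_scalar: "vcoef (vscale (Poly_Mapping.single 0 c) u) p = c * vcoef u p"
  by (simp add: vcoef_def lookup_vscale lookup_single_0_mult)

lemma fvec_eqI: "(\<And>p. vcoef u p = vcoef v p) \<Longrightarrow> u = v"
  by (rule poly_mapping_eqI, rule poly_mapping_eqI) (metis vcoef_def fst_conv snd_conv)

lemma finite_vcoef: "finite {p. vcoef u p \<noteq> 0}"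
proof (rule finite_subset)
  show "{p. vcoef u p \<noteq> 0} \<subseteq>
      (SIGMA i:Poly_Mapping.keys u. Poly_Mapping.keys (Poly_Mapping.lookup u i))"
    by (auto simp: vcoef_def in_keys_iff mem_Times_iff)
qed auto

lemma mem_free_module_iff: "u \<in> free_module m \<longleftrightarrow> (\<forall>p. vcoef u p \<noteq> 0 \<longrightarrow> p \<in> mdom m)"
proof
  assume *: "\<forall>p. vcoef u p \<noteq> 0 \<longrightarrow> p \<in> mdom m"
  have "i \<in> {1..m}" if i: "i \<in> Poly_Mapping.keys u" for i
  proof -
    have "Poly_Mapping.lookup u i \<noteq> 0" using i by (simp add: in_keys_iff)
    then obtain x where "Poly_Mapping.lookup (Poly_Mapping.lookup u i) x \<noteq> 0"
      by (metis poly_mapping_eqI lookup_zero)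
    then show ?thesis using *[rule_format, of "(i, x)"] by (simp add: vcoef_def mdom_def)
  qed
  then show "u \<in> free_module m" by (auto simp: free_module_def)
next
  assume u: "u \<in> free_module m"
  show "\<forall>p. vcoef u p \<noteq> 0 \<longrightarrow> p \<in> mdom m"
  proof (intro allI impI)
    fix p assume "vcoef u p \<noteq> 0"
    then have "fst p \<in> Poly_Mapping.keys u" by (auto simp: vcoef_def in_keys_iff)
    with u show "p \<in> mdom m" by (auto simp: free_module_def mdom_def mem_Times_iff)
  qed
qed

lemma free_module_iff_lookup: "u \<in> free_module n \<longleftrightarrow> (\<forall>i. i \<notin> {1..n} \<longrightarrow> Poly_Mapping.lookup u i = 0)"
  unfolding free_module_def by (auto simp: subset_iff in_keys_iff)

lemma free_module_closed:
  "0 \<in> free_module n"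
  "u \<in> free_module n \<Longrightarrow> v \<in> free_module n \<Longrightarrow> u + v \<in> free_module n"
  "u \<in> free_module n \<Longrightarrow> v \<in> free_module n \<Longrightarrow> u - v \<in> free_module n"
  "u \<in> free_module n \<Longrightarrow> vscale a u \<in> free_module n"
  unfolding free_module_iff_lookup by (simp_all add: lookup_add lookup_minus lookup_vscale)

lemma single_in_free_module: "i \<in> {1..n} \<Longrightarrow> Poly_Mapping.single i a \<in> free_module n"
  by (auto simp: free_module_def)

lemma sum_in_free_module:
  "(\<And>i. i \<in> A \<Longrightarrow> f i \<in> free_module n) \<Longrightarrow> sum f A \<in> free_module n"
  by (induction A rule: infinite_finite_induct) (auto simp: free_module_closed)

lemma free_module_mono: "n \<le> n' \<Longrightarrow> u \<in> free_module n \<Longrightarrow> u \<in> free_module n'"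
  by (fastforce simp: free_module_def)

section \<open>Images and \<open>\<phi>\<close>\<close>

text \<open>A larger index set lets two families be summed over the union of their supports.\<close>

lemma poly_image_eq_sum:
  assumes "finite A" "Poly_Mapping.keys u \<subseteq> A"
  shows "poly_image g u = (\<Sum>i\<in>A. Poly_Mapping.lookup u i * g i)"
  unfolding poly_image_def
  by (rule sum.mono_neutral_left) (use assms in \<open>auto simp: in_keys_iff\<close>)

lemma phi_eq_sum:
  assumes "finite A" "Poly_Mapping.keys u \<subseteq> A"
  shows "phi B u = (\<Sum>i\<in>A. vscale (Poly_Mapping.lookup u i) (bphi B i))"
  unfolding phi_def
  by (rule sum.mono_neutral_left)
    (use assms in \<open>auto simp: in_keys_iff module.scale_zero_left[OF module_vscale]\<close>)

lemma poly_image_diff: "poly_image g (u - v) = poly_image g u - poly_image g v"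
proof -
  let ?A = "Poly_Mapping.keys u \<union> Poly_Mapping.keys v"
  have "Poly_Mapping.keys (u - v) \<subseteq> ?A" by (auto simp: in_keys_iff lookup_minus)
  then show ?thesis
    by (simp add: poly_image_eq_sum[of ?A] lookup_minus left_diff_distrib sum_subtractf)
qed

lemma phi_diff: "phi B (u - v) = phi B u - phi B v"
proof -
  let ?A = "Poly_Mapping.keys u \<union> Poly_Mapping.keys v"
  have "Poly_Mapping.keys (u - v) \<subseteq> ?A" by (auto simp: in_keys_iff lookup_minus)
  then show ?thesis
    by (simp add: phi_eq_sum[of ?A] lookup_minus module.scale_left_diff_distrib[OF module_vscale]
        sum_subtractf)
qed

lemma poly_image_0 [simp]: "poly_image g 0 = 0"
  by (simp add: poly_image_def)

lemma poly_image_add: "poly_image g (u + v) = poly_image g u + poly_image g v"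
  using poly_image_diff[of g "u + v" v] by simp

lemma poly_image_vscale: "poly_image g (vscale a u) = a * poly_image g u"
proof -
  have "Poly_Mapping.keys (vscale a u) \<subseteq> Poly_Mapping.keys u"
    by (auto simp: in_keys_iff lookup_vscale)
  then show ?thesis
    by (simp add: poly_image_eq_sum[of "Poly_Mapping.keys u"] lookup_vscale sum_distrib_left ac_simps)
qed

lemma poly_image_sum: "poly_image g (sum f A) = (\<Sum>i\<in>A. poly_image g (f i))"
  by (induction A rule: infinite_finite_induct) (auto simp: poly_image_add)

lemma poly_image_single: "poly_image g (Poly_Mapping.single i a) = a * g i"
  by (simp add: poly_image_def)

lemma phi_single: "phi B (Poly_Mapping.single i a) = vscale a (bphi B i)"
  by (simp add: phi_def module.scale_zero_left[OF module_vscale])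

lemma poly_image_cong:
  "u \<in> free_module n \<Longrightarrow> (\<And>i. i \<in> {1..n} \<Longrightarrow> g i = g' i) \<Longrightarrow> poly_image g u = poly_image g' u"
  unfolding poly_image_def free_module_def by (auto intro!: sum.cong)

lemma phi_cong:
  "u \<in> free_module n \<Longrightarrow> (\<And>i. i \<in> {1..n} \<Longrightarrow> bphi B i = bphi B' i) \<Longrightarrow> phi B u = phi B' u"
  unfolding phi_def free_module_def by (auto intro!: sum.cong)

section \<open>The orders on exponents\<close>

text \<open>Restricted to one representative \<open>f p\<close> of each class of
  \<open>\<simeq>\<close>, the preorder becomes antisymmetric. \<open>D\<close> keeps to the
  exponents whose terms the order governs.\<close>

lemma term_order_on_well_linear:
  fixes f :: "'i \<Rightarrow> 'a::zero"
  assumes le: "term_order_on scale TT le" and f: "\<And>p. p \<in> D \<Longrightarrow> f p \<in> TT"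
    and inj: "\<And>p q. p \<in> D \<Longrightarrow> q \<in> D \<Longrightarrow> simeq scale (f p) (f q) \<longleftrightarrow> p = q"
  shows "well_linear_on D (\<lambda>p q. le (f p) (f q))"
proof
  have eq: "le (f p) (f q) \<and> le (f q) (f p) \<longleftrightarrow> p = q" if "p \<in> D" "q \<in> D" for p q
    using le f[OF that(1)] f[OF that(2)] inj[OF that] unfolding term_order_on_def by blast
  have "totalp_on (insert 0 TT) le" "reflp_on (insert 0 TT) le"
    using le unfolding term_order_on_def by blast+
  then show "le (f p) (f q) \<or> le (f q) (f p)" if "p \<in> D" "q \<in> D" for p q
    using totalp_onD[of "insert 0 TT" le "f p" "f q"] reflp_onD[of "insert 0 TT" le "f p"]
      f[OF that(1)] f[OF that(2)] by (cases "f p = f q") auto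
  show "p = q" if "p \<in> D" "q \<in> D" "le (f p) (f q)" "le (f q) (f p)" for p q
    using eq that by blast
  show "le (f p) (f r)" if "p \<in> D" "q \<in> D" "r \<in> D" "le (f p) (f q)" "le (f q) (f r)" for p q r
  proof -
    have "transp_on (insert 0 TT) le" using le unfolding term_order_on_def by blast
    from transp_onD[OF this _ _ _ that(4,5)] show ?thesis using f that by blast
  qed
  have "wfp_on TT (strict_of le)" using le unfolding term_order_on_def by blast
  then have "wfp_on (f ` D) (strict_of le)" by (rule wfp_on_subset) (use f in blast)
  then have wf: "wfp_on D (\<lambda>p q. strict_of le (f p) (f q))" unfolding wfp_on_image .
  \<comment> \<open>On representatives, comparison of distinct elements is the strict part of the
    preorder, so minimal elements carry over.\<close>
  show "wfp_on D (\<lambda>p q. le (f p) (f q) \<and> p \<noteq> q)"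
    unfolding wfp_on_iff_ex_minimal
  proof (intro allI impI)
    fix A assume A: "A \<subseteq> D" "A \<noteq> {}"
    then obtain z where z: "z \<in> A" "\<And>y. strict_of le (f y) (f z) \<Longrightarrow> y \<notin> A"
      using wf unfolding wfp_on_iff_ex_minimal by metis
    have "y \<notin> A" if "le (f y) (f z) \<and> y \<noteq> z" for y
    proof
      assume "y \<in> A"
      then have "strict_of le (f y) (f z)"
        using that eq[of y z] A(1) z(1) unfolding strict_of_def by blast
      with z(2) \<open>y \<in> A\<close> show False by blast
    qed
    with z(1) show "\<exists>z\<in>A. \<forall>y. le (f y) (f z) \<and> y \<noteq> z \<longrightarrow> y \<notin> A" by blast
  qed
qed

lemma max_term_eqI:
  assumes "t \<in> A" "\<And>s. s \<in> A \<Longrightarrow> le s t" "\<And>s. s \<in> A \<Longrightarrow> le t s \<Longrightarrow> s = t"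
  shows "max_term le A = t"
proof -
  have "(THE t. t \<in> A \<and> (\<forall>s\<in>A. le s t)) = t"
    by (rule the_equality) (use assms in blast)+
  with assms(1) show ?thesis unfolding max_term_def by auto
qed

locale compatible_term_orders =
  fixes leR :: "('v, 'k::field) pol \<Rightarrow> ('v, 'k) pol \<Rightarrow> bool"
    and leM :: "('v, 'k) fvec \<Rightarrow> ('v, 'k) fvec \<Rightarrow> bool" and m :: nat
  assumes ring_order: "term_order_on (*) monomials leR"
    and module_order: "term_order_on vscale (module_terms m) leM"
    and compat: "compatible_orders m leR leM"
begin

definition ler :: "('v \<Rightarrow>\<^sub>0 nat) \<Rightarrow> ('v \<Rightarrow>\<^sub>0 nat) \<Rightarrow> bool" where
  "ler x y \<longleftrightarrow> leR (Poly_Mapping.single x 1) (Poly_Mapping.single y 1)"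

definition lem :: "nat \<times> ('v \<Rightarrow>\<^sub>0 nat) \<Rightarrow> nat \<times> ('v \<Rightarrow>\<^sub>0 nat) \<Rightarrow> bool" where
  "lem p q \<longleftrightarrow> leM (mterm p 1) (mterm q 1)"

sublocale R: well_linear_on UNIV ler
  unfolding ler_def
  by (rule term_order_on_well_linear[OF ring_order]) (auto simp: simeq_single_iff)

sublocale M: well_linear_on "mdom m" lem
  unfolding lem_def
  by (rule term_order_on_well_linear[OF module_order])
    (auto simp: mterm_in_module_terms simeq_mterm_iff)

text \<open>A nonzero coefficient moves a term only within its class of \<open>\<simeq>\<close>, so
  transitivity reduces every comparison to coefficient 1.\<close>

lemma leR_single_iff:
  assumes "c \<noteq> 0" "d \<noteq> 0"
  shows "leR (Poly_Mapping.single x c) (Poly_Mapping.single y d) \<longleftrightarrow> ler x y"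
proof -
  let ?s = "\<lambda>x c. Poly_Mapping.single x c :: ('v, 'k) pol"
  have mem: "?s x c \<in> monomials" "?s x 1 \<in> monomials" "?s y d \<in> monomials" "?s y 1 \<in> monomials"
    using assms by simp_all
  have "leR (?s x c) (?s x 1) \<and> leR (?s x 1) (?s x c)" "leR (?s y d) (?s y 1) \<and> leR (?s y 1) (?s y d)"
    using ring_order mem assms unfolding term_order_on_def by (simp_all add: simeq_single_iff)
  moreover have "transp_on (insert 0 monomials) leR" using ring_order unfolding term_order_on_def by blast
  ultimately show ?thesis using mem unfolding ler_def by (meson insertI2 transp_onD)
qed

lemma leM_mterm_iff:
  assumes "c \<noteq> 0" "d \<noteq> 0" "p \<in> mdom m" "q \<in> mdom m"
  shows "leM (mterm p c) (mterm q d) \<longleftrightarrow> lem p q"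
proof -
  have mem: "mterm p c \<in> module_terms m" "mterm q d \<in> module_terms m"
      "mterm p (1::'k) \<in> module_terms m" "mterm q (1::'k) \<in> module_terms m"
    using assms by (simp_all add: mterm_in_module_terms)
  have "leM (mterm p c) (mterm p 1) \<and> leM (mterm p 1) (mterm p c)"
    "leM (mterm q d) (mterm q 1) \<and> leM (mterm q 1) (mterm q d)"
    using module_order mem assms unfolding term_order_on_def by (simp_all add: simeq_mterm_iff)
  moreover have "transp_on (insert 0 (module_terms m)) leM" using module_order unfolding term_order_on_def by blast
  ultimately show ?thesis using mem unfolding lem_def by (meson insertI2 transp_onD)
qed

lemma strict_leM_mterm_iff:
  assumes "c \<noteq> 0" "d \<noteq> 0" "p \<in> mdom m" "q \<in> mdom m"
  shows "strict_of leM (mterm p c) (mterm q d) \<longleftrightarrow> M.lt p q"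
  using assms M.not_le[of q p] M.lt_imp_le[of p q] by (auto simp: strict_of_def leM_mterm_iff)

lemma ler_add: assumes "ler x y" shows "ler (x + z) (y + z)"
proof -
  let ?s = "\<lambda>x. Poly_Mapping.single x 1 :: ('v, 'k) pol"
  have mem: "?s x \<in> monomials" for x by simp
  have "leR (?s z * ?s x) (?s z * ?s y)"
    using ring_order assms mem unfolding term_order_on_def ler_def by blast
  then show ?thesis by (simp add: mult_single ler_def add.commute)
qed

lemma ltr_add: "R.lt x y \<Longrightarrow> R.lt (x + z) (y + z)"
  by (simp add: R.lt_def ler_add)

text \<open>The converse comes from totality: the opposite comparison would be preserved by adding
  \<open>z\<close> as well.\<close>

lemma ltr_add_iff: "R.lt (x + z) (y + z) \<longleftrightarrow> R.lt x y"
  using ltr_add[of x y z] ltr_add[of y x z] R.not_lt[of x y] R.not_lt[of "x + z" "y + z"] R.lt_def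
  by auto

lemma ler_add_iff: "ler (x + z) (y + z) \<longleftrightarrow> ler x y"
  using ltr_add_iff[of y z x] R.not_le[OF UNIV_I UNIV_I] by blast

text \<open>The term order puts the zero polynomial below all terms but says nothing directly about
  the constant term, which has exponent \<open>0\<close>. A smaller \<open>x\<close> would push the
  least exponent \<open>y\<close> down to \<open>x + y\<close>.\<close>

lemma ler_0: "ler 0 x"
proof (rule ccontr)
  assume "\<not> ler 0 x"
  then have "R.lt x 0" using R.not_le by simp
  obtain y where y: "\<And>z. ler y z" using R.ex_least[of UNIV] by auto
  from \<open>R.lt x 0\<close> have "R.lt (x + y) y" using ltr_add[of x 0 y] by simp
  then show False using y R.not_le[of y "x + y"] by simp
qed

lemma lem_shift: assumes "lem p q" "p \<in> mdom m" "q \<in> mdom m" shows "lem (shift p x) (shift q x)"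
proof -
  have "Poly_Mapping.single x (1::'k) \<in> monomials" by simp
  moreover have "mterm p (1::'k) \<in> module_terms m" "mterm q (1::'k) \<in> module_terms m"
    using assms by (simp_all add: mterm_in_module_terms)
  ultimately have "leM (vscale (Poly_Mapping.single x 1) (mterm p 1))
      (vscale (Poly_Mapping.single x 1) (mterm q 1))"
    using module_order assms(1) unfolding term_order_on_def lem_def by blast
  then show ?thesis by (simp add: vscale_mterm lem_def)
qed

lemma ltm_shift: "M.lt p q \<Longrightarrow> p \<in> mdom m \<Longrightarrow> q \<in> mdom m \<Longrightarrow> M.lt (shift p x) (shift q x)"
  by (simp add: M.lt_def lem_shift)

lemma ltm_shift_iff: "p \<in> mdom m \<Longrightarrow> q \<in> mdom m \<Longrightarrow> M.lt (shift p x) (shift q x) \<longleftrightarrow> M.lt p q"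
  using ltm_shift[of p q x] ltm_shift[of q p x] M.not_lt[of p q] M.not_lt[of "shift p x" "shift q x"]
    M.lt_def by auto

text \<open>Compatibility of the two orders enters here: along one basis vector the module order is
  the ring order, and the fixed part \<open>snd p\<close> cancels.\<close>

lemma lem_shift_shift:
  assumes "p \<in> mdom m" shows "lem (shift p x) (shift p y) \<longleftrightarrow> ler x y"
proof -
  have s: "Poly_Mapping.single z (1::'k) \<in> monomials" for z :: "'v \<Rightarrow>\<^sub>0 nat" by simp
  have "ler (snd p + x) (snd p + y) \<longleftrightarrow> lem (shift p x) (shift p y)"
    using compat assms s unfolding compatible_orders_def ler_def lem_def mterm_def
    by (auto simp: mdom_def shift_def)
  moreover have "ler (snd p + x) (snd p + y) \<longleftrightarrow> ler x y"
    using ler_add_iff[of x "snd p" y] by (simp add: add.commute)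
  ultimately show ?thesis by simp
qed

lemma lem_shift_self: "p \<in> mdom m \<Longrightarrow> lem p (shift p x)"
  using lem_shift_shift[of p 0 x] ler_0 by simp

section \<open>Lead exponents and signature exponents\<close>

definition lpp :: "('v, 'k) pol \<Rightarrow> ('v \<Rightarrow>\<^sub>0 nat)" where
  "lpp f = R.top (Poly_Mapping.lookup f)"

definition spp :: "('v, 'k) fvec \<Rightarrow> nat \<times> ('v \<Rightarrow>\<^sub>0 nat)" where
  "spp u = M.top (vcoef u)"

lemma fin_on_lookup: "R.fin_on (Poly_Mapping.lookup f)"
  by (simp add: R.fin_on_def)

lemma fin_on_vcoef: "u \<in> free_module m \<Longrightarrow> M.fin_on (vcoef u)"
  using finite_vcoef[of u] by (auto simp: M.fin_on_def mem_free_module_iff)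

lemma lookup_lpp: "f \<noteq> 0 \<Longrightarrow> Poly_Mapping.lookup f (lpp f) \<noteq> 0"
  unfolding lpp_def using R.top_nonzero[OF fin_on_lookup] by (metis poly_mapping_eqI lookup_zero)

lemma le_lpp: "Poly_Mapping.lookup f x \<noteq> 0 \<Longrightarrow> ler x (lpp f)"
  unfolding lpp_def by (rule R.le_top[OF fin_on_lookup])

lemma lpp_eqI:
  "Poly_Mapping.lookup f x \<noteq> 0 \<Longrightarrow> (\<And>y. Poly_Mapping.lookup f y \<noteq> 0 \<Longrightarrow> ler y x) \<Longrightarrow> lpp f = x"
  unfolding lpp_def by (rule R.top_eqI[OF fin_on_lookup])

lemma ex_vcoef: "u \<noteq> 0 \<Longrightarrow> \<exists>p. vcoef u p \<noteq> 0"
  using fvec_eqI[of u 0] by auto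

lemma vcoef_spp: "u \<in> free_module m \<Longrightarrow> u \<noteq> 0 \<Longrightarrow> vcoef u (spp u) \<noteq> 0"
  unfolding spp_def using M.top_nonzero[OF fin_on_vcoef] ex_vcoef by blast

lemma spp_in: "u \<in> free_module m \<Longrightarrow> u \<noteq> 0 \<Longrightarrow> spp u \<in> mdom m"
  using vcoef_spp mem_free_module_iff by blast

lemma le_spp: "u \<in> free_module m \<Longrightarrow> vcoef u p \<noteq> 0 \<Longrightarrow> lem p (spp u)"
  unfolding spp_def by (rule M.le_top[OF fin_on_vcoef])

lemma spp_eqI:
  "u \<in> free_module m \<Longrightarrow> vcoef u p \<noteq> 0 \<Longrightarrow> (\<And>q. vcoef u q \<noteq> 0 \<Longrightarrow> lem q p) \<Longrightarrow> spp u = p"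
  unfolding spp_def by (rule M.top_eqI[OF fin_on_vcoef])

lemma lead_term_eq:
  assumes "f \<noteq> 0"
  shows "lead_term leR f = Poly_Mapping.single (lpp f) (Poly_Mapping.lookup f (lpp f))"
  unfolding lead_term_def
proof (rule max_term_eqI)
  show "Poly_Mapping.single (lpp f) (Poly_Mapping.lookup f (lpp f)) \<in> terms_of f"
    using lookup_lpp[OF assms] by (auto simp: terms_of_def in_keys_iff)
  fix s assume "s \<in> terms_of f"
  then obtain x where x: "Poly_Mapping.lookup f x \<noteq> 0" "s = Poly_Mapping.single x (Poly_Mapping.lookup f x)"
    by (auto simp: terms_of_def in_keys_iff)
  then show "leR s (Poly_Mapping.single (lpp f) (Poly_Mapping.lookup f (lpp f)))"
    using le_lpp lookup_lpp[OF assms] by (simp add: leR_single_iff)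
  assume "leR (Poly_Mapping.single (lpp f) (Poly_Mapping.lookup f (lpp f))) s"
  then have "ler (lpp f) x" using x lookup_lpp[OF assms] by (simp add: leR_single_iff)
  with le_lpp[OF x(1)] have "x = lpp f" using R.antisym by blast
  with x show "s = Poly_Mapping.single (lpp f) (Poly_Mapping.lookup f (lpp f))" by simp
qed

lemma vterms_of_iff: "t \<in> vterms_of u \<longleftrightarrow> (\<exists>p. vcoef u p \<noteq> 0 \<and> t = mterm p (vcoef u p))"
proof
  assume "\<exists>p. vcoef u p \<noteq> 0 \<and> t = mterm p (vcoef u p)"
  then obtain i x where "Poly_Mapping.lookup (Poly_Mapping.lookup u i) x \<noteq> 0"
    "t = Poly_Mapping.single i (Poly_Mapping.single x (Poly_Mapping.lookup (Poly_Mapping.lookup u i) x))"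
    by (auto simp: vcoef_def mterm_def)
  moreover from this have "Poly_Mapping.lookup u i \<noteq> 0" by (metis lookup_zero)
  ultimately show "t \<in> vterms_of u" by (auto simp: vterms_of_def terms_of_def in_keys_iff)
qed (auto simp: vterms_of_def terms_of_def in_keys_iff vcoef_def mterm_def)

lemma signature_eq:
  assumes "u \<in> free_module m" "u \<noteq> 0"
  shows "signature leM u = mterm (spp u) (vcoef u (spp u))"
  unfolding signature_def
proof (rule max_term_eqI)
  note nz = vcoef_spp[OF assms] and dom = spp_in[OF assms]
  show "mterm (spp u) (vcoef u (spp u)) \<in> vterms_of u"
    using nz vterms_of_iff by blast
  fix s assume "s \<in> vterms_of u"
  then obtain p where p: "vcoef u p \<noteq> 0" "s = mterm p (vcoef u p)" by (auto simp: vterms_of_iff)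
  then have "p \<in> mdom m" using assms mem_free_module_iff by blast
  note iff = leM_mterm_iff[OF p(1) nz this dom] leM_mterm_iff[OF nz p(1) dom this]
  show "leM s (mterm (spp u) (vcoef u (spp u)))"
    unfolding p(2) iff by (rule le_spp[OF assms(1) p(1)])
  assume "leM (mterm (spp u) (vcoef u (spp u))) s"
  then have "p = spp u" using le_spp[OF assms(1) p(1)] M.antisym \<open>p \<in> mdom m\<close> dom
    unfolding p(2) iff by blast
  with p show "s = mterm (spp u) (vcoef u (spp u))" by simp
qed

lemma signature_0 [simp]: "signature leM 0 = 0"
  by (simp add: signature_def max_term_def vterms_of_def)

text \<open>Monotonicity bounds each sum of exponents by the sum of the two maxima, and only the
  maxima themselves attain it, so the lead coefficient of the product cannot cancel.\<close>

lemma lpp_mult: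
  assumes "f \<noteq> 0" "g \<noteq> 0"
  shows "lpp (f * g) = lpp f + lpp g"
    and "Poly_Mapping.lookup (f * g) (lpp f + lpp g) =
      Poly_Mapping.lookup f (lpp f) * Poly_Mapping.lookup g (lpp g)"
    and "f * g \<noteq> 0"
proof -
  have le: "ler (x + y) (lpp f + lpp g)" and eq: "x + y = lpp f + lpp g \<Longrightarrow> x = lpp f \<and> y = lpp g"
    if "x \<in> Poly_Mapping.keys f" "y \<in> Poly_Mapping.keys g" for x y
  proof -
    have xy: "ler x (lpp f)" "ler y (lpp g)" using that by (auto simp: in_keys_iff intro: le_lpp)
    then have 1: "ler (x + y) (lpp f + y)" "ler (lpp f + y) (lpp f + lpp g)"
      using ler_add[of x "lpp f" y] ler_add[of y "lpp g" "lpp f"] by (simp_all add: add.commute)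
    then show "ler (x + y) (lpp f + lpp g)" using R.trans by blast
    assume "x + y = lpp f + lpp g"
    with 1 have "lpp f + y = x + y" using R.antisym[of "x + y" "lpp f + y"] by simp
    with \<open>x + y = lpp f + lpp g\<close> show "x = lpp f \<and> y = lpp g" by simp
  qed
  show coef: "Poly_Mapping.lookup (f * g) (lpp f + lpp g) =
      Poly_Mapping.lookup f (lpp f) * Poly_Mapping.lookup g (lpp g)"
    by (rule lookup_mult_unique_sum) (use eq in blast)
  then have nz: "Poly_Mapping.lookup (f * g) (lpp f + lpp g) \<noteq> 0"
    using lookup_lpp assms by simp
  then show "f * g \<noteq> 0" by (metis lookup_zero)
  show "lpp (f * g) = lpp f + lpp g"
  proof (rule lpp_eqI[OF nz])
    fix z assume "Poly_Mapping.lookup (f * g) z \<noteq> 0"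
    then have "z \<in> Poly_Mapping.keys (f * g)" by (simp add: in_keys_iff)
    then obtain x y where "x \<in> Poly_Mapping.keys f" "y \<in> Poly_Mapping.keys g" "z = x + y"
      using keys_mult[of f g] by auto
    then show "ler z (lpp f + lpp g)" using le by blast
  qed
qed

text \<open>Two monotonicities meet: raising \<open>x\<close> to \<open>lpp f\<close> over a fixed
  pair uses compatibility, raising the pair to \<open>spp u\<close> uses the module order. Attaining
  the bound forces equality in both, so the top coefficient is a single product.\<close>

lemma spp_vscale:
  assumes "f \<noteq> 0" "u \<in> free_module m" "u \<noteq> 0"
  shows "spp (vscale f u) = shift (spp u) (lpp f)"
    and "vcoef (vscale f u) (shift (spp u) (lpp f)) = Poly_Mapping.lookup f (lpp f) * vcoef u (spp u)"
    and "vscale f u \<noteq> 0"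
proof -
  note dom = spp_in[OF assms(2,3)]
  have le: "lem (i, x + y) (shift (spp u) (lpp f))"
    and eq: "(i, x + y) = shift (spp u) (lpp f) \<Longrightarrow> x = lpp f \<and> y = snd (spp u)"
    if "x \<in> Poly_Mapping.keys f" "y \<in> Poly_Mapping.keys (Poly_Mapping.lookup u i)" for x y i
  proof -
    have c: "vcoef u (i, y) \<noteq> 0" using that by (simp add: vcoef_def in_keys_iff)
    then have D: "(i, y) \<in> mdom m" using assms(2) by (simp add: mem_free_module_iff)
    have xy: "ler x (lpp f)" using that by (simp add: in_keys_iff le_lpp)
    have 1: "lem (shift (i, y) x) (shift (i, y) (lpp f))" using D xy by (simp add: lem_shift_shift)
    have 2: "lem (shift (i, y) (lpp f)) (shift (spp u) (lpp f))"
      using lem_shift[OF le_spp[OF assms(2) c] D dom] .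
    have [simp]: "(i, x + y) = shift (i, y) x" by (simp add: shift_def add.commute)
    show "lem (i, x + y) (shift (spp u) (lpp f))"
      using M.trans[OF _ _ _ 1 2] D dom by simp
    assume "(i, x + y) = shift (spp u) (lpp f)"
    then have s: "shift (i, y) x = shift (spp u) (lpp f)" by simp
    with 1 2 D dom have "shift (i, y) (lpp f) = shift (spp u) (lpp f)"
      using M.antisym[of "shift (i, y) (lpp f)" "shift (spp u) (lpp f)"] by simp
    then have "(i, y) = spp u" by simp
    with s show "x = lpp f \<and> y = snd (spp u)" by (metis shift_inject snd_conv)
  qed
  have "Poly_Mapping.lookup (f * Poly_Mapping.lookup u (fst (spp u))) (lpp f + snd (spp u)) =
     Poly_Mapping.lookup f (lpp f) * Poly_Mapping.lookup (Poly_Mapping.lookup u (fst (spp u))) (snd (spp u))"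
    by (rule lookup_mult_unique_sum, rule eq[of _ _ "fst (spp u)"]) (simp_all add: shift_def add.commute)
  then show coef: "vcoef (vscale f u) (shift (spp u) (lpp f)) = Poly_Mapping.lookup f (lpp f) * vcoef u (spp u)"
    by (simp add: vcoef_def lookup_vscale shift_def add.commute)
  then have nz: "vcoef (vscale f u) (shift (spp u) (lpp f)) \<noteq> 0"
    using lookup_lpp[OF assms(1)] vcoef_spp[OF assms(2,3)] by simp
  then show "vscale f u \<noteq> 0" by (metis vcoef_0)
  show "spp (vscale f u) = shift (spp u) (lpp f)"
  proof (rule spp_eqI[OF free_module_closed(4)[OF assms(2)] nz])
    fix q assume "vcoef (vscale f u) q \<noteq> 0"
    then have "snd q \<in> Poly_Mapping.keys (f * Poly_Mapping.lookup u (fst q))"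
      by (simp add: in_keys_iff vcoef_def lookup_vscale)
    then obtain x y where "x \<in> Poly_Mapping.keys f" "y \<in> Poly_Mapping.keys (Poly_Mapping.lookup u (fst q))"
        "snd q = x + y"
      using keys_mult[of f "Poly_Mapping.lookup u (fst q)"] by blast
    moreover from this have "q = (fst q, x + y)" by (simp add: prod_eq_iff)
    ultimately show "lem q (shift (spp u) (lpp f))" using le by metis
  qed
qed

lemma lpp_single [simp]: "c \<noteq> 0 \<Longrightarrow> lpp (Poly_Mapping.single x c) = x"
  by (rule lpp_eqI) (auto simp: lookup_single when_def R.refl split: if_splits)

lemma spp_mterm: assumes "c \<noteq> 0" "p \<in> mdom m" shows "spp (mterm p c) = p"
proof (rule spp_eqI)
  show "mterm p c \<in> free_module m" using assms by (auto simp: mem_free_module_iff vcoef_mterm)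
qed (use assms in \<open>auto simp: vcoef_mterm M.refl split: if_splits\<close>)

text \<open>The bound on \<open>v\<close> is conditional because \<open>spp 0\<close> has no
  meaning; a reducer or a remainder may vanish.\<close>

lemma spp_diff:
  assumes "u \<in> free_module m" "v \<in> free_module m" "u \<noteq> 0" "v \<noteq> 0 \<Longrightarrow> M.lt (spp v) (spp u)"
  shows "spp (u - v) = spp u" "vcoef (u - v) (spp u) = vcoef u (spp u)" "u - v \<noteq> 0"
proof -
  obtain p where p: "vcoef u p \<noteq> 0" using ex_vcoef[OF assms(3)] by blast
  have *: "M.lt q (M.top (vcoef u))" if "vcoef v q \<noteq> 0" for q
  proof -
    have "v \<noteq> 0" using that by auto
    moreover have "q \<in> mdom m" using that assms(2) mem_free_module_iff by blast
    ultimately show ?thesis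
      using M.le_lt_trans[OF _ _ _ le_spp[OF assms(2) that] assms(4)] spp_in assms
      by (simp add: spp_def)
  qed
  note 1 = M.top_combine[OF fin_on_vcoef[OF assms(1)] p
      fin_on_vcoef[OF free_module_closed(3)[OF assms(1,2)]] _ *, where a = 1 and b = "-1"]
  show "spp (u - v) = spp u" and c: "vcoef (u - v) (spp u) = vcoef u (spp u)"
    unfolding spp_def using 1 by (simp_all add: vcoef_diff)
  show "u - v \<noteq> 0" using c vcoef_spp[OF assms(1,3)] by auto
qed

lemma lpp_diff:
  assumes "f \<noteq> 0" "g \<noteq> 0 \<Longrightarrow> R.lt (lpp g) (lpp f)"
  shows "lpp (f - g) = lpp f" "f - g \<noteq> 0"
proof -
  have f: "Poly_Mapping.lookup f (lpp f) \<noteq> 0" using lookup_lpp assms by blast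
  have *: "R.lt x (R.top (Poly_Mapping.lookup f))" if "Poly_Mapping.lookup g x \<noteq> 0" for x
  proof -
    have "g \<noteq> 0" using that by auto
    then show ?thesis using R.le_lt_trans[OF _ _ _ le_lpp[OF that] assms(2)] by (simp add: lpp_def)
  qed
  have eq: "Poly_Mapping.lookup (f - g) x = 1 * Poly_Mapping.lookup f x + - 1 * Poly_Mapping.lookup g x" for x
    by (simp add: lookup_minus)
  note 1 = R.top_combine[OF fin_on_lookup f fin_on_lookup one_neq_zero * eq]
  show "lpp (f - g) = lpp f" unfolding lpp_def by (rule 1)
  have "Poly_Mapping.lookup (f - g) (lpp f) = Poly_Mapping.lookup f (lpp f)"
    unfolding lpp_def using 1(2) by simp
  with f show "f - g \<noteq> 0" by auto
qed

lemma spp_cancel: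
  assumes "u \<in> free_module m" "v \<in> free_module m" "u \<noteq> 0" "v \<noteq> 0" "spp u = spp v"
  obtains c where "c \<noteq> 0" "u - vscale (Poly_Mapping.single 0 c) v \<noteq> 0 \<Longrightarrow>
      M.lt (spp (u - vscale (Poly_Mapping.single 0 c) v)) (spp u)"
proof -
  \<comment> \<open>The quotient of the two top coefficients cancels the common signature
    term.\<close>
  let ?c = "vcoef u (spp u) / vcoef v (spp v)"
  let ?w = "u - vscale (Poly_Mapping.single 0 ?c) v"
  note nz = vcoef_spp[OF assms(1,3)] vcoef_spp[OF assms(2,4)]
  have "M.lt (spp ?w) (spp u)" if w: "?w \<noteq> 0"
  proof -
    obtain p where p: "vcoef ?w p \<noteq> 0" using ex_vcoef w by blast
    have fin: "M.fin_on (vcoef ?w)"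
      by (intro fin_on_vcoef free_module_closed assms)
    have "M.lt (M.top (vcoef ?w)) (M.top (vcoef u))"
    proof (rule M.lt_top_cancel[OF fin_on_vcoef[OF assms(1)] fin_on_vcoef[OF assms(2)] fin p])
      show "M.top (vcoef u) = M.top (vcoef v)" using assms(5) by (simp add: spp_def)
      show "vcoef ?w q = 1 * vcoef u q + (- ?c) * vcoef v q" for q
        by (simp add: vcoef_diff vcoef_scalar)
      show "vcoef ?w (M.top (vcoef u)) = 0"
        using nz assms(5) by (simp add: vcoef_diff vcoef_scalar spp_def)
    qed
    then show ?thesis by (simp only: spp_def)
  qed
  with nz show ?thesis by (intro that[of ?c]) auto
qed

end

section \<open>Reducibility in terms of exponents\<close>

lemma expo_single [simp]: "c \<noteq> 0 \<Longrightarrow> expo (Poly_Mapping.single x c) = x"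
  by (simp add: expo_def)

lemma coef_single [simp]: "c \<noteq> 0 \<Longrightarrow> coef (Poly_Mapping.single x c) = c"
  by (simp add: coef_def)

lemma pp_gcd_commute: "pp_gcd x y = pp_gcd y x"
  by (rule poly_mapping_eqI) (simp add: lookup_pp_gcd min.commute)

lemma add_minus_pp_gcd: "x + (y - pp_gcd x y) = y + (x - pp_gcd x y)"
  by (rule poly_mapping_eqI) (simp add: lookup_add lookup_minus lookup_pp_gcd)

lemma minus_pp_gcd_0 [simp]: "x - pp_gcd x x = 0"
  by (rule poly_mapping_eqI) (simp add: lookup_minus lookup_pp_gcd)

text \<open>A common multiple of \<open>a\<close> and \<open>b\<close> factors through their lcm,
  and \<open>b - pp_gcd a b\<close> is the cofactor of \<open>a\<close>. The common rest
  \<open>h\<close> is a truncated difference, which loses nothing since that cofactor is pointwise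
  below \<open>x\<close>.\<close>

lemma common_multiple_decomp:
  fixes x y a b :: "'v \<Rightarrow>\<^sub>0 nat"
  assumes "x + a = y + b"
  obtains h where "x = (b - pp_gcd a b) + h" "y = (a - pp_gcd a b) + h"
proof
  have eq: "Poly_Mapping.lookup x v + Poly_Mapping.lookup a v =
      Poly_Mapping.lookup y v + Poly_Mapping.lookup b v" for v
    using assms by (metis lookup_add)
  show "x = (b - pp_gcd a b) + (x - (b - pp_gcd a b))"
  proof (rule poly_mapping_eqI)
    fix v show "Poly_Mapping.lookup x v = Poly_Mapping.lookup ((b - pp_gcd a b) + (x - (b - pp_gcd a b))) v"
      using eq[of v] by (simp add: lookup_add lookup_minus lookup_pp_gcd)
  qed
  show "y = (a - pp_gcd a b) + (x - (b - pp_gcd a b))"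
  proof (rule poly_mapping_eqI)
    fix v show "Poly_Mapping.lookup y v = Poly_Mapping.lookup ((a - pp_gcd a b) + (x - (b - pp_gcd a b))) v"
      using eq[of v] by (simp add: lookup_add lookup_minus lookup_pp_gcd)
  qed
qed

section \<open>Extended bases of a fixed input, described by exponents\<close>

locale sb_input = compatible_term_orders leR leM m
  for leR :: "('v, 'k::field) pol \<Rightarrow> ('v, 'k) pol \<Rightarrow> bool"
    and leM :: "('v, 'k) fvec \<Rightarrow> ('v, 'k) fvec \<Rightarrow> bool" and m :: nat +
  fixes g :: "nat \<Rightarrow> ('v, 'k) pol"
  assumes gens_nonzero: "\<forall>i\<in>{1..m}. g i \<noteq> 0"
begin

definition basis_ok :: "('v, 'k) ext_basis \<Rightarrow> bool" where
  "basis_ok B \<longleftrightarrow> m \<le> bsize B \<and> (\<forall>i\<in>{1..m}. bphi B i = Poly_Mapping.single i 1) \<and>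
     (\<forall>i\<in>{1..bsize B}. bphi B i \<in> free_module m \<and> poly_image g (bphi B i) = bgen B i \<and>
        bgen B i \<noteq> 0)"

definition lexp :: "('v, 'k) ext_basis \<Rightarrow> nat \<Rightarrow> ('v \<Rightarrow>\<^sub>0 nat)" where
  "lexp B i = lpp (bgen B i)"

definition sexp :: "('v, 'k) ext_basis \<Rightarrow> nat \<Rightarrow> nat \<times> ('v \<Rightarrow>\<^sub>0 nat)" where
  "sexp B i = spp (bphi B i)"

text \<open>Only exponents occur, since the coefficient of a reducer can always be adjusted:
  \<open>x\<close> is the lead exponent of the element to be reduced and \<open>S\<close> its
  signature exponent.\<close>

definition reg_reducible :: "('v, 'k) ext_basis \<Rightarrow> ('v \<Rightarrow>\<^sub>0 nat) \<Rightarrow> nat \<times> ('v \<Rightarrow>\<^sub>0 nat) \<Rightarrow> bool" where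
  "reg_reducible B x S \<longleftrightarrow> (\<exists>j\<in>{1..bsize B}. \<exists>y. y + lexp B j = x \<and> M.lt (shift (sexp B j) y) S)"

definition sing_reducible :: "('v, 'k) ext_basis \<Rightarrow> ('v \<Rightarrow>\<^sub>0 nat) \<Rightarrow> nat \<times> ('v \<Rightarrow>\<^sub>0 nat) \<Rightarrow> bool" where
  "sing_reducible B x S \<longleftrightarrow> (\<exists>j\<in>{1..bsize B}. \<exists>y. y + lexp B j = x \<and> shift (sexp B j) y = S)"

text \<open>The power product in front of \<open>e_i\<close> in the S-pair of \<open>i\<close> and
  \<open>j\<close>: the lcm of the two lead power products divided by that of
  \<open>g_i\<close>.\<close>

definition cofactor :: "('v, 'k) ext_basis \<Rightarrow> nat \<Rightarrow> nat \<Rightarrow> ('v \<Rightarrow>\<^sub>0 nat)" where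
  "cofactor B i j = lexp B j - pp_gcd (lexp B i) (lexp B j)"

definition plcm :: "('v, 'k) ext_basis \<Rightarrow> nat \<Rightarrow> nat \<Rightarrow> ('v \<Rightarrow>\<^sub>0 nat)" where
  "plcm B i j = lexp B i + cofactor B i j"

definition psig :: "('v, 'k) ext_basis \<Rightarrow> nat \<Rightarrow> nat \<Rightarrow> nat \<times> ('v \<Rightarrow>\<^sub>0 nat)" where
  "psig B i j = M.greater (shift (sexp B i) (cofactor B i j)) (shift (sexp B j) (cofactor B j i))"

definition preg :: "('v, 'k) ext_basis \<Rightarrow> nat \<Rightarrow> nat \<Rightarrow> bool" where
  "preg B i j \<longleftrightarrow> shift (sexp B i) (cofactor B i j) \<noteq> shift (sexp B j) (cofactor B j i)"

definition koszul_exp :: "('v, 'k) ext_basis \<Rightarrow> nat \<times> ('v \<Rightarrow>\<^sub>0 nat) \<Rightarrow> bool" where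
  "koszul_exp B S \<longleftrightarrow> (\<exists>i\<in>{1..bsize B}. \<exists>j\<in>{1..bsize B}.
     shift (sexp B i) (lexp B j) \<noteq> shift (sexp B j) (lexp B i) \<and>
     S = M.greater (shift (sexp B i) (lexp B j)) (shift (sexp B j) (lexp B i)))"

text \<open>The candidate of the singular criterion, stripped of its coefficient.\<close>

definition least_rep :: "('v, 'k) ext_basis \<Rightarrow> nat \<times> ('v \<Rightarrow>\<^sub>0 nat) \<Rightarrow> nat \<Rightarrow> ('v \<Rightarrow>\<^sub>0 nat) \<Rightarrow> bool" where
  "least_rep B S i x \<longleftrightarrow> i \<in> {1..bsize B} \<and> shift (sexp B i) x = S \<and>
     (\<forall>i'\<in>{1..bsize B}. \<forall>x'. shift (sexp B i') x' = S \<longrightarrow> ler (x + lexp B i) (x' + lexp B i'))"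

lemma basis_ok_gen:
  assumes "basis_ok B" "i \<in> {1..bsize B}"
  shows "bphi B i \<in> free_module m" "poly_image g (bphi B i) = bgen B i" "bgen B i \<noteq> 0"
    "bphi B i \<noteq> 0" "sexp B i \<in> mdom m"
proof -
  show *: "bphi B i \<in> free_module m" "poly_image g (bphi B i) = bgen B i" "bgen B i \<noteq> 0"
    using assms unfolding basis_ok_def by blast+
  then show "bphi B i \<noteq> 0" by auto
  with * show "sexp B i \<in> mdom m" unfolding sexp_def using spp_in by blast
qed

lemma phi_in_free_module:
  assumes "basis_ok B" "u \<in> free_module (bsize B)" shows "phi B u \<in> free_module m"
  unfolding phi_def
  by (rule sum_in_free_module, rule free_module_closed(4), rule basis_ok_gen(1)[OF assms(1)])
    (use assms(2) in \<open>auto simp: free_module_def\<close>)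

lemma poly_image_eq_phi:
  assumes "basis_ok B" "u \<in> free_module (bsize B)"
  shows "poly_image (bgen B) u = poly_image g (phi B u)"
  unfolding phi_def poly_image_sum poly_image_vscale unfolding poly_image_def[of "bgen B"]
  by (rule sum.cong[OF HOL.refl], subst basis_ok_gen(2)[OF assms(1)])
    (use assms(2) in \<open>auto simp: free_module_def\<close>)

lemma sig_eq:
  assumes "basis_ok B" "u \<in> free_module (bsize B)" "phi B u \<noteq> 0"
  shows "sig leM B u = mterm (spp (phi B u)) (vcoef (phi B u) (spp (phi B u)))"
    and "vcoef (phi B u) (spp (phi B u)) \<noteq> 0" and "spp (phi B u) \<in> mdom m"
  unfolding sig_def
  using signature_eq vcoef_spp spp_in phi_in_free_module[OF assms(1,2)] assms(3) by blast+

lemma phi_single_facts: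
  assumes "basis_ok B" "i \<in> {1..bsize B}" "f \<noteq> 0"
  shows "phi B (Poly_Mapping.single i f) \<noteq> 0"
    "spp (phi B (Poly_Mapping.single i f)) = shift (sexp B i) (lpp f)"
    "Poly_Mapping.single i f \<in> free_module (bsize B)"
    "vcoef (phi B (Poly_Mapping.single i f)) (shift (sexp B i) (lpp f)) =
       Poly_Mapping.lookup f (lpp f) * vcoef (bphi B i) (sexp B i)"
  unfolding phi_single sexp_def
  using spp_vscale[OF assms(3) basis_ok_gen(1,4)[OF assms(1,2)]] single_in_free_module[OF assms(2)]
  by auto

lemma sig_single:
  assumes "basis_ok B" "i \<in> {1..bsize B}" "c \<noteq> 0"
  shows "sig leM B (Poly_Mapping.single i (Poly_Mapping.single x c)) =
    mterm (shift (sexp B i) x) (c * vcoef (bphi B i) (sexp B i))"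
    and "vcoef (bphi B i) (sexp B i) \<noteq> 0"
proof -
  have nz: "Poly_Mapping.single x c \<noteq> 0" using assms(3) by (metis lookup_single_eq lookup_zero)
  show "sig leM B (Poly_Mapping.single i (Poly_Mapping.single x c)) =
    mterm (shift (sexp B i) x) (c * vcoef (bphi B i) (sexp B i))"
    using sig_eq(1)[OF assms(1) phi_single_facts(3,1)[OF assms(1,2) nz]]
      phi_single_facts(2,4)[OF assms(1,2) nz] assms(3) by simp
  show "vcoef (bphi B i) (sexp B i) \<noteq> 0"
    unfolding sexp_def using vcoef_spp basis_ok_gen[OF assms(1,2)] by blast
qed

lemma image_single:
  assumes "basis_ok B" "i \<in> {1..bsize B}" "c \<noteq> 0"
  shows "lead_term leR (poly_image (bgen B) (Poly_Mapping.single i (Poly_Mapping.single x c))) =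
      Poly_Mapping.single (x + lexp B i) (c * Poly_Mapping.lookup (bgen B i) (lexp B i))"
    and "Poly_Mapping.lookup (bgen B i) (lexp B i) \<noteq> 0"
proof -
  have nz: "Poly_Mapping.single x c \<noteq> 0" using assms(3) by (metis lookup_single_eq lookup_zero)
  show "lead_term leR (poly_image (bgen B) (Poly_Mapping.single i (Poly_Mapping.single x c))) =
      Poly_Mapping.single (x + lexp B i) (c * Poly_Mapping.lookup (bgen B i) (lexp B i))"
    using lpp_mult[OF nz basis_ok_gen(3)[OF assms(1,2)]] assms(3)
    by (simp add: poly_image_single lead_term_eq lexp_def)
  show "Poly_Mapping.lookup (bgen B i) (lexp B i) \<noteq> 0"
    unfolding lexp_def using lookup_lpp basis_ok_gen[OF assms(1,2)] by blast
qed

lemma lead_term_in_terms_of: "f \<noteq> 0 \<Longrightarrow> lead_term leR f \<in> terms_of f"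
  using lookup_lpp[of f] unfolding lead_term_eq by (auto simp: terms_of_def in_keys_iff)

lemma s_reduces_lead_exp:
  assumes B: "basis_ok B" and u: "u \<in> free_module (bsize B)" "poly_image (bgen B) u \<noteq> 0"
    and "s_reduces leR leM B a i u (lead_term leR (poly_image (bgen B) u))"
  obtains y c where "c \<noteq> 0" "a = Poly_Mapping.single y c" "i \<in> {1..bsize B}"
    "y + lexp B i = lpp (poly_image (bgen B) u)"
proof -
  obtain y c where a: "c \<noteq> 0" "a = Poly_Mapping.single y c" and i: "i \<in> {1..bsize B}"
    and lt: "lead_term leR (poly_image (bgen B) (Poly_Mapping.single i a)) = lead_term leR (poly_image (bgen B) u)"
    using assms(4) unfolding s_reduces_def monomials_iff by blast
  from lt have "y + lexp B i = lpp (poly_image (bgen B) u)"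
    unfolding a(2) image_single(1)[OF B i a(1)] lead_term_eq[OF u(2)]
    using image_single(2)[OF B i a(1)] a(1) by (subst (asm) single_eq_iff) auto
  with a i that show ?thesis by blast
qed

lemma lead_exp_reducible:
  assumes B: "basis_ok B" and u: "u \<in> free_module (bsize B)" "poly_image (bgen B) u \<noteq> 0"
    and i: "i \<in> {1..bsize B}" "y + lexp B i = lpp (poly_image (bgen B) u)"
    and le: "lem (shift (sexp B i) y) (spp (phi B u))"
  obtains c where "c \<noteq> 0"
    "s_reduces leR leM B (Poly_Mapping.single y c) i u (lead_term leR (poly_image (bgen B) u))"
proof -
  have nz: "phi B u \<noteq> 0" using poly_image_eq_phi[OF B u(1)] u(2) by auto
  \<comment> \<open>A reducer must match the lead term including its coefficient, hence the quotient
    of the lead coefficients.\<close>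
  let ?c = "Poly_Mapping.lookup (poly_image (bgen B) u) (lpp (poly_image (bgen B) u)) /
      Poly_Mapping.lookup (bgen B i) (lexp B i)"
  have lc: "Poly_Mapping.lookup (bgen B i) (lexp B i) \<noteq> 0" using image_single(2)[OF B i(1), of 1] by simp
  with lookup_lpp[OF u(2)] have c: "?c \<noteq> 0" by simp
  have "s_reduces leR leM B (Poly_Mapping.single y ?c) i u (lead_term leR (poly_image (bgen B) u))"
    unfolding s_reduces_def
  proof (intro conjI)
    show "leM (sig leM B (Poly_Mapping.single i (Poly_Mapping.single y ?c))) (sig leM B u)"
      unfolding sig_single(1)[OF B i(1) c] sig_eq(1)[OF B u(1) nz]
      by (subst leM_mterm_iff)
        (use c sig_single(2)[OF B i(1) c] sig_eq[OF B u(1) nz] basis_ok_gen(5)[OF B i(1)] le in simp_all)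
    show "lead_term leR (poly_image (bgen B) (Poly_Mapping.single i (Poly_Mapping.single y ?c))) =
        lead_term leR (poly_image (bgen B) u)"
      unfolding image_single(1)[OF B i(1) c] using lc i(2) lead_term_eq[OF u(2)] by simp
  qed (use c i lead_term_in_terms_of[OF u(2)] in simp_all)
  with c that show ?thesis by blast
qed

lemma strict_sig_iff:
  assumes B: "basis_ok B" and u: "u \<in> free_module (bsize B)" "phi B u \<noteq> 0"
    and i: "i \<in> {1..bsize B}" "c \<noteq> 0"
  shows "strict_of leM (sig leM B (Poly_Mapping.single i (Poly_Mapping.single y c))) (sig leM B u) \<longleftrightarrow>
      M.lt (shift (sexp B i) y) (spp (phi B u))"
    and "simeq vscale (sig leM B (Poly_Mapping.single i (Poly_Mapping.single y c))) (sig leM B u) \<longleftrightarrow>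
      shift (sexp B i) y = spp (phi B u)"
  unfolding sig_single(1)[OF B i] sig_eq(1)[OF B u]
  using sig_single(2)[OF B i] sig_eq[OF B u] basis_ok_gen(5)[OF B i(1)] i(2)
  by (simp_all add: strict_leM_mterm_iff simeq_mterm_iff)

lemma regular_top_reducible_iff:
  assumes B: "basis_ok B" and u: "u \<in> free_module (bsize B)" "poly_image (bgen B) u \<noteq> 0"
  shows "regular_top_reducible leR leM B u \<longleftrightarrow>
    reg_reducible B (lpp (poly_image (bgen B) u)) (spp (phi B u))"
proof -
  have nz: "phi B u \<noteq> 0" using poly_image_eq_phi[OF B u(1)] u(2) by auto
  show ?thesis
  proof
    assume "regular_top_reducible leR leM B u"
    then obtain a i where a: "s_reduces leR leM B a i u (lead_term leR (poly_image (bgen B) u))"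
      "strict_of leM (sig leM B (Poly_Mapping.single i a)) (sig leM B u)"
      unfolding regular_top_reducible_def regular_reduces_def by blast
    obtain y c where yc: "c \<noteq> 0" "a = Poly_Mapping.single y c" "i \<in> {1..bsize B}"
      "y + lexp B i = lpp (poly_image (bgen B) u)"
      by (rule s_reduces_lead_exp[OF B u a(1)])
    from a(2) have "M.lt (shift (sexp B i) y) (spp (phi B u))"
      unfolding yc(2) strict_sig_iff(1)[OF B u(1) nz yc(3,1)] .
    with yc show "reg_reducible B (lpp (poly_image (bgen B) u)) (spp (phi B u))"
      unfolding reg_reducible_def by blast
  next
    assume "reg_reducible B (lpp (poly_image (bgen B) u)) (spp (phi B u))"
    then obtain i y where i: "i \<in> {1..bsize B}" "y + lexp B i = lpp (poly_image (bgen B) u)"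
      and lt: "M.lt (shift (sexp B i) y) (spp (phi B u))"
      unfolding reg_reducible_def by blast
    obtain c where c: "c \<noteq> 0"
      "s_reduces leR leM B (Poly_Mapping.single y c) i u (lead_term leR (poly_image (bgen B) u))"
      by (rule lead_exp_reducible[OF B u i M.lt_imp_le[OF lt]])
    with lt show "regular_top_reducible leR leM B u"
      unfolding regular_top_reducible_def regular_reduces_def
      using strict_sig_iff(1)[OF B u(1) nz i(1) c(1)] by blast
  qed
qed

lemma singular_top_reducible_iff:
  assumes B: "basis_ok B" and u: "u \<in> free_module (bsize B)" "poly_image (bgen B) u \<noteq> 0"
  shows "singular_top_reducible leR leM B u \<longleftrightarrow>
    sing_reducible B (lpp (poly_image (bgen B) u)) (spp (phi B u))"
proof -
  have nz: "phi B u \<noteq> 0" using poly_image_eq_phi[OF B u(1)] u(2) by auto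
  show ?thesis
  proof
    assume "singular_top_reducible leR leM B u"
    then obtain a i where a: "s_reduces leR leM B a i u (lead_term leR (poly_image (bgen B) u))"
      "simeq vscale (sig leM B (Poly_Mapping.single i a)) (sig leM B u)"
      unfolding singular_top_reducible_def singular_reduces_def by blast
    obtain y c where yc: "c \<noteq> 0" "a = Poly_Mapping.single y c" "i \<in> {1..bsize B}"
      "y + lexp B i = lpp (poly_image (bgen B) u)"
      by (rule s_reduces_lead_exp[OF B u a(1)])
    from a(2) have "shift (sexp B i) y = spp (phi B u)"
      unfolding yc(2) strict_sig_iff(2)[OF B u(1) nz yc(3,1)] .
    with yc show "sing_reducible B (lpp (poly_image (bgen B) u)) (spp (phi B u))"
      unfolding sing_reducible_def by blast
  next
    assume "sing_reducible B (lpp (poly_image (bgen B) u)) (spp (phi B u))"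
    then obtain i y where i: "i \<in> {1..bsize B}" "y + lexp B i = lpp (poly_image (bgen B) u)"
      and eq: "shift (sexp B i) y = spp (phi B u)"
      unfolding sing_reducible_def by blast
    obtain c where c: "c \<noteq> 0"
      "s_reduces leR leM B (Poly_Mapping.single y c) i u (lead_term leR (poly_image (bgen B) u))"
      by (rule lead_exp_reducible[OF B u i])
        (use eq sig_eq(3)[OF B u(1) nz] M.refl in simp)
    with eq show "singular_top_reducible leR leM B u"
      unfolding singular_top_reducible_def singular_reduces_def
      using strict_sig_iff(2)[OF B u(1) nz i(1) c(1)] by blast
  qed
qed

text \<open>Only something of strictly smaller signature is subtracted, so the top of
  \<open>phi B u\<close> survives. In particular \<open>phi B u'\<close> stays nonzero even if the
  image vanishes, and a reduction to zero exhibits a nonzero syzygy.\<close>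

lemma regular_step_signature:
  assumes B: "basis_ok B" and u: "u \<in> free_module (bsize B)" "phi B u \<noteq> 0"
    and step: "regular_step leR leM B u u'"
  shows "u' \<in> free_module (bsize B) \<and> phi B u' \<noteq> 0 \<and> spp (phi B u') = spp (phi B u)"
proof -
  obtain a i where "a \<in> monomials" and i: "i \<in> {1..bsize B}"
    and lt: "strict_of leM (sig leM B (Poly_Mapping.single i a)) (sig leM B u)"
    and u': "u' = u - Poly_Mapping.single i a"
    using step unfolding regular_step_def regular_reduces_def s_reduces_def by blast
  then obtain y c where a: "c \<noteq> 0" "a = Poly_Mapping.single y c" by (auto simp: monomials_iff)
  have nz: "a \<noteq> 0" using a by (metis lookup_single_eq lookup_zero)
  note single = phi_single_facts[OF B i nz]
  have "M.lt (spp (phi B (Poly_Mapping.single i a))) (spp (phi B u))"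
    using lt strict_sig_iff(1)[OF B u i a(1)] single(2) a by simp
  then show ?thesis
    unfolding u' phi_diff
    using spp_diff[OF phi_in_free_module[OF B u(1)] phi_in_free_module[OF B single(3)] u(2)]
      free_module_closed(3)[OF u(1) single(3)] by blast
qed

lemma regular_reduction_result_facts:
  assumes B: "basis_ok B" and u: "u \<in> free_module (bsize B)" "phi B u \<noteq> 0"
    and res: "regular_reduction_result leR leM B u p'"
  shows "p' \<in> free_module (bsize B)" "phi B p' \<noteq> 0" "spp (phi B p') = spp (phi B u)"
    "poly_image (bgen B) p' \<noteq> 0 \<Longrightarrow> \<not> reg_reducible B (lpp (poly_image (bgen B) p')) (spp (phi B u))"
proof -
  have "(regular_step leR leM B)\<^sup>*\<^sup>* u p'" using res by (simp add: regular_reduction_result_def)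
  then have "p' \<in> free_module (bsize B) \<and> phi B p' \<noteq> 0 \<and> spp (phi B p') = spp (phi B u)"
  proof (induction rule: rtranclp_induct)
    case (step v w)
    with regular_step_signature[OF B, of v w] show ?case by simp
  qed (use u in simp)
  then show p': "p' \<in> free_module (bsize B)" "phi B p' \<noteq> 0" "spp (phi B p') = spp (phi B u)" by auto
  assume "poly_image (bgen B) p' \<noteq> 0"
  from regular_top_reducible_iff[OF B p'(1) this] res p'(3)
  show "\<not> reg_reducible B (lpp (poly_image (bgen B) p')) (spp (phi B u))"
    unfolding regular_reduction_result_def regular_reduced_def regular_top_reducible_def by metis
qed

text \<open>The criterion asks for the signature \<open>T\<close> with its exact coefficient. A
  multiple whose signature has the right exponent can always be scaled to it, and neither lead
  exponents nor regular reducibility notice the scaling.\<close>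

lemma singular_criterion_iff:
  assumes B: "basis_ok B" and c: "c \<noteq> 0"
  shows "singular_criterion leR leM B (mterm S c) \<longleftrightarrow>
    (\<exists>i x. least_rep B S i x \<and> \<not> reg_reducible B (x + lexp B i) S)"
proof -
  let ?s = "\<lambda>i x d. Poly_Mapping.single i (Poly_Mapping.single x d) :: ('v, 'k) fvec"
  have sig: "sig leM B (?s i x d) = mterm S c \<longleftrightarrow>
      shift (sexp B i) x = S \<and> d * vcoef (bphi B i) (sexp B i) = c"
    if "i \<in> {1..bsize B}" "d \<noteq> 0" for i x d
    unfolding sig_single(1)[OF B that] by (rule mterm_eq_iff) (use that sig_single(2)[OF B that] in simp)
  have ex: "\<exists>d. d \<noteq> 0 \<and> d * vcoef (bphi B i) (sexp B i) = c" if "i \<in> {1..bsize B}" for i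
    using sig_single(2)[OF B that, of 1] c by (intro exI[of _ "c / vcoef (bphi B i) (sexp B i)"]) auto
  have lead: "leR (lead_term leR (poly_image (bgen B) (?s i x d)))
        (lead_term leR (poly_image (bgen B) (?s i' x' d'))) \<longleftrightarrow> ler (x + lexp B i) (x' + lexp B i')"
    if "i \<in> {1..bsize B}" "d \<noteq> 0" "i' \<in> {1..bsize B}" "d' \<noteq> 0" for i x d i' x' d'
    unfolding image_single(1)[OF B that(1,2)] image_single(1)[OF B that(3,4)]
    by (rule leR_single_iff) (use that image_single(2)[OF B that(1,2)] image_single(2)[OF B that(3,4)] in auto)
  have red: "regular_top_reducible leR leM B (?s i x d) \<longleftrightarrow> reg_reducible B (x + lexp B i) (shift (sexp B i) x)"
    if "i \<in> {1..bsize B}" "d \<noteq> 0" for i x d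
  proof -
    have nz: "Poly_Mapping.single x d \<noteq> 0" using that(2) by (metis lookup_single_eq lookup_zero)
    have im: "poly_image (bgen B) (?s i x d) \<noteq> 0" "lpp (poly_image (bgen B) (?s i x d)) = x + lexp B i"
      using lpp_mult[OF nz basis_ok_gen(3)[OF B that(1)]] that(2)
      by (simp_all add: poly_image_single lexp_def)
    show ?thesis
      using regular_top_reducible_iff[OF B phi_single_facts(3)[OF B that(1) nz] im(1)]
        phi_single_facts(2)[OF B that(1) nz] that(2) im(2) by simp
  qed
  show ?thesis
  proof
    assume "singular_criterion leR leM B (mterm S c)"
    then obtain t i where t: "t \<in> monomials" and i: "i \<in> {1..bsize B}"
      and s: "sig leM B (Poly_Mapping.single i t) = mterm S c"
      and least: "\<And>t' i'. t' \<in> monomials \<Longrightarrow> i' \<in> {1..bsize B} \<Longrightarrow>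
        sig leM B (Poly_Mapping.single i' t') = mterm S c \<Longrightarrow>
        leR (lead_term leR (poly_image (bgen B) (Poly_Mapping.single i t)))
          (lead_term leR (poly_image (bgen B) (Poly_Mapping.single i' t')))"
      and nred: "\<not> regular_top_reducible leR leM B (Poly_Mapping.single i t)"
      unfolding singular_criterion_def by blast
    from t obtain x d where x: "d \<noteq> 0" "t = Poly_Mapping.single x d" unfolding monomials_iff by blast
    have S: "shift (sexp B i) x = S" using s sig[OF i x(1)] x(2) by blast
    have "ler (x + lexp B i) (x' + lexp B i')"
      if i': "i' \<in> {1..bsize B}" "shift (sexp B i') x' = S" for i' x'
    proof -
      obtain d' where d': "d' \<noteq> 0" "d' * vcoef (bphi B i') (sexp B i') = c" using ex[OF i'(1)] by blast
      show ?thesis using least[of "Poly_Mapping.single x' d'" i'] sig[OF i'(1) d'(1)] d' i'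
          lead[OF i x(1) i'(1) d'(1)] x(2) by simp
    qed
    then have "least_rep B S i x" unfolding least_rep_def using i S by blast
    with nred red[OF i x(1)] S x(2)
    show "\<exists>i x. least_rep B S i x \<and> \<not> reg_reducible B (x + lexp B i) S" by auto
  next
    assume "\<exists>i x. least_rep B S i x \<and> \<not> reg_reducible B (x + lexp B i) S"
    then obtain i x where i: "i \<in> {1..bsize B}" and S: "shift (sexp B i) x = S"
      and least: "\<And>i' x'. i' \<in> {1..bsize B} \<Longrightarrow> shift (sexp B i') x' = S \<Longrightarrow> ler (x + lexp B i) (x' + lexp B i')"
      and nred: "\<not> reg_reducible B (x + lexp B i) S"
      unfolding least_rep_def by blast
    obtain d where d: "d \<noteq> 0" "d * vcoef (bphi B i) (sexp B i) = c" using ex[OF i] by blast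
    show "singular_criterion leR leM B (mterm S c)"
      unfolding singular_criterion_def
    proof (intro bexI[of _ "Poly_Mapping.single x d"] bexI[of _ i] conjI ballI impI)
      show "sig leM B (?s i x d) = mterm S c" using sig[OF i d(1)] S d(2) by blast
      show "\<not> regular_top_reducible leR leM B (?s i x d)" using red[OF i d(1)] nred S by simp
      fix t' i' assume t': "t' \<in> monomials" "i' \<in> {1..bsize B}" "sig leM B (Poly_Mapping.single i' t') = mterm S c"
      then obtain x' d' where x': "d' \<noteq> 0" "t' = Poly_Mapping.single x' d'" unfolding monomials_iff by blast
      show "leR (lead_term leR (poly_image (bgen B) (?s i x d)))
          (lead_term leR (poly_image (bgen B) (Poly_Mapping.single i' t')))"
        unfolding x'(2) lead[OF i d(1) t'(2) x'(1)]
        using least t' sig[OF t'(2) x'(1)] x'(2) by blast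
    qed (use d i in auto)
  qed
qed

section \<open>Signatures of S-pairs and of Koszul syzygies\<close>

lemma spp_diff_greater:
  assumes u: "u \<in> free_module m" "u \<noteq> 0" and v: "v \<in> free_module m" "v \<noteq> 0" and ne: "spp u \<noteq> spp v"
  shows "spp (u - v) = M.greater (spp u) (spp v)" "u - v \<noteq> 0"
proof -
  consider "M.lt (spp v) (spp u)" | "M.lt (spp u) (spp v)"
    using ne M.cases_order[OF spp_in[OF u] spp_in[OF v]] by metis
  then have "spp (u - v) = M.greater (spp u) (spp v) \<and> u - v \<noteq> 0"
  proof cases
    case 1
    then have "M.greater (spp u) (spp v) = spp u"
      using M.not_le[OF spp_in[OF u] spp_in[OF v]] by (simp add: M.greater_def)
    with 1 spp_diff[OF u(1) v(1) u(2)] show ?thesis by simp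
  next
    case 2
    then have "M.greater (spp u) (spp v) = spp v" by (simp add: M.greater_def M.lt_def)
    moreover have "spp (v - u) = spp v" "v - u \<noteq> 0" using 2 spp_diff[OF v(1) u(1) v(2)] by auto
    \<comment> \<open>The two differences have the same support, so this case reduces to the
      previous one.\<close>
    moreover have "spp (u - v) = spp (v - u)"
      by (rule spp_eqI)
        (use u v \<open>v - u \<noteq> 0\<close> vcoef_spp[of "v - u"] le_spp[of "v - u"]
          in \<open>auto simp: free_module_closed vcoef_diff\<close>)
    ultimately show ?thesis by auto
  qed
  then show "spp (u - v) = M.greater (spp u) (spp v)" "u - v \<noteq> 0" by auto
qed

lemma plcm_commute: "plcm B i j = plcm B j i"
  unfolding plcm_def cofactor_def using add_minus_pp_gcd pp_gcd_commute by metis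

lemma preg_commute: "preg B i j \<longleftrightarrow> preg B j i"
  unfolding preg_def by metis

lemma preg_neq: "preg B i j \<Longrightarrow> i \<noteq> j"
  unfolding preg_def cofactor_def by auto

lemma greater_commute:
  "p \<in> mdom m \<Longrightarrow> q \<in> mdom m \<Longrightarrow> M.greater p q = M.greater q p"
  using M.total[of p q] M.antisym[of p q] by (auto simp: M.greater_def)

lemma le_greater:
  assumes "p \<in> mdom m" "q \<in> mdom m" shows "lem p (M.greater p q)" "lem q (M.greater p q)"
  using assms M.total[of p q] M.refl[of p] M.refl[of q] by (auto simp: M.greater_def)

lemma greater_in: "p \<in> mdom m \<Longrightarrow> q \<in> mdom m \<Longrightarrow> M.greater p q \<in> mdom m"
  by (simp add: M.greater_def)

lemma psig_commute:
  "basis_ok B \<Longrightarrow> i \<in> {1..bsize B} \<Longrightarrow> j \<in> {1..bsize B} \<Longrightarrow> psig B i j = psig B j i"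
  unfolding psig_def using basis_ok_gen(5) by (intro greater_commute) auto

lemma psig_in: "basis_ok B \<Longrightarrow> i \<in> {1..bsize B} \<Longrightarrow> j \<in> {1..bsize B} \<Longrightarrow> psig B i j \<in> mdom m"
  unfolding psig_def using basis_ok_gen(5) by (intro greater_in) auto

lemma spair_facts:
  assumes B: "basis_ok B" and i: "i \<in> {1..bsize B}" and j: "j \<in> {1..bsize B}"
  shows "regular_spair leR leM B (i, j) \<longleftrightarrow> preg B i j"
    "spair leR B (i, j) \<in> free_module (bsize B)"
    "preg B i j \<Longrightarrow> phi B (spair leR B (i, j)) \<noteq> 0"
    "preg B i j \<Longrightarrow> spp (phi B (spair leR B (i, j))) = psig B i j"
proof -
  let ?ci = "Poly_Mapping.lookup (bgen B i) (lexp B i)" and ?cj = "Poly_Mapping.lookup (bgen B j) (lexp B j)"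
  have nz: "?ci \<noteq> 0" "?cj \<noteq> 0" using image_single(2)[OF B i, of 1] image_single(2)[OF B j, of 1] by auto
  have l: "lead_term leR (bgen B i) = Poly_Mapping.single (lexp B i) ?ci"
    "lead_term leR (bgen B j) = Poly_Mapping.single (lexp B j) ?cj"
    using lead_term_eq basis_ok_gen(3)[OF B] i j by (simp_all add: lexp_def)
  let ?a = "Poly_Mapping.single (cofactor B i j) ?cj" and ?b = "Poly_Mapping.single (cofactor B j i) ?ci"
  have left: "spair_left leR B (i, j) = Poly_Mapping.single i ?a"
    and right: "spair_right leR B (i, j) = Poly_Mapping.single j ?b"
    using nz by (simp_all add: spair_left_def spair_right_def l term_div_def term_gcd_def cofactor_def
        pp_gcd_commute[of "lexp B j"])
  have nz': "?a \<noteq> 0" "?b \<noteq> 0" using nz by (metis lookup_single_eq lookup_zero)+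
  show "regular_spair leR leM B (i, j) \<longleftrightarrow> preg B i j"
    unfolding regular_spair_def left right sig_single(1)[OF B i nz(2)] sig_single(1)[OF B j nz(1)] preg_def
    by (subst simeq_mterm_iff) (use nz sig_single(2)[OF B i nz(2)] sig_single(2)[OF B j nz(1)] in auto)
  note fi = phi_single_facts[OF B i nz'(1)] and fj = phi_single_facts[OF B j nz'(2)]
  show "spair leR B (i, j) \<in> free_module (bsize B)"
    unfolding spair_def left right by (rule free_module_closed(3)[OF fi(3) fj(3)])
  assume "preg B i j"
  then have "spp (phi B (Poly_Mapping.single i ?a)) \<noteq> spp (phi B (Poly_Mapping.single j ?b))"
    using nz by (simp add: fi(2) fj(2) preg_def)
  note * = spp_diff_greater[OF phi_in_free_module[OF B fi(3)] fi(1) phi_in_free_module[OF B fj(3)] fj(1) this]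
  show "phi B (spair leR B (i, j)) \<noteq> 0" "spp (phi B (spair leR B (i, j))) = psig B i j"
    unfolding spair_def left right phi_diff using * nz by (simp_all add: fi(2) fj(2) psig_def)
qed

text \<open>The signature of \<open>g_j e_i\<close> is that of \<open>e_i\<close> shifted by the
  lead exponent of \<open>g_j\<close>; if the two halves differ, the larger one survives the
  subtraction.\<close>

lemma koszul_facts:
  assumes B: "basis_ok B" and i: "i \<in> {1..bsize B}" and j: "j \<in> {1..bsize B}"
  defines "a \<equiv> shift (sexp B i) (lexp B j)" and "b \<equiv> shift (sexp B j) (lexp B i)"
  shows "regular_koszul leM B i j \<longleftrightarrow> a \<noteq> b"
    "koszul B i j \<in> free_module (bsize B)" "poly_image (bgen B) (koszul B i j) = 0"
    "a \<noteq> b \<Longrightarrow> phi B (koszul B i j) \<noteq> 0"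
    "a \<noteq> b \<Longrightarrow> spp (phi B (koszul B i j)) = M.greater a b"
proof -
  note fi = phi_single_facts[OF B i basis_ok_gen(3)[OF B j]]
    and fj = phi_single_facts[OF B j basis_ok_gen(3)[OF B i]]
  have a: "spp (phi B (Poly_Mapping.single i (bgen B j))) = a"
    and b: "spp (phi B (Poly_Mapping.single j (bgen B i))) = b"
    by (simp_all add: fi(2) fj(2) a_def b_def lexp_def)
  show "regular_koszul leM B i j \<longleftrightarrow> a \<noteq> b"
    unfolding regular_koszul_def sig_eq(1)[OF B fi(3,1)] sig_eq(1)[OF B fj(3,1)]
    by (subst simeq_mterm_iff) (use sig_eq(2)[OF B fi(3,1)] sig_eq(2)[OF B fj(3,1)] a b in simp_all)
  show "koszul B i j \<in> free_module (bsize B)"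
    unfolding koszul_def by (rule free_module_closed(3)[OF fi(3) fj(3)])
  show "poly_image (bgen B) (koszul B i j) = 0"
    by (simp add: koszul_def poly_image_diff poly_image_single mult.commute)
  assume "a \<noteq> b"
  with a b have "spp (phi B (Poly_Mapping.single i (bgen B j))) \<noteq> spp (phi B (Poly_Mapping.single j (bgen B i)))"
    by simp
  note * = spp_diff_greater[OF phi_in_free_module[OF B fi(3)] fi(1) phi_in_free_module[OF B fj(3)] fj(1) this]
  show "phi B (koszul B i j) \<noteq> 0" "spp (phi B (koszul B i j)) = M.greater a b"
    unfolding koszul_def phi_diff using * by (simp_all add: a b)
qed

lemma koszul_signature_iff:
  assumes B: "basis_ok B" and c: "c \<noteq> 0"
  shows "koszul_signature leM B (mterm S c) \<longleftrightarrow> koszul_exp B S"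
proof -
  have "(regular_koszul leM B i j \<and> simeq vscale (mterm S c) (sig leM B (koszul B i j))) \<longleftrightarrow>
     (shift (sexp B i) (lexp B j) \<noteq> shift (sexp B j) (lexp B i) \<and>
     S = M.greater (shift (sexp B i) (lexp B j)) (shift (sexp B j) (lexp B i)))"
    if i: "i \<in> {1..bsize B}" and j: "j \<in> {1..bsize B}" for i j
  proof (cases "regular_koszul leM B i j")
    case True
    note K = koszul_facts[OF B i j]
    from True have ne: "shift (sexp B i) (lexp B j) \<noteq> shift (sexp B j) (lexp B i)" using K(1) by blast
    show ?thesis
      unfolding sig_eq(1)[OF B K(2) K(4)[OF ne]]
      by (subst simeq_mterm_iff) (use True ne c sig_eq(2)[OF B K(2) K(4)[OF ne]] K(5)[OF ne] in auto)
  qed (use koszul_facts(1)[OF B i j] in blast)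
  then show ?thesis unfolding koszul_signature_def koszul_exp_def by auto
qed

section \<open>Lead exponents in a given signature\<close>

text \<open>These turn out to be the exponents of all terms of the initial submodule, not merely of
  its generators.\<close>

definition syz_exps :: "(nat \<times> ('v \<Rightarrow>\<^sub>0 nat)) set" where
  "syz_exps = {spp u | u. u \<in> free_module m \<and> u \<noteq> 0 \<and> poly_image g u = 0}"

text \<open>Singular reducers count, since the comparison is by \<open>lem\<close>. The elements
  range over \<open>R^m\<close> because the image and the signature of an element of
  \<open>R^n\<close> depend only on its value under \<open>phi\<close>.\<close>

definition gb_at :: "('v, 'k) ext_basis \<Rightarrow> nat \<times> ('v \<Rightarrow>\<^sub>0 nat) \<Rightarrow> bool" where
  "gb_at B S \<longleftrightarrow> (\<forall>u. u \<in> free_module m \<longrightarrow> u \<noteq> 0 \<longrightarrow> spp u = S \<longrightarrow> poly_image g u \<noteq> 0 \<longrightarrow>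
     (\<exists>j\<in>{1..bsize B}. \<exists>y. y + lexp B j = lpp (poly_image g u) \<and> lem (shift (sexp B j) y) S))"

text \<open>
  An S-pair no longer has to be considered if a known syzygy divides its signature, or if some
  multiple of a basis element has the same signature and a smaller lead term than both halves.
\<close>

definition resolved ::
  "('v, 'k) ext_basis \<Rightarrow> (nat \<times> ('v \<Rightarrow>\<^sub>0 nat)) set \<Rightarrow> nat \<Rightarrow> nat \<Rightarrow> bool" where
  "resolved B Y i j \<longleftrightarrow> (\<exists>p\<in>Y. \<exists>h. shift p h = psig B i j) \<or>
     (\<exists>k\<in>{1..bsize B}. \<exists>t. shift (sexp B k) t = psig B i j \<and> R.lt (t + lexp B k) (plcm B i j))"

definition processed ::
  "('v, 'k) ext_basis \<Rightarrow> (nat \<times> nat) set \<Rightarrow> (nat \<times> ('v \<Rightarrow>\<^sub>0 nat)) set \<Rightarrow> bool" where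
  "processed B P Y \<longleftrightarrow> P \<subseteq> {1..bsize B} \<times> {1..bsize B} \<and> Y \<subseteq> syz_exps \<and>
     (\<forall>i\<in>{1..bsize B}. \<forall>j\<in>{1..bsize B}. i < j \<longrightarrow> preg B i j \<longrightarrow> (i, j) \<notin> P \<longrightarrow> resolved B Y i j)"

definition none_pending :: "('v, 'k) ext_basis \<Rightarrow> (nat \<times> nat) set \<Rightarrow> nat \<times> ('v \<Rightarrow>\<^sub>0 nat) \<Rightarrow> bool" where
  "none_pending B P S \<longleftrightarrow> (\<forall>(i, j)\<in>P. \<not> lem (psig B i j) S)"

lemma syz_exps_in: "p \<in> syz_exps \<Longrightarrow> p \<in> mdom m"
  unfolding syz_exps_def using spp_in by blast

lemma nonzero_single: "c \<noteq> 0 \<Longrightarrow> Poly_Mapping.single x c \<noteq> (0 :: ('v, 'k) pol)"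
  by (metis lookup_single_eq lookup_zero)

lemma ex_syzygy_shift:
  assumes "p \<in> syz_exps"
  shows "\<exists>u. u \<in> free_module m \<and> u \<noteq> 0 \<and> poly_image g u = 0 \<and> spp u = shift p h"
proof -
  obtain v where v: "v \<in> free_module m" "v \<noteq> 0" "poly_image g v = 0" "p = spp v"
    using assms unfolding syz_exps_def by blast
  then have "vscale (Poly_Mapping.single h 1) v \<in> free_module m \<and> vscale (Poly_Mapping.single h 1) v \<noteq> 0 \<and>
      poly_image g (vscale (Poly_Mapping.single h 1) v) = 0 \<and>
      spp (vscale (Poly_Mapping.single h 1) v) = shift p h"
    using spp_vscale[OF nonzero_single[of 1 h] v(1,2)]
    by (simp add: free_module_closed poly_image_vscale)
  then show ?thesis by blast
qed

lemma syz_exps_shift: "p \<in> syz_exps \<Longrightarrow> shift p h \<in> syz_exps"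
  using ex_syzygy_shift[of p h] unfolding syz_exps_def by force

lemma ex_multiple:
  assumes B: "basis_ok B" and i: "i \<in> {1..bsize B}"
  obtains v where "v \<in> free_module m" "v \<noteq> 0" "spp v = shift (sexp B i) x" "poly_image g v \<noteq> 0"
    "lpp (poly_image g v) = x + lexp B i"
proof
  let ?v = "vscale (Poly_Mapping.single x 1) (bphi B i)"
  note nz = nonzero_single[of 1 x, simplified]
  show "?v \<in> free_module m" by (rule free_module_closed(4)[OF basis_ok_gen(1)[OF B i]])
  show "?v \<noteq> 0" "spp ?v = shift (sexp B i) x"
    using spp_vscale[OF nz basis_ok_gen(1,4)[OF B i]] by (simp_all add: sexp_def)
  show "poly_image g ?v \<noteq> 0" "lpp (poly_image g ?v) = x + lexp B i"
    using lpp_mult[OF nz basis_ok_gen(3)[OF B i]]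
    by (simp_all add: poly_image_vscale basis_ok_gen(2)[OF B i] lexp_def)
qed

text \<open>\<open>v\<close> may be a syzygy, hence lead exponents are compared only if its image is
  nonzero: one lemma covers comparison with a basis multiple and with a syzygy. The reducer found
  has signature at most that of the difference, which lies below \<open>S\<close>, so it is
  regular.\<close>

lemma reg_reducible_if_not_least:
  assumes B: "basis_ok B" and gb: "\<And>S'. S' \<in> mdom m \<Longrightarrow> M.lt S' S \<Longrightarrow> gb_at B S'"
    and u: "u \<in> free_module m" "u \<noteq> 0" "spp u = S" "poly_image g u \<noteq> 0"
    and v: "v \<in> free_module m" "v \<noteq> 0" "spp v = S"
    and lt: "poly_image g v \<noteq> 0 \<Longrightarrow> R.lt (lpp (poly_image g v)) (lpp (poly_image g u))"
  shows "reg_reducible B (lpp (poly_image g u)) S"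
proof -
  obtain c where c: "c \<noteq> 0" and
    w: "u - vscale (Poly_Mapping.single 0 c) v \<noteq> 0 \<Longrightarrow>
      M.lt (spp (u - vscale (Poly_Mapping.single 0 c) v)) (spp u)"
    using spp_cancel[OF u(1) v(1) u(2) v(2)] u(3) v(3) by metis
  let ?w = "u - vscale (Poly_Mapping.single 0 c) v"
  have wm: "?w \<in> free_module m" using u v by (simp add: free_module_closed)
  have "R.lt (lpp (Poly_Mapping.single 0 c * poly_image g v)) (lpp (poly_image g u))"
    if "Poly_Mapping.single 0 c * poly_image g v \<noteq> 0"
  proof -
    have "poly_image g v \<noteq> 0" using that by auto
    then show ?thesis using lt lpp_mult(1)[OF nonzero_single[OF c, of 0]] c by simp
  qed
  \<comment> \<open>The scaled \<open>v\<close> contributes only below the lead exponent of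
    \<open>u\<close>: the signature cancels while the lead exponent stays.\<close>
  then have w': "lpp (poly_image g ?w) = lpp (poly_image g u)" "poly_image g ?w \<noteq> 0"
    using lpp_diff[OF u(4)] by (simp_all add: poly_image_diff poly_image_vscale)
  then have nz: "?w \<noteq> 0" by auto
  then have wS: "M.lt (spp ?w) S" "spp ?w \<in> mdom m" using w u(3) spp_in[OF wm] by auto
  then obtain j y where jy: "j \<in> {1..bsize B}" "y + lexp B j = lpp (poly_image g u)"
      "lem (shift (sexp B j) y) (spp ?w)"
    using gb[OF wS(2,1)] wm nz w' unfolding gb_at_def by metis
  have "S \<in> mdom m" using spp_in[OF u(1,2)] u(3) by simp
  then have "M.lt (shift (sexp B j) y) S"
    using M.le_lt_trans[OF _ _ _ jy(3) wS(1)] basis_ok_gen(5)[OF B jy(1)] wS(2) by simp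
  with jy show ?thesis unfolding reg_reducible_def by blast
qed

section \<open>Multiples of basis elements in a given signature and their S-pairs\<close>

lemma sexp_input:
  assumes "basis_ok B" "i \<in> {1..m}" shows "sexp B i = (i, 0)"
proof -
  have "bphi B i = mterm (i, 0) 1" using assms by (simp add: basis_ok_def mterm_def)
  then show ?thesis using assms(2) by (simp add: sexp_def spp_mterm mdom_def)
qed

lemma ex_least_rep_below:
  assumes "i \<in> {1..bsize B}" "shift (sexp B i) x = S"
  shows "\<exists>k t. least_rep B S k t \<and> ler (t + lexp B k) (x + lexp B i)"
proof -
  let ?A = "{t + lexp B k | k t. k \<in> {1..bsize B} \<and> shift (sexp B k) t = S}"
  have mem: "x + lexp B i \<in> ?A" using assms by blast
  then obtain z where "z \<in> ?A" "\<forall>q\<in>?A. ler z q"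
    using R.ex_least[of ?A] by blast
  with mem show ?thesis unfolding least_rep_def by blast
qed

text \<open>The input element with index \<open>fst S\<close> has signature exponent
  \<open>(fst S, 0)\<close>, so its multiple by \<open>snd S\<close> is a first
  representation.\<close>

lemma ex_least_rep:
  assumes "basis_ok B" "S \<in> mdom m" shows "\<exists>i x. least_rep B S i x"
proof -
  have i: "fst S \<in> {1..m}" using assms(2) by (simp add: mdom_def mem_Times_iff)
  moreover have "m \<le> bsize B" using assms(1) by (simp add: basis_ok_def)
  ultimately have "fst S \<in> {1..bsize B}" by simp
  moreover have "shift (sexp B (fst S)) (snd S) = S"
    using sexp_input[OF assms(1) i] by (simp add: shift_def)
  ultimately show ?thesis using ex_least_rep_below by blast
qed

lemma greater_eq_left:
  assumes "p \<in> mdom m" "q \<in> mdom m" "M.lt q p" shows "M.greater p q = p"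
  using M.not_le[OF assms(1,2)] assms(3) by (simp add: M.greater_def)

text \<open>The multiple and its reducer share the lead exponent, hence factor through the lcm with
  a common rest \<open>h\<close>. Cancelling \<open>h\<close> from the strict signature inequality
  shows that the half of \<open>i\<close> carries the signature of the S-pair.\<close>

lemma spair_of_reg_reducible:
  assumes B: "basis_ok B" and i: "i \<in> {1..bsize B}" "shift (sexp B i) x = S"
    and red: "reg_reducible B (x + lexp B i) S"
  obtains j h where "j \<in> {1..bsize B}" "preg B i j" "shift (psig B i j) h = S"
    "plcm B i j + h = x + lexp B i"
proof -
  obtain j y where j: "j \<in> {1..bsize B}" and y: "x + lexp B i = y + lexp B j"
    and lt: "M.lt (shift (sexp B j) y) S"
    using red unfolding reg_reducible_def by metis
  obtain h where h: "x = cofactor B i j + h" "y = cofactor B j i + h"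
    using common_multiple_decomp[OF y] unfolding cofactor_def by (metis pp_gcd_commute)
  note D = basis_ok_gen(5)[OF B i(1)] basis_ok_gen(5)[OF B j]
  have "M.lt (shift (shift (sexp B j) (cofactor B j i)) h) (shift (shift (sexp B i) (cofactor B i j)) h)"
    using lt h i(2) by simp
  then have lt': "M.lt (shift (sexp B j) (cofactor B j i)) (shift (sexp B i) (cofactor B i j))"
    using ltm_shift_iff D by (metis shift_in_mdom)
  then have "psig B i j = shift (sexp B i) (cofactor B i j)"
    unfolding psig_def using D by (intro greater_eq_left) auto
  then have "shift (psig B i j) h = S" using h i(2) by simp
  moreover have "preg B i j" using lt' unfolding preg_def by (metis M.lt_irrefl)
  moreover have "plcm B i j + h = x + lexp B i" unfolding plcm_def h by (simp add: ac_simps)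
  ultimately show ?thesis using j that by blast
qed

text \<open>The half of larger signature is the representation, and the other half, with the same
  lead exponent, is its regular reducer.\<close>

lemma spair_halves:
  assumes B: "basis_ok B" and i: "i \<in> {1..bsize B}" and j: "j \<in> {1..bsize B}" and reg: "preg B i j"
  shows "\<exists>k\<in>{1..bsize B}. \<exists>x. shift (sexp B k) x = psig B i j \<and> x + lexp B k = plcm B i j"
    and "reg_reducible B (plcm B i j) (psig B i j)"
proof -
  have *: "(\<exists>k\<in>{1..bsize B}. \<exists>x. shift (sexp B k) x = psig B i j \<and> x + lexp B k = plcm B i j) \<and>
      reg_reducible B (plcm B i j) (psig B i j)"
    if lt: "M.lt (shift (sexp B j) (cofactor B j i)) (shift (sexp B i) (cofactor B i j))"
      and i: "i \<in> {1..bsize B}" and j: "j \<in> {1..bsize B}" for i j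
  proof
    have s: "psig B i j = shift (sexp B i) (cofactor B i j)"
      unfolding psig_def using lt basis_ok_gen(5)[OF B] i j by (intro greater_eq_left) auto
    then show "\<exists>k\<in>{1..bsize B}. \<exists>x. shift (sexp B k) x = psig B i j \<and> x + lexp B k = plcm B i j"
      using i by (metis plcm_def add.commute)
    have "cofactor B j i + lexp B j = plcm B i j"
      using plcm_commute[of B i j] unfolding plcm_def by (simp add: add.commute)
    with lt s j show "reg_reducible B (plcm B i j) (psig B i j)"
      unfolding reg_reducible_def by metis
  qed
  consider "M.lt (shift (sexp B j) (cofactor B j i)) (shift (sexp B i) (cofactor B i j))"
    | "M.lt (shift (sexp B i) (cofactor B i j)) (shift (sexp B j) (cofactor B j i))"
    using reg basis_ok_gen(5)[OF B i] basis_ok_gen(5)[OF B j] unfolding preg_def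
    by (metis M.cases_order shift_in_mdom)
  then have "(\<exists>k\<in>{1..bsize B}. \<exists>x. shift (sexp B k) x = psig B i j \<and> x + lexp B k = plcm B i j) \<and>
      reg_reducible B (plcm B i j) (psig B i j)"
  proof cases
    case 1
    then show ?thesis by (rule *[OF _ i j])
  next
    case 2
    then show ?thesis using *[OF _ j i] psig_commute[OF B i j] plcm_commute[of B i j] by simp
  qed
  then show "\<exists>k\<in>{1..bsize B}. \<exists>x. shift (sexp B k) x = psig B i j \<and> x + lexp B k = plcm B i j"
    "reg_reducible B (plcm B i j) (psig B i j)" by auto
qed

text \<open>If the S-pair coming from the reducer were resolved by a smaller multiple, then this
  multiple times \<open>h\<close> would undercut the least one of signature \<open>S\<close>. Only a
  known syzygy remains.\<close>

lemma known_syzygy_divides: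
  assumes B: "basis_ok B" and pr: "processed B P Y" and np: "none_pending B P S"
    and least: "least_rep B S i x" and red: "reg_reducible B (x + lexp B i) S"
  shows "\<exists>p\<in>Y. \<exists>h. S = shift p h"
proof -
  have i: "i \<in> {1..bsize B}" "shift (sexp B i) x = S" using least unfolding least_rep_def by auto
  obtain j h where j: "j \<in> {1..bsize B}" "preg B i j" and h: "shift (psig B i j) h = S"
    "plcm B i j + h = x + lexp B i"
    by (rule spair_of_reg_reducible[OF B i red])
  have le: "lem (psig B i j) S" using lem_shift_self[OF psig_in[OF B i(1) j(1)], of h] h by simp
  have "resolved B Y i j"
  proof (cases "i < j")
    case True
    moreover have "(i, j) \<notin> P" using le np unfolding none_pending_def by auto
    ultimately show ?thesis using pr i(1) j unfolding processed_def by blast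
  next
    case False
    \<comment> \<open>Pairs are recorded with the smaller index in front, so the mirrored pair is
      the one to look up.\<close>
    then have "j < i" using preg_neq[OF j(2)] by simp
    moreover have "(j, i) \<notin> P"
      using le np psig_commute[OF B i(1) j(1)] unfolding none_pending_def by auto
    ultimately have "resolved B Y j i"
      using pr i(1) j preg_commute unfolding processed_def by blast
    then show ?thesis
      using psig_commute[OF B i(1) j(1)] plcm_commute[of B i j] unfolding resolved_def by simp
  qed
  then show ?thesis
    unfolding resolved_def
  proof (elim disjE bexE exE conjE)
    fix p h' assume "p \<in> Y" "shift p h' = psig B i j"
    then have "S = shift p (h' + h)" using h(1) by (metis shift_shift)
    with \<open>p \<in> Y\<close> show ?thesis by blast
  next
    fix k t assume k: "k \<in> {1..bsize B}" "shift (sexp B k) t = psig B i j"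
      "R.lt (t + lexp B k) (plcm B i j)"
    then have "shift (sexp B k) (t + h) = S" using h(1) by (metis shift_shift)
    then have le: "ler (x + lexp B i) ((t + h) + lexp B k)"
      using least k(1) unfolding least_rep_def by blast
    have "R.lt ((t + h) + lexp B k) (x + lexp B i)"
      using ltr_add[OF k(3), of h] h(2) by (simp add: ac_simps)
    with le have False using R.not_le[of "x + lexp B i" "(t + h) + lexp B k"] by simp
    then show ?thesis ..
  qed
qed

section \<open>The signature Groebner property below the pending S-pairs\<close>

lemma none_pending_mono:
  assumes "basis_ok B" "processed B P Y" "none_pending B P S" "lem S' S" "S \<in> mdom m" "S' \<in> mdom m"
  shows "none_pending B P S'"
  unfolding none_pending_def
proof (intro ballI, clarify)
  fix i j assume ij: "(i, j) \<in> P" and le: "lem (psig B i j) S'"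
  have "psig B i j \<in> mdom m" using ij assms(1,2) unfolding processed_def by (auto intro!: psig_in)
  then have "lem (psig B i j) S" using M.trans[OF _ _ _ le assms(4)] assms(5,6) by blast
  with assms(3) ij show False unfolding none_pending_def by blast
qed

lemma gb_at_if_none_pending:
  assumes B: "basis_ok B" and pr: "processed B P Y" and "S \<in> mdom m" "none_pending B P S"
  shows "gb_at B S"
  using assms(3,4)
proof (induction rule: M.induct_lt)
  case (less S)
  have gb: "gb_at B S'" if "S' \<in> mdom m" "M.lt S' S" for S'
    using less that none_pending_mono[OF B pr _ M.lt_imp_le] by blast
  show ?case
    unfolding gb_at_def
  proof (intro allI impI)
    fix u assume u: "u \<in> free_module m" "u \<noteq> 0" "spp u = S" "poly_image g u \<noteq> 0"
    let ?goal = "\<exists>j\<in>{1..bsize B}. \<exists>y. y + lexp B j = lpp (poly_image g u) \<and> lem (shift (sexp B j) y) S"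
    have goalI: ?goal if "reg_reducible B (lpp (poly_image g u)) S"
      using that M.lt_imp_le unfolding reg_reducible_def by blast
    obtain i x where least: "least_rep B S i x" using ex_least_rep[OF B less(1)] by blast
    then have i: "i \<in> {1..bsize B}" "shift (sexp B i) x = S" unfolding least_rep_def by auto
    show ?goal
    proof (cases "reg_reducible B (x + lexp B i) S")
      case True
      then obtain p h where "p \<in> Y" "S = shift p h"
        using known_syzygy_divides[OF B pr less(3) least] by blast
      then obtain v where "v \<in> free_module m" "v \<noteq> 0" "poly_image g v = 0" "spp v = S"
        using ex_syzygy_shift[of p h] pr unfolding processed_def by blast
      then show ?goal using reg_reducible_if_not_least[OF B gb u] goalI by blast
    next
      case False
      obtain v where v: "v \<in> free_module m" "v \<noteq> 0" "spp v = S" "poly_image g v \<noteq> 0"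
        "lpp (poly_image g v) = x + lexp B i"
        using ex_multiple[OF B i(1), of x] i(2) by metis
      \<comment> \<open>With equal lead exponents the multiple itself reduces \<open>u\<close>
        singularly, which \<open>gb_at\<close> admits. In the last case \<open>u\<close> and
        \<open>v\<close> exchange roles and the least multiple would be regular reducible.\<close>
      consider "R.lt (lpp (poly_image g v)) (lpp (poly_image g u))"
        | "lpp (poly_image g v) = lpp (poly_image g u)"
        | "R.lt (lpp (poly_image g u)) (lpp (poly_image g v))"
        using R.cases_order[OF UNIV_I UNIV_I] by blast
      then show ?goal
      proof cases
        case 1
        then show ?thesis using reg_reducible_if_not_least[OF B gb u v(1-3)] goalI by blast
      next
        case 2
        then show ?thesis using i v(5) M.refl[OF less(1)] by metis
      next
        case 3
        then have "reg_reducible B (x + lexp B i) S"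
          using reg_reducible_if_not_least[OF B gb v(1-4) u(1-3)] v(5) by simp
        with False show ?thesis by blast
      qed
    qed
  qed
qed

text \<open>A syzygy of signature \<open>S\<close> has image 0 and thus undercuts every multiple of
  that signature.\<close>

lemma reg_reducible_least_rep_of_syzygy:
  assumes B: "basis_ok B" and gb: "\<And>S'. S' \<in> mdom m \<Longrightarrow> M.lt S' S \<Longrightarrow> gb_at B S'"
    and S: "S \<in> syz_exps" and least: "least_rep B S i x"
  shows "reg_reducible B (x + lexp B i) S"
proof -
  have i: "i \<in> {1..bsize B}" "shift (sexp B i) x = S" using least unfolding least_rep_def by auto
  obtain v where v: "v \<in> free_module m" "v \<noteq> 0" "spp v = S" "poly_image g v \<noteq> 0"
    "lpp (poly_image g v) = x + lexp B i"
    using ex_multiple[OF B i(1), of x] i(2) by metis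
  obtain u where u: "u \<in> free_module m" "u \<noteq> 0" "poly_image g u = 0" "spp u = S"
    using S unfolding syz_exps_def by blast
  show ?thesis using reg_reducible_if_not_least[OF B gb v(1-4) u(1,2,4)] u(3) v(5) by simp
qed

text \<open>Serves twice: below the signature being treated, to prove minimality of a new syzygy
  signature, and at the end, when nothing is pending.\<close>

lemma syz_exp_known:
  assumes B: "basis_ok B" and pr: "processed B P Y" and S: "S \<in> syz_exps" and np: "none_pending B P S"
  shows "\<exists>p\<in>Y. \<exists>h. S = shift p h"
proof -
  obtain i x where least: "least_rep B S i x" using ex_least_rep[OF B syz_exps_in[OF S]] by blast
  have gb: "gb_at B S'" if "S' \<in> mdom m" "M.lt S' S" for S'
    using gb_at_if_none_pending[OF B pr that(1)]
      none_pending_mono[OF B pr np M.lt_imp_le[OF that(2)] syz_exps_in[OF S] that(1)] .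
  show ?thesis
    by (rule known_syzygy_divides[OF B pr np least reg_reducible_least_rep_of_syzygy[OF B gb S least]])
qed

section \<open>Minimal generators of the initial syzygy module\<close>

definition min_syz_exp :: "nat \<times> ('v \<Rightarrow>\<^sub>0 nat) \<Rightarrow> bool" where
  "min_syz_exp p \<longleftrightarrow> p \<in> syz_exps \<and> (\<forall>q\<in>syz_exps. \<forall>h. p = shift q h \<longrightarrow> q = p)"

text \<open>The vectors all of whose exponents are multiples of exponents occurring in
  \<open>X\<close> form a submodule containing \<open>X\<close>.\<close>

lemma vcoef_span:
  fixes X :: "('v, 'k) fvec set"
  assumes "w \<in> module.span vscale X" "vcoef w p \<noteq> 0"
  obtains t q h where "t \<in> X" "vcoef t q \<noteq> 0" "p = shift q h"
proof -
  let ?W = "{w :: ('v, 'k) fvec. \<forall>p. vcoef w p \<noteq> 0 \<longrightarrow> (\<exists>t\<in>X. \<exists>q h. vcoef t q \<noteq> 0 \<and> p = shift q h)}"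
  have "module.span vscale X \<subseteq> ?W"
  proof (rule module.span_minimal[OF module_vscale])
    show "X \<subseteq> ?W" by (force intro: exI[of _ 0])
    show "module.subspace vscale ?W"
    proof (rule module.subspaceI[OF module_vscale])
      show "0 \<in> ?W" by simp
      show "u + v \<in> ?W" if "u \<in> ?W" "v \<in> ?W" for u v
      proof (clarify)
        fix a b assume "vcoef (u + v) (a, b) \<noteq> 0"
        then have "vcoef u (a, b) \<noteq> 0 \<or> vcoef v (a, b) \<noteq> 0" by (auto simp: vcoef_add)
        with that show "\<exists>t\<in>X. \<exists>q h. vcoef t q \<noteq> 0 \<and> (a, b) = shift q h" by blast
      qed
      show "vscale f u \<in> ?W" if u: "u \<in> ?W" for f u
      proof (clarify)
        fix a b assume "vcoef (vscale f u) (a, b) \<noteq> 0"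
        then have "b \<in> Poly_Mapping.keys (f * Poly_Mapping.lookup u a)"
          by (simp add: vcoef_def lookup_vscale in_keys_iff)
        then obtain y z where "b = y + z" "z \<in> Poly_Mapping.keys (Poly_Mapping.lookup u a)"
          using keys_mult[of f "Poly_Mapping.lookup u a"] by blast
        then have "vcoef u (a, z) \<noteq> 0" and ab: "(a, b) = shift (a, z) y"
          by (simp_all add: vcoef_def in_keys_iff shift_def add.commute)
        then obtain t q h where "t \<in> X" "vcoef t q \<noteq> 0" "(a, z) = shift q h" using u by blast
        with ab show "\<exists>t\<in>X. \<exists>q h. vcoef t q \<noteq> 0 \<and> (a, b) = shift q h" by (metis shift_shift)
      qed
    qed
  qed
  with assms that show ?thesis by blast
qed

lemma mterm_in_span:
  fixes X :: "('v, 'k) fvec set"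
  assumes "mterm q d \<in> X" "d \<noteq> 0" shows "mterm (shift q h) c \<in> module.span vscale X"
proof -
  have "mterm (shift q h) c = vscale (Poly_Mapping.single h (c / d)) (mterm q d)"
    using assms(2) by (simp add: vscale_mterm)
  then show ?thesis
    using module.span_scale[OF module_vscale module.span_base[OF module_vscale assms(1)]] by simp
qed

lemma mterm_in_span_iff:
  fixes X :: "('v, 'k) fvec set"
  assumes X: "X \<subseteq> module_terms m" and c: "c \<noteq> 0"
  shows "mterm p c \<in> module.span vscale X \<longleftrightarrow> (\<exists>q d h. mterm q d \<in> X \<and> d \<noteq> 0 \<and> p = shift q h)"
proof
  assume "mterm p c \<in> module.span vscale X"
  then obtain t q h where t: "t \<in> X" "vcoef t q \<noteq> 0" "p = shift q h"
    by (rule vcoef_span[of _ _ p]) (use c in \<open>auto simp: vcoef_mterm\<close>)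
  obtain q' d where d: "t = mterm q' d" "d \<noteq> 0" using X t(1) module_terms_iff by blast
  with t(2) have "q = q'" by (simp add: vcoef_mterm split: if_splits)
  with t d show "\<exists>q d h. mterm q d \<in> X \<and> d \<noteq> 0 \<and> p = shift q h" by blast
qed (use mterm_in_span in blast)

lemma signature_in_initial:
  assumes "p \<in> syz_exps" shows "\<exists>c. c \<noteq> 0 \<and> mterm p c \<in> {signature leM u | u. u \<in> free_module m \<and> poly_image g u = 0}"
proof -
  obtain u where u: "u \<in> free_module m" "u \<noteq> 0" "poly_image g u = 0" "p = spp u"
    using assms unfolding syz_exps_def by blast
  then have "signature leM u = mterm p (vcoef u p)" "vcoef u p \<noteq> 0"
    using signature_eq vcoef_spp by auto
  with u show ?thesis by (metis (mono_tags, lifting) mem_Collect_eq)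
qed

text \<open>Passing from the generators to the span only multiplies exponents, and
  \<open>syz_exps\<close> is closed under \<open>shift\<close>.\<close>

lemma mterm_in_initial_iff:
  assumes "c \<noteq> 0"
  shows "mterm p c \<in> initial_syzygies leM m g \<longleftrightarrow> p \<in> syz_exps"
proof
  assume "mterm p c \<in> initial_syzygies leM m g"
  then obtain t q h where t: "t \<in> {signature leM u | u. u \<in> free_module m \<and> poly_image g u = 0}"
    "vcoef t q \<noteq> 0" "p = shift q h"
    unfolding initial_syzygies_def
    by (rule vcoef_span[of _ _ p]) (use assms in \<open>auto simp: vcoef_mterm\<close>)
  then obtain u where u: "u \<in> free_module m" "poly_image g u = 0" "t = signature leM u" by blast
  with t(2) have "u \<noteq> 0" by auto
  with u t(2) have "q = spp u" by (auto simp: signature_eq vcoef_mterm split: if_splits)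
  with u \<open>u \<noteq> 0\<close> have "q \<in> syz_exps" unfolding syz_exps_def by blast
  with t(3) syz_exps_shift show "p \<in> syz_exps" by blast
next
  assume "p \<in> syz_exps"
  then obtain d where "d \<noteq> 0" "mterm p d \<in> {signature leM u | u. u \<in> free_module m \<and> poly_image g u = 0}"
    using signature_in_initial by blast
  from mterm_in_span[OF this(2,1), of 0 c] show "mterm p c \<in> initial_syzygies leM m g"
    by (simp add: initial_syzygies_def)
qed

lemma initial_syzygies_subset_span:
  assumes "\<And>p c. p \<in> syz_exps \<Longrightarrow> c \<noteq> 0 \<Longrightarrow> mterm p c \<in> module.span vscale X"
  shows "initial_syzygies leM m g \<subseteq> module.span vscale X"
  unfolding initial_syzygies_def
proof (rule module.span_minimal[OF module_vscale _ module.subspace_span[OF module_vscale]], clarify)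
  fix u assume u: "u \<in> free_module m" "poly_image g u = 0"
  show "signature leM u \<in> module.span vscale X"
  proof (cases "u = 0")
    case True
    then show ?thesis using module.span_zero[OF module_vscale] by simp
  next
    case False
    with u have "spp u \<in> syz_exps" unfolding syz_exps_def by blast
    with assms show ?thesis unfolding signature_eq[OF u(1) False] using vcoef_spp[OF u(1) False] by blast
  qed
qed

text \<open>A proper divisor is strictly smaller in the module order, so descent along divisors
  stops at a minimal exponent.\<close>

lemma ex_min_syz_exp:
  assumes "p \<in> syz_exps"
  shows "\<exists>q h. min_syz_exp q \<and> p = shift q h"
  using syz_exps_in[OF assms] assms
proof (induction rule: M.induct_lt)
  case (less p)
  show ?case
  proof (cases "min_syz_exp p")
    case True
    then show ?thesis by (metis shift_0)
  next
    case False
    then obtain q h where q: "q \<in> syz_exps" "p = shift q h" "q \<noteq> p"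
      using less(3) unfolding min_syz_exp_def by blast
    then have "M.lt q p" using lem_shift_self[OF syz_exps_in] by (simp add: M.lt_def)
    then obtain r h' where "min_syz_exp r" "q = shift r h'"
      using less(2)[OF syz_exps_in[OF q(1)]] q(1) by blast
    with q(2) show ?thesis by (metis shift_shift)
  qed
qed

lemma min_syz_exp_dvd: "min_syz_exp p \<Longrightarrow> q \<in> syz_exps \<Longrightarrow> p = shift q h \<Longrightarrow> p = q"
  unfolding min_syz_exp_def by metis

lemma shift_antisym: "p = shift q h \<Longrightarrow> q = shift p h' \<Longrightarrow> q = p"
proof -
  assume *: "p = shift q h" "q = shift p h'"
  then have "shift q (h + h') = shift q 0" by (metis shift_0 shift_shift)
  then have "h + h' = 0" by (simp only: shift_inject)
  then have "Poly_Mapping.lookup h v + Poly_Mapping.lookup h' v = 0" for v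
    by (metis lookup_add lookup_zero)
  then have "h = 0" by (intro poly_mapping_eqI) simp
  with * show "q = p" by simp
qed

text \<open>A generator with a proper divisor in \<open>syz_exps\<close> could be dropped, because
  another generator divides that divisor. Conversely, choosing one term for each minimal exponent
  gives a minimal generating set.\<close>

lemma minimal_generator_iff:
  "minimal_generator m (initial_syzygies leM m g) T \<longleftrightarrow> (\<exists>p c. c \<noteq> 0 \<and> T = mterm p c \<and> min_syz_exp p)"
  (is "minimal_generator m ?H T \<longleftrightarrow> _")
proof
  assume "minimal_generator m ?H T"
  then obtain X where X: "X \<subseteq> module_terms m" "module.span vscale X = ?H"
    and min: "\<And>Y. Y \<subset> X \<Longrightarrow> module.span vscale Y \<noteq> ?H" and T: "T \<in> X"
    unfolding minimal_generator_def by blast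
  obtain p c where p: "c \<noteq> 0" "T = mterm p c" using X(1) T module_terms_iff by blast
  have span: "mterm r e \<in> module.span vscale X \<longleftrightarrow> r \<in> syz_exps" if "e \<noteq> 0" for r e
    using mterm_in_initial_iff[OF that] X(2) by simp
  have p_in: "p \<in> syz_exps"
    using span[OF p(1), of p] module.span_base[OF module_vscale T] p(2) by simp
  have "q = p" if q: "q \<in> syz_exps" "p = shift q h" for q h
  proof (rule ccontr)
    assume "q \<noteq> p"
    obtain r d h' where r: "mterm r d \<in> X" "d \<noteq> 0" "q = shift r h'"
      using span[of 1 q] q(1) mterm_in_span_iff[OF X(1), of 1 q] by auto
    \<comment> \<open>If \<open>r\<close> were \<open>p\<close>, then \<open>p\<close> and
      \<open>q\<close> would divide each other.\<close>
    have "r \<noteq> p" using shift_antisym[OF q(2), of h'] r(3) \<open>q \<noteq> p\<close> by metis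
    let ?Y = "X - {T}"
    have r': "mterm r d \<in> ?Y" using r p \<open>r \<noteq> p\<close> by (simp add: mterm_eq_iff)
    have "mterm s e \<in> module.span vscale ?Y" if s: "s \<in> syz_exps" "e \<noteq> 0" for s e
    proof -
      obtain r1 d1 h1 where r1: "mterm r1 d1 \<in> X" "d1 \<noteq> 0" "s = shift r1 h1"
        using span[OF s(2)] s(1) mterm_in_span_iff[OF X(1) s(2)] by blast
      show ?thesis
      proof (cases "mterm r1 d1 = T")
        case True
        then have "r1 = p" using p by (simp add: mterm_eq_iff r1(2))
        then have "s = shift r (h' + h + h1)" using r1(3) q(2) r(3) by simp
        then show ?thesis using mterm_in_span[OF r' r(2)] by simp
      next
        case False
        then show ?thesis using mterm_in_span[of r1 d1 ?Y] r1 by simp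
      qed
    qed
    then have "?H \<subseteq> module.span vscale ?Y" by (rule initial_syzygies_subset_span)
    moreover have "module.span vscale ?Y \<subseteq> ?H"
      unfolding X(2)[symmetric] by (rule module.span_mono[OF module_vscale]) blast
    ultimately show False using min[of ?Y] T by blast
  qed
  with p p_in show "\<exists>p c. c \<noteq> 0 \<and> T = mterm p c \<and> min_syz_exp p"
    unfolding min_syz_exp_def by blast
next
  assume "\<exists>p c. c \<noteq> 0 \<and> T = mterm p c \<and> min_syz_exp p"
  then obtain p c where p: "c \<noteq> 0" "T = mterm p c" "min_syz_exp p" by blast
  \<comment> \<open>One term per minimal exponent: at \<open>p\<close> it is \<open>T\<close> with
    its own coefficient, elsewhere the coefficient is 1.\<close>
  let ?X = "insert T {mterm q 1 | q. min_syz_exp q \<and> q \<noteq> p}"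
  have memX: "min_syz_exp q \<and> d \<noteq> 0" if "mterm q d \<in> ?X" "d \<noteq> 0" for q d
    using that p by (auto simp: mterm_eq_iff)
  have uniq: "d = e" if "mterm q d \<in> ?X" "mterm q e \<in> ?X" "d \<noteq> 0" "e \<noteq> 0" for q d e
    using that p by (auto simp: mterm_eq_iff)
  have inX: "\<exists>d. d \<noteq> 0 \<and> mterm q d \<in> ?X" if "min_syz_exp q" for q
  proof (cases "q = p")
    case True
    then show ?thesis using p by blast
  next
    case False
    then have "mterm q 1 \<in> ?X" using that by blast
    then show ?thesis using one_neq_zero by blast
  qed
  have in_syz: "q \<in> syz_exps" if "min_syz_exp q" for q using that unfolding min_syz_exp_def by blast
  have X: "?X \<subseteq> module_terms m"
    using p in_syz syz_exps_in by (auto simp: mterm_in_module_terms)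
  have "mterm s e \<in> module.span vscale ?X" if "s \<in> syz_exps" "e \<noteq> 0" for s e
    using ex_min_syz_exp[OF that(1)] inX mterm_in_span[of _ _ ?X _ e] by blast
  then have "?H \<subseteq> module.span vscale ?X" by (rule initial_syzygies_subset_span)
  moreover have "module.span vscale ?X \<subseteq> ?H"
  proof (rule module.span_minimal[OF module_vscale])
    show "?X \<subseteq> ?H"
      using p in_syz by (auto simp: mterm_in_initial_iff)
    show "module.subspace vscale ?H"
      unfolding initial_syzygies_def by (rule module.subspace_span[OF module_vscale])
  qed
  moreover have "module.span vscale Y \<noteq> ?H" if Y: "Y \<subset> ?X" for Y
  proof
    assume H: "module.span vscale Y = ?H"
    obtain t where t: "t \<in> ?X" "t \<notin> Y" using Y by blast
    obtain q d where q: "t = mterm q d" "d \<noteq> 0" using X t(1) module_terms_iff by blast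
    have qX: "mterm q d \<in> ?X" using t(1) unfolding q(1) .
    have mq: "min_syz_exp q" using memX[OF qX q(2)] by blast
    then have "mterm q d \<in> module.span vscale Y"
      using in_syz mterm_in_initial_iff[OF q(2)] H by simp
    then obtain r e h where r: "mterm r e \<in> Y" "e \<noteq> 0" "q = shift r h"
      using mterm_in_span_iff[of Y d q] Y X q(2) by blast
    have rX: "mterm r e \<in> ?X" using r(1) Y by blast
    then have "min_syz_exp r" using memX[OF rX r(2)] by blast
    \<comment> \<open>Minimality makes the divisor equal to \<open>q\<close>; as each exponent
      occurs once in the set, the omitted term \<open>t\<close> would lie in
      \<open>Y\<close>.\<close>
    then have "r = q" using min_syz_exp_dvd[OF mq in_syz r(3)] by simp
    then have "d = e" using uniq[OF qX _ q(2) r(2)] rX by simp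
    with r(1) \<open>r = q\<close> t(2) q show False by simp
  qed
  ultimately show "minimal_generator m ?H T"
    unfolding minimal_generator_def using X by (intro exI[of _ ?X]) blast
qed

section \<open>The invariant of the algorithm\<close>

definition entry_sig :: "('v, 'k) ext_basis \<Rightarrow> (nat \<times> nat) \<times> ('v, 'k) fvec \<Rightarrow> nat \<times> ('v \<Rightarrow>\<^sub>0 nat)" where
  "entry_sig B r = psig B (fst (fst r)) (snd (fst r))"

definition valid_pair :: "('v, 'k) ext_basis \<Rightarrow> nat \<times> nat \<Rightarrow> bool" where
  "valid_pair B q \<longleftrightarrow> 1 \<le> fst q \<and> fst q < snd q \<and> snd q \<le> bsize B \<and> preg B (fst q) (snd q)"

text \<open>No clause covers a singular top reducible result, as none ever occurs. Being no Koszul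
  signature refers to the current basis, so it must be re-established whenever the basis
  grows.\<close>

definition valid_entry :: "('v, 'k) ext_basis \<Rightarrow> (nat \<times> nat) \<times> ('v, 'k) fvec \<Rightarrow> bool" where
  "valid_entry B r \<longleftrightarrow> valid_pair B (fst r) \<and> snd r \<in> free_module (bsize B) \<and>
     phi B (snd r) \<noteq> 0 \<and> spp (phi B (snd r)) = entry_sig B r \<and>
     (if poly_image (bgen B) (snd r) = 0 then min_syz_exp (entry_sig B r) \<and> \<not> koszul_exp B (entry_sig B r)
      else \<exists>l. m < l \<and> l \<le> bsize B \<and> yields_element B r l)"

text \<open>Strict increase of the entry signatures makes the position of an entry unique, and their
  bound by the pending pairs maintains this increase. Distinct signatures of the added elements make
  the element belonging to an entry unique.\<close>

definition sb_inv ::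
  "('v, 'k) ext_basis \<Rightarrow> (nat \<times> nat) set \<Rightarrow> (nat \<times> ('v \<Rightarrow>\<^sub>0 nat)) set \<Rightarrow>
    ((nat \<times> nat) \<times> ('v, 'k) fvec) list \<Rightarrow> bool" where
  "sb_inv B P Y rs \<longleftrightarrow> basis_ok B \<and> (\<forall>q\<in>P. valid_pair B q) \<and> processed B P Y \<and>
     (\<forall>p\<in>Y. koszul_exp B p \<or> (\<exists>r\<in>set rs. entry_sig B r = p \<and> poly_image (bgen B) (snd r) = 0)) \<and>
     (\<forall>r\<in>set rs. valid_entry B r) \<and>
     sorted_wrt (\<lambda>r r'. M.lt (entry_sig B r) (entry_sig B r')) rs \<and>
     (\<forall>r\<in>set rs. \<forall>q\<in>P. M.lt (entry_sig B r) (psig B (fst q) (snd q))) \<and>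
     (\<forall>l. m < l \<and> l \<le> bsize B \<longrightarrow> (\<exists>r\<in>set rs. yields_element B r l)) \<and>
     (\<forall>l l'. m < l \<and> l < l' \<and> l' \<le> bsize B \<longrightarrow> sexp B l \<noteq> sexp B l')"

definition least_pending :: "('v, 'k) ext_basis \<Rightarrow> (nat \<times> nat) set \<Rightarrow> nat \<times> nat \<Rightarrow> bool" where
  "least_pending B P q \<longleftrightarrow> q \<in> P \<and> (\<forall>q'\<in>P. lem (psig B (fst q) (snd q)) (psig B (fst q') (snd q')))"

definition left_over ::
  "('v, 'k) ext_basis \<Rightarrow> (nat \<times> nat) set \<Rightarrow> nat \<times> ('v \<Rightarrow>\<^sub>0 nat) \<Rightarrow> (nat \<times> nat) set" where
  "left_over B P S = {q \<in> P. psig B (fst q) (snd q) \<noteq> S}"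

definition elim_exp :: "('v, 'k) ext_basis \<Rightarrow> (nat \<times> ('v \<Rightarrow>\<^sub>0 nat)) set \<Rightarrow> nat \<times> ('v \<Rightarrow>\<^sub>0 nat) \<Rightarrow> bool" where
  "elim_exp B Y S \<longleftrightarrow> (\<exists>p\<in>Y. \<exists>h. S = shift p h) \<or> koszul_exp B S \<or>
     (\<exists>i x. least_rep B S i x \<and> \<not> reg_reducible B (x + lexp B i) S)"

section \<open>Preservation of the invariant when pairs are eliminated or reduce to zero\<close>

lemma sb_invD:
  assumes "sb_inv B P Y rs"
  shows "basis_ok B" "\<And>q. q \<in> P \<Longrightarrow> valid_pair B q" "processed B P Y"
    "\<And>p. p \<in> Y \<Longrightarrow> koszul_exp B p \<or> (\<exists>r\<in>set rs. entry_sig B r = p \<and> poly_image (bgen B) (snd r) = 0)"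
    "\<And>r. r \<in> set rs \<Longrightarrow> valid_entry B r"
    "sorted_wrt (\<lambda>r r'. M.lt (entry_sig B r) (entry_sig B r')) rs"
    "\<And>r q. r \<in> set rs \<Longrightarrow> q \<in> P \<Longrightarrow> M.lt (entry_sig B r) (psig B (fst q) (snd q))"
    "\<And>l. m < l \<Longrightarrow> l \<le> bsize B \<Longrightarrow> \<exists>r\<in>set rs. yields_element B r l"
    "\<And>l l'. m < l \<Longrightarrow> l < l' \<Longrightarrow> l' \<le> bsize B \<Longrightarrow> sexp B l \<noteq> sexp B l'"
  using assms unfolding sb_inv_def by blast+

lemma valid_pairD:
  assumes "valid_pair B q"
  shows "fst q \<in> {1..bsize B}" "snd q \<in> {1..bsize B}" "fst q < snd q" "preg B (fst q) (snd q)"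
  using assms by (auto simp: valid_pair_def)

lemma valid_pair_psig_in: "basis_ok B \<Longrightarrow> valid_pair B q \<Longrightarrow> psig B (fst q) (snd q) \<in> mdom m"
  using psig_in valid_pairD by blast

lemma phi_basis: "phi B (Poly_Mapping.single i 1) = bphi B i"
  by (simp add: phi_single module.scale_one[OF module_vscale])

lemma yields_element_sexp:
  assumes "valid_entry B r" "yields_element B r l" shows "sexp B l = entry_sig B r"
  using assms unfolding valid_entry_def yields_element_def sexp_def by (simp add: phi_basis)

text \<open>As \<open>S\<close> is least among the pending signatures, nothing is pending strictly
  below it, and the basis already has the Groebner property there.\<close>

lemma least_pendingD:
  assumes inv: "sb_inv B P Y rs" and q: "least_pending B P q" and S: "S = psig B (fst q) (snd q)"
  shows "S \<in> mdom m" "\<And>q'. q' \<in> left_over B P S \<Longrightarrow> M.lt S (psig B (fst q') (snd q'))"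
    "\<And>S'. S' \<in> mdom m \<Longrightarrow> M.lt S' S \<Longrightarrow> none_pending B P S'"
    "\<And>S'. S' \<in> mdom m \<Longrightarrow> M.lt S' S \<Longrightarrow> gb_at B S'"
    "\<And>r. r \<in> set rs \<Longrightarrow> M.lt (entry_sig B r) S"
proof -
  note I = sb_invD[OF inv]
  have qP: "q \<in> P" "\<And>q'. q' \<in> P \<Longrightarrow> lem S (psig B (fst q') (snd q'))"
    using q S unfolding least_pending_def by blast+
  show Sm: "S \<in> mdom m" using valid_pair_psig_in[OF I(1) I(2)[OF qP(1)]] S by simp
  show "M.lt S (psig B (fst q') (snd q'))" if "q' \<in> left_over B P S" for q'
    using that qP(2)[of q'] unfolding left_over_def M.lt_def by auto
  show np: "none_pending B P S'" if "S' \<in> mdom m" "M.lt S' S" for S'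
    unfolding none_pending_def
  proof (clarify)
    fix i j assume ij: "(i, j) \<in> P" and "lem (psig B i j) S'"
    moreover have "psig B i j \<in> mdom m" using valid_pair_psig_in[OF I(1) I(2)[OF ij]] by simp
    ultimately have "M.lt (psig B i j) S" using M.le_lt_trans[OF _ that(1) Sm _ that(2)] by blast
    with qP(2)[OF ij] show False using M.not_le[OF Sm \<open>psig B i j \<in> mdom m\<close>] by simp
  qed
  show "gb_at B S'" if "S' \<in> mdom m" "M.lt S' S" for S'
    by (rule gb_at_if_none_pending[OF I(1,3) that(1) np[OF that]])
  show "M.lt (entry_sig B r) S" if "r \<in> set rs" for r
    using I(7)[OF that qP(1)] S by simp
qed

lemma processed_left_over:
  assumes pr: "processed B P Y" and Y: "Y \<subseteq> Y'" "Y' \<subseteq> syz_exps"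
    and res: "\<And>i j. i \<in> {1..bsize B} \<Longrightarrow> j \<in> {1..bsize B} \<Longrightarrow> preg B i j \<Longrightarrow> psig B i j = S \<Longrightarrow> resolved B Y' i j"
  shows "processed B (left_over B P S) Y'"
  unfolding processed_def
proof (intro conjI ballI impI)
  show "left_over B P S \<subseteq> {1..bsize B} \<times> {1..bsize B}"
    using pr unfolding processed_def left_over_def by blast
  show "Y' \<subseteq> syz_exps" by (rule Y(2))
  fix i j assume ij: "i \<in> {1..bsize B}" "j \<in> {1..bsize B}" "i < j" "preg B i j" "(i, j) \<notin> left_over B P S"
  show "resolved B Y' i j"
  proof (cases "psig B i j = S")
    case True
    then show ?thesis using res ij by blast
  next
    case False
    then have "(i, j) \<notin> P" using ij(5) unfolding left_over_def by simp
    then have "resolved B Y i j" using pr ij unfolding processed_def by blast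
    then show ?thesis using Y(1) unfolding resolved_def by blast
  qed
qed

lemma resolved_known: "S \<in> Y \<Longrightarrow> psig B i j = S \<Longrightarrow> resolved B Y i j"
  unfolding resolved_def by (metis shift_0)

lemma koszul_exp_syzygy:
  assumes B: "basis_ok B" and "koszul_exp B S" shows "S \<in> syz_exps"
proof -
  obtain i j where i: "i \<in> {1..bsize B}" and j: "j \<in> {1..bsize B}"
    and ne: "shift (sexp B i) (lexp B j) \<noteq> shift (sexp B j) (lexp B i)"
    and S: "S = M.greater (shift (sexp B i) (lexp B j)) (shift (sexp B j) (lexp B i))"
    using assms(2) unfolding koszul_exp_def by blast
  note K = koszul_facts[OF B i j]
  have "poly_image g (phi B (koszul B i j)) = 0" using poly_image_eq_phi[OF B K(2)] K(3) by simp
  then show ?thesis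
    using phi_in_free_module[OF B K(2)] K(4,5)[OF ne] S unfolding syz_exps_def by force
qed

lemma sb_inv_subset:
  assumes inv: "sb_inv B P Y rs" and P': "P' \<subseteq> P" and pr: "processed B P' Y'"
    and Y': "\<And>p. p \<in> Y' \<Longrightarrow> p \<in> Y \<or> koszul_exp B p"
  shows "sb_inv B P' Y' rs"
proof -
  note I = sb_invD[OF inv]
  show ?thesis unfolding sb_inv_def
  proof (intro conjI ballI)
    show "koszul_exp B p \<or> (\<exists>r\<in>set rs. entry_sig B r = p \<and> poly_image (bgen B) (snd r) = 0)"
      if "p \<in> Y'" for p using Y'[OF that] I(4) by blast
  qed (use I P' pr in blast)+
qed

text \<open>The first two criteria provide a known syzygy. Under the singular criterion the least
  multiple of signature \<open>S\<close> is itself the certificate for each discarded pair.\<close>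

lemma sb_inv_eliminate:
  assumes inv: "sb_inv B P Y rs" and q: "least_pending B P q" and S: "S = psig B (fst q) (snd q)"
    and elim: "elim_exp B Y S"
  shows "sb_inv B (left_over B P S) (if koszul_exp B S then insert S Y else Y) rs"
proof (rule sb_inv_subset[OF inv])
  note I = sb_invD[OF inv]
  let ?Y = "if koszul_exp B S then insert S Y else Y"
  show "left_over B P S \<subseteq> P" unfolding left_over_def by blast
  show "p \<in> Y \<or> koszul_exp B p" if "p \<in> ?Y" for p using that by (auto split: if_splits)
  show "processed B (left_over B P S) ?Y"
  proof (rule processed_left_over[OF I(3)])
    show "Y \<subseteq> ?Y" by auto
    show "?Y \<subseteq> syz_exps" using I(3) koszul_exp_syzygy[OF I(1)] unfolding processed_def by auto
    fix i j assume ij: "i \<in> {1..bsize B}" "j \<in> {1..bsize B}" "preg B i j" "psig B i j = S"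
    show "resolved B ?Y i j"
    proof (cases "koszul_exp B S")
      case True
      then show ?thesis using resolved_known[of S ?Y] ij(4) by simp
    next
      case False
      with elim consider p h where "p \<in> Y" "S = shift p h"
        | k t where "least_rep B S k t" "\<not> reg_reducible B (t + lexp B k) S"
        unfolding elim_exp_def by blast
      then show ?thesis
      proof cases
        case 1
        then show ?thesis using ij(4) False unfolding resolved_def by auto
      next
        case (2 k t)
        obtain k' x where k': "k' \<in> {1..bsize B}" "shift (sexp B k') x = S" "x + lexp B k' = plcm B i j"
          using spair_halves(1)[OF I(1) ij(1-3)] ij(4) by blast
        then have "ler (t + lexp B k) (plcm B i j)"
          using 2(1) unfolding least_rep_def by metis
        \<comment> \<open>At the lcm the other half of the pair is a regular reducer, whereas the
          least multiple has none.\<close>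
        moreover have "t + lexp B k \<noteq> plcm B i j"
          using 2(2) spair_halves(2)[OF I(1) ij(1-3)] ij(4) by metis
        ultimately have "R.lt (t + lexp B k) (plcm B i j)" by (simp add: R.lt_def)
        moreover have "k \<in> {1..bsize B}" "shift (sexp B k) t = S"
          using 2(1) unfolding least_rep_def by blast+
        ultimately show ?thesis unfolding resolved_def ij(4) by blast
      qed
    qed
  qed
qed

text \<open>A proper divisor of \<open>S\<close> among the syzygy exponents lies below
  \<open>S\<close>, where all of them are multiples of known ones; the signature criterion would
  then have eliminated the pair. Hence \<open>S\<close> is minimal.\<close>

lemma sb_inv_to_zero:
  assumes inv: "sb_inv B P Y rs" and q: "least_pending B P q" and S: "S = psig B (fst q) (snd q)"
    and nelim: "\<not> elim_exp B Y S"
    and p': "p' \<in> free_module (bsize B)" "phi B p' \<noteq> 0" "spp (phi B p') = S" "poly_image (bgen B) p' = 0"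
  shows "sb_inv B (left_over B P S) (insert S Y) (rs @ [(q, p')])"
proof -
  note I = sb_invD[OF inv] and L = least_pendingD[OF inv q S]
  let ?r = "(q, p')"
  have qP: "q \<in> P" using q unfolding least_pending_def by blast
  have entry: "entry_sig B ?r = S" by (simp add: entry_sig_def S)
  have "S \<in> syz_exps"
    using p' phi_in_free_module[OF I(1) p'(1)] poly_image_eq_phi[OF I(1) p'(1)] unfolding syz_exps_def by force
  have "p = S" if p: "p \<in> syz_exps" "S = shift p h" for p h
  proof (rule ccontr)
    assume "p \<noteq> S"
    then have "M.lt p S" using lem_shift_self[OF syz_exps_in[OF p(1)], of h] p(2) by (simp add: M.lt_def)
    then obtain p1 h1 where "p1 \<in> Y" "p = shift p1 h1"
      using syz_exp_known[OF I(1,3) p(1) L(3)] syz_exps_in[OF p(1)] by blast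
    then have "S = shift p1 (h1 + h)" using p(2) by simp
    with \<open>p1 \<in> Y\<close> nelim show False unfolding elim_exp_def by blast
  qed
  with \<open>S \<in> syz_exps\<close> have min: "min_syz_exp S" unfolding min_syz_exp_def by blast
  have nk: "\<not> koszul_exp B S" using nelim unfolding elim_exp_def by blast
  have valid: "valid_entry B ?r"
    unfolding valid_entry_def entry using I(2)[OF qP] p' min nk by simp
  have sub: "left_over B P S \<subseteq> P" unfolding left_over_def by blast
  have pr: "processed B (left_over B P S) (insert S Y)"
    by (rule processed_left_over[OF I(3)])
      (use I(3) \<open>S \<in> syz_exps\<close> resolved_known[of S "insert S Y"] in \<open>auto simp: processed_def\<close>)
  show ?thesis unfolding sb_inv_def
  proof (intro conjI ballI allI impI)
    show "koszul_exp B p \<or> (\<exists>r\<in>set (rs @ [?r]). entry_sig B r = p \<and> poly_image (bgen B) (snd r) = 0)"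
      if "p \<in> insert S Y" for p
    proof (cases "p = S")
      case True
      then show ?thesis using entry p'(4) by auto
    next
      case False
      then show ?thesis using I(4)[of p] that by auto
    qed
    show "sorted_wrt (\<lambda>r r'. M.lt (entry_sig B r) (entry_sig B r')) (rs @ [?r])"
      using I(6) L(5) entry by (simp add: sorted_wrt_append)
    show "M.lt (entry_sig B r) (psig B (fst q') (snd q'))"
      if "r \<in> set (rs @ [?r])" "q' \<in> left_over B P S" for r q'
    proof (cases "r = ?r")
      case True
      then show ?thesis using L(2)[OF that(2)] entry by simp
    next
      case False
      then show ?thesis using I(7)[of r q'] that sub by auto
    qed
    show "\<exists>r\<in>set (rs @ [?r]). yields_element B r l" if "m < l \<and> l \<le> bsize B" for l
      using I(8)[of l] that by auto
    show "sexp B l \<noteq> sexp B l'" if "m < l \<and> l < l' \<and> l' \<le> bsize B" for l l'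
      using I(9)[of l l'] that by blast
  qed (use I(1,2,5) sub pr valid in auto)
qed

text \<open>A singular reducer is a multiple of signature \<open>S\<close>, so the least such
  multiple has at most the same lead exponent. Equality is excluded: the failed singular criterion
  makes the least multiple regular reducible, but the result is not. A strictly smaller one would
  make the result regular reducible.\<close>

lemma not_singular_reducible:
  assumes inv: "sb_inv B P Y rs" and q: "least_pending B P q" and S: "S = psig B (fst q) (snd q)"
    and nelim: "\<not> elim_exp B Y S"
    and p': "p' \<in> free_module (bsize B)" "phi B p' \<noteq> 0" "spp (phi B p') = S" "poly_image (bgen B) p' \<noteq> 0"
    and nred: "\<not> reg_reducible B (lpp (poly_image (bgen B) p')) S"
  shows "\<not> sing_reducible B (lpp (poly_image (bgen B) p')) S"
proof
  note I = sb_invD[OF inv] and L = least_pendingD[OF inv q S]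
  let ?f = "poly_image (bgen B) p'"
  have im: "?f = poly_image g (phi B p')" by (rule poly_image_eq_phi[OF I(1) p'(1)])
  assume "sing_reducible B (lpp ?f) S"
  then obtain j y where "j \<in> {1..bsize B}" "y + lexp B j = lpp ?f" "shift (sexp B j) y = S"
    unfolding sing_reducible_def by blast
  then obtain k t where least: "least_rep B S k t" and le: "ler (t + lexp B k) (lpp ?f)"
    using ex_least_rep_below[of j B y S] by auto
  have k: "k \<in> {1..bsize B}" "shift (sexp B k) t = S" using least unfolding least_rep_def by auto
  have "t + lexp B k \<noteq> lpp ?f" using nelim nred least unfolding elim_exp_def by metis
  with le have lt: "R.lt (t + lexp B k) (lpp ?f)" by (simp add: R.lt_def)
  obtain v where v: "v \<in> free_module m" "v \<noteq> 0" "spp v = S" "poly_image g v \<noteq> 0"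
      "lpp (poly_image g v) = t + lexp B k"
    using ex_multiple[OF I(1) k(1), of t] k(2) by metis
  have "reg_reducible B (lpp (poly_image g (phi B p'))) S"
    by (rule reg_reducible_if_not_least[OF I(1) L(4) phi_in_free_module[OF I(1) p'(1)] p'(2,3) _ v(1-3)])
      (use p'(4) im lt v(5) in simp_all)
  with nred im show False by simp
qed

section \<open>Adding a basis element\<close>

lemma add_element_simps:
  assumes "i \<in> {1..bsize B}"
  shows "bgen (add_element B p) i = bgen B i" "bphi (add_element B p) i = bphi B i"
  using assms by (auto simp: add_element_def)

lemma bsize_add_element [simp]: "bsize (add_element B p) = Suc (bsize B)"
  by (simp add: add_element_def)

lemma add_element_exps:
  assumes i: "i \<in> {1..bsize B}"
  shows "lexp (add_element B p) i = lexp B i" "sexp (add_element B p) i = sexp B i"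
  using add_element_simps[OF i] by (simp_all add: lexp_def sexp_def)

lemma add_element_new:
  shows "lexp (add_element B p) (Suc (bsize B)) = lpp (poly_image (bgen B) p)"
    "sexp (add_element B p) (Suc (bsize B)) = spp (phi B p)"
  by (simp_all add: add_element_def lexp_def sexp_def)

lemma add_element_pair:
  assumes i: "i \<in> {1..bsize B}" and j: "j \<in> {1..bsize B}"
  shows "psig (add_element B p) i j = psig B i j" "plcm (add_element B p) i j = plcm B i j"
    "preg (add_element B p) i j \<longleftrightarrow> preg B i j"
  by (simp_all add: psig_def plcm_def preg_def cofactor_def add_element_exps[OF i] add_element_exps[OF j])

lemma add_element_image:
  assumes "u \<in> free_module (bsize B)"
  shows "poly_image (bgen (add_element B p)) u = poly_image (bgen B) u"
    "phi (add_element B p) u = phi B u"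
  using poly_image_cong[OF assms] phi_cong[OF assms] add_element_simps by metis+

lemma basis_ok_add_element:
  assumes B: "basis_ok B" and p: "p \<in> free_module (bsize B)" "poly_image (bgen B) p \<noteq> 0"
  shows "basis_ok (add_element B p)"
  unfolding basis_ok_def
proof (intro conjI ballI)
  show "m \<le> bsize (add_element B p)" using B by (simp add: basis_ok_def)
  show "bphi (add_element B p) i = Poly_Mapping.single i 1" if "i \<in> {1..m}" for i
    using that B add_element_simps(2)[of i B p] by (auto simp: basis_ok_def)
  fix i assume i: "i \<in> {1..bsize (add_element B p)}"
  show "bphi (add_element B p) i \<in> free_module m" "bgen (add_element B p) i \<noteq> 0"
    "poly_image g (bphi (add_element B p) i) = bgen (add_element B p) i"
  proof (atomize(full), cases "i = Suc (bsize B)")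
    case True
    then show "bphi (add_element B p) i \<in> free_module m \<and> bgen (add_element B p) i \<noteq> 0 \<and>
        poly_image g (bphi (add_element B p) i) = bgen (add_element B p) i"
      using p phi_in_free_module[OF B p(1)] poly_image_eq_phi[OF B p(1)] by (simp add: add_element_def)
  next
    case False
    then have i': "i \<in> {1..bsize B}" using i by auto
    then show "bphi (add_element B p) i \<in> free_module m \<and> bgen (add_element B p) i \<noteq> 0 \<and>
        poly_image g (bphi (add_element B p) i) = bgen (add_element B p) i"
      using basis_ok_gen[OF B i'] by (simp add: add_element_simps[OF i'])
  qed
qed

lemma valid_pair_add_element: "valid_pair B q \<Longrightarrow> valid_pair (add_element B p) q"
  using valid_pairD[of B q] add_element_pair(3)[of "fst q" B "snd q" p] unfolding valid_pair_def by auto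

lemma entry_sig_add_element: "valid_pair B (fst r) \<Longrightarrow> entry_sig (add_element B p) r = entry_sig B r"
  using valid_pairD[of B "fst r"] add_element_pair(1) unfolding entry_sig_def by blast

lemma koszul_exp_mono:
  assumes "koszul_exp B T" shows "koszul_exp (add_element B p) T"
proof -
  obtain i j where i: "i \<in> {1..bsize B}" and j: "j \<in> {1..bsize B}"
    and *: "shift (sexp B i) (lexp B j) \<noteq> shift (sexp B j) (lexp B i)"
      "T = M.greater (shift (sexp B i) (lexp B j)) (shift (sexp B j) (lexp B i))"
    using assms unfolding koszul_exp_def by blast
  show ?thesis
    unfolding koszul_exp_def
    by (rule bexI[of _ i], rule bexI[of _ j])
      (use i j * in \<open>simp_all add: add_element_exps[OF i] add_element_exps[OF j]\<close>)
qed

text \<open>Both halves are multiples of the signatures of the elements involved, so a Koszul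
  signature involving the new element is at least the new signature and cannot be
  \<open>T\<close>.\<close>

lemma koszul_exp_add_element:
  assumes B': "basis_ok (add_element B p)"
    and T: "T \<in> mdom m" "M.lt T (spp (phi B p))"
  shows "koszul_exp (add_element B p) T \<longleftrightarrow> koszul_exp B T"
proof
  assume "koszul_exp B T"
  then show "koszul_exp (add_element B p) T" by (rule koszul_exp_mono)
next
  let ?B = "add_element B p"
  assume "koszul_exp ?B T"
  then obtain i j where ij: "i \<in> {1..bsize ?B}" "j \<in> {1..bsize ?B}"
    and *: "shift (sexp ?B i) (lexp ?B j) \<noteq> shift (sexp ?B j) (lexp ?B i)"
      "T = M.greater (shift (sexp ?B i) (lexp ?B j)) (shift (sexp ?B j) (lexp ?B i))"
    unfolding koszul_exp_def by blast
  note D = basis_ok_gen(5)[OF B' ij(1)] basis_ok_gen(5)[OF B' ij(2)]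
  have le: "lem (sexp ?B i) T" "lem (sexp ?B j) T"
  proof -
    have g: "lem (shift (sexp ?B i) (lexp ?B j)) T" "lem (shift (sexp ?B j) (lexp ?B i)) T"
      unfolding *(2) using D by (simp_all add: le_greater)
    show "lem (sexp ?B i) T" using M.trans[OF _ _ _ lem_shift_self[OF D(1)] g(1)] D T(1) by simp
    show "lem (sexp ?B j) T" using M.trans[OF _ _ _ lem_shift_self[OF D(2)] g(2)] D T(1) by simp
  qed
  have "l \<noteq> Suc (bsize B)" if "lem (sexp ?B l) T" "l \<in> {1..bsize ?B}" for l
  proof
    assume "l = Suc (bsize B)"
    then have eq: "sexp ?B l = spp (phi B p)" by (simp add: add_element_new)
    show False using M.not_le[OF basis_ok_gen(5)[OF B' that(2)] T(1)] that(1) T(2) eq by simp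
  qed
  then have ij': "i \<in> {1..bsize B}" "j \<in> {1..bsize B}" using le ij by (auto simp: le_Suc_eq)
  show "koszul_exp B T"
    unfolding koszul_exp_def
    by (rule bexI[OF _ ij'(1)], rule bexI[OF _ ij'(2)])
      (use * in \<open>simp add: add_element_exps[OF ij'(1)] add_element_exps[OF ij'(2)]\<close>)
qed

lemma yields_element_add_element:
  assumes "valid_entry B r" "l \<in> {1..bsize B}"
  shows "yields_element (add_element B p) r l \<longleftrightarrow> yields_element B r l"
  using assms add_element_image[of "snd r" B p] add_element_simps[OF assms(2), of p]
  unfolding yields_element_def valid_entry_def by (simp add: phi_basis)

lemma valid_entry_add_element:
  assumes B: "basis_ok B" and B': "basis_ok (add_element B p)" and r: "valid_entry B r"
    and lt: "M.lt (entry_sig B r) (spp (phi B p))"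
  shows "valid_entry (add_element B p) r"
proof -
  have r': "valid_pair B (fst r)" "snd r \<in> free_module (bsize B)" "phi B (snd r) \<noteq> 0"
    "spp (phi B (snd r)) = entry_sig B r"
    using r unfolding valid_entry_def by blast+
  have dom: "entry_sig B r \<in> mdom m"
    unfolding entry_sig_def by (rule valid_pair_psig_in[OF B r'(1)])
  have y: "\<exists>l. m < l \<and> l \<le> Suc (bsize B) \<and> yields_element (add_element B p) r l"
    if "m < l" "l \<le> bsize B" "yields_element B r l" for l
    using that yields_element_add_element[OF r, of l p] by (intro exI[of _ l]) simp
  show ?thesis
    using r y valid_pair_add_element[OF r'(1)] free_module_mono[of _ "Suc (bsize B)", OF _ r'(2)]
    unfolding valid_entry_def entry_sig_add_element[OF r'(1)] add_element_image[OF r'(2)]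
      koszul_exp_add_element[OF B' dom lt] bsize_add_element
    by (auto split: if_splits)
qed

text \<open>The signature is at least that of the half with the new element. Equality forces the
  multiplier of the new element to be trivial, so the lead term of \<open>g_i\<close> divides the
  new lead term and the smaller half would be a regular reducer. Hence new pairs never fall back to
  a signature already treated.\<close>

lemma new_spair_larger:
  assumes B: "basis_ok B" and B': "basis_ok (add_element B p)"
    and nred: "\<not> reg_reducible B (lpp (poly_image (bgen B) p)) (spp (phi B p))"
    and i: "i \<in> {1..bsize B}" and reg: "preg (add_element B p) i (Suc (bsize B))"
  shows "M.lt (spp (phi B p)) (psig (add_element B p) i (Suc (bsize B)))"
proof -
  let ?B = "add_element B p" and ?n = "Suc (bsize B)" and ?S = "spp (phi B p)"
  have n: "?n \<in> {1..bsize ?B}" and i': "i \<in> {1..bsize ?B}" using i by auto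
  have S: "sexp ?B ?n = ?S" by (simp add: add_element_new)
  note D = basis_ok_gen(5)[OF B' i'] basis_ok_gen(5)[OF B' n]
  let ?a = "shift (sexp ?B i) (cofactor ?B i ?n)" and ?b = "shift (sexp ?B ?n) (cofactor ?B ?n i)"
  have ab: "?a \<in> mdom m" "?b \<in> mdom m" "psig ?B i ?n = M.greater ?a ?b"
    using D by (simp_all add: psig_def)
  have Sb: "lem ?S ?b" using lem_shift_self[OF D(2)] S by simp
  have le: "lem ?S (psig ?B i ?n)"
    using M.trans[OF _ _ _ Sb le_greater(2)[OF ab(1,2)]] D ab(3) S greater_in[OF ab(1,2)] by simp
  moreover have "?S \<noteq> psig ?B i ?n"
  proof
    assume eq: "?S = psig ?B i ?n"
    then have "lem ?b ?S" using le_greater(2)[OF ab(1,2)] ab(3) by simp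
    then have b: "?b = ?S" using Sb M.antisym[of ?b ?S] ab(2) D(2) S by simp
    then have "shift (sexp ?B ?n) (cofactor ?B ?n i) = shift (sexp ?B ?n) 0" using S by simp
    then have cof: "cofactor ?B ?n i = 0" by (simp only: shift_inject)
    have "lem ?a ?S" using le_greater(1)[OF ab(1,2)] ab(3) eq by simp
    moreover have "?a \<noteq> ?S" using reg b unfolding preg_def by metis
    ultimately have lt: "M.lt (shift (sexp B i) (cofactor ?B i ?n)) ?S"
      using add_element_exps(2)[OF i] by (simp add: M.lt_def)
    have "cofactor ?B i ?n + lexp B i = lpp (poly_image (bgen B) p)"
      using plcm_commute[of ?B i ?n] cof add_element_exps(1)[OF i, of p] add_element_new(1)[of B p]
      by (simp add: plcm_def add.commute)
    with lt i nred show False unfolding reg_reducible_def by blast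
  qed
  ultimately show ?thesis by (simp add: M.lt_def)
qed

lemma resolved_add_element:
  assumes "resolved B Y i j" "i \<in> {1..bsize B}" "j \<in> {1..bsize B}"
  shows "resolved (add_element B p) Y i j"
proof -
  have pair: "psig (add_element B p) i j = psig B i j" "plcm (add_element B p) i j = plcm B i j"
    using add_element_pair assms(2,3) by blast+
  from assms(1) consider "\<exists>q\<in>Y. \<exists>h. shift q h = psig B i j"
    | k t where "k \<in> {1..bsize B}" "shift (sexp B k) t = psig B i j" "R.lt (t + lexp B k) (plcm B i j)"
    unfolding resolved_def by blast
  then show ?thesis
  proof cases
    case 2
    then have "\<exists>k\<in>{1..bsize (add_element B p)}. \<exists>t. shift (sexp (add_element B p) k) t = psig B i j \<and>
        R.lt (t + lexp (add_element B p) k) (plcm B i j)"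
      by (intro bexI[of _ k] exI[of _ t]) (simp_all add: add_element_exps)
    then show ?thesis unfolding resolved_def pair by blast
  qed (simp add: resolved_def pair)
qed

text \<open>The new element certifies all pairs of signature \<open>S\<close>. Its lead exponent is
  not the lcm, since the smaller half of the pair would reduce it regularly, and not larger, since
  comparison with the larger half would again give a regular reducer.\<close>

lemma processed_new_element:
  assumes inv: "sb_inv B P Y rs" and q: "least_pending B P q" and S: "S = psig B (fst q) (snd q)"
    and p': "p' \<in> free_module (bsize B)" "phi B p' \<noteq> 0" "spp (phi B p') = S" "poly_image (bgen B) p' \<noteq> 0"
    and nred: "\<not> reg_reducible B (lpp (poly_image (bgen B) p')) S"
    and B': "B' = add_element B p'"
    and N: "N = {(i, bsize B') | i. 1 \<le> i \<and> i < bsize B' \<and> preg B' i (bsize B')}"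
  shows "processed B' (left_over B P S \<union> N) Y"
  unfolding processed_def
proof (intro conjI ballI impI)
  note I = sb_invD[OF inv] and L = least_pendingD[OF inv q S]
  have P: "P \<subseteq> {1..bsize B} \<times> {1..bsize B}" "Y \<subseteq> syz_exps" using I(3) unfolding processed_def by auto
  show "left_over B P S \<union> N \<subseteq> {1..bsize B'} \<times> {1..bsize B'}"
    using P(1) unfolding left_over_def N B' by auto
  show "Y \<subseteq> syz_exps" by (rule P(2))
  fix i j assume ij: "i \<in> {1..bsize B'}" "j \<in> {1..bsize B'}" "i < j" "preg B' i j" "(i, j) \<notin> left_over B P S \<union> N"
  have "j \<noteq> bsize B'"
  proof
    assume "j = bsize B'"
    with ij have "(i, j) \<in> N" unfolding N by auto
    with ij(5) show False by simp
  qed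
  with ij have i: "i \<in> {1..bsize B}" and j: "j \<in> {1..bsize B}" by (auto simp: B')
  note pair = add_element_pair[OF i j, of p', folded B']
  have reg: "preg B i j" using ij(4) pair by simp
  show "resolved B' Y i j"
  proof (cases "psig B i j = S")
    case False
    then have "(i, j) \<notin> P" using ij(5) unfolding left_over_def by simp
    then have "resolved B Y i j" using I(3) i j ij(3) reg unfolding processed_def by blast
    then show ?thesis unfolding B' by (rule resolved_add_element[OF _ i j])
  next
    case True
    let ?f = "poly_image (bgen B) p'"
    have im: "?f = poly_image g (phi B p')" by (rule poly_image_eq_phi[OF I(1) p'(1)])
    obtain k x where k: "k \<in> {1..bsize B}" "shift (sexp B k) x = S" "x + lexp B k = plcm B i j"
      using spair_halves(1)[OF I(1) i j reg] True by blast
    obtain v where v: "v \<in> free_module m" "v \<noteq> 0" "spp v = S" "poly_image g v \<noteq> 0"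
        "lpp (poly_image g v) = plcm B i j"
      using ex_multiple[OF I(1) k(1), of x] k(2,3) by metis
    have "\<not> R.lt (plcm B i j) (lpp ?f)"
    proof
      assume "R.lt (plcm B i j) (lpp ?f)"
      then have "reg_reducible B (lpp (poly_image g (phi B p'))) S"
        by (intro reg_reducible_if_not_least[OF I(1) L(4) phi_in_free_module[OF I(1) p'(1)] p'(2,3) _ v(1-3)])
          (use p'(4) im v(5) in simp_all)
      with nred im show False by simp
    qed
    moreover have "lpp ?f \<noteq> plcm B i j" using nred spair_halves(2)[OF I(1) i j reg] True by metis
    ultimately have lt: "R.lt (lpp ?f) (plcm B i j)"
      using R.cases_order[OF UNIV_I UNIV_I] by metis
    \<comment> \<open>The witness is the new element with trivial multiplier
      \<open>0\<close>.\<close>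
    have "bsize B' \<in> {1..bsize B'}" "shift (sexp B' (bsize B')) 0 = psig B' i j"
      "R.lt (0 + lexp B' (bsize B')) (plcm B' i j)"
      using lt pair True p'(3) by (simp_all add: B' add_element_new)
    then show ?thesis unfolding resolved_def by blast
  qed
qed

lemma sb_inv_new_element:
  assumes inv: "sb_inv B P Y rs" and q: "least_pending B P q" and S: "S = psig B (fst q) (snd q)"
    and p': "p' \<in> free_module (bsize B)" "phi B p' \<noteq> 0" "spp (phi B p') = S" "poly_image (bgen B) p' \<noteq> 0"
    and nred: "\<not> reg_reducible B (lpp (poly_image (bgen B) p')) S"
    and B': "B' = add_element B p'"
    and N: "N = {(i, bsize B') | i. 1 \<le> i \<and> i < bsize B' \<and> preg B' i (bsize B')}"
  shows "sb_inv B' (left_over B P S \<union> N) Y (rs @ [(q, p')])"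
proof -
  note I = sb_invD[OF inv] and L = least_pendingD[OF inv q S]
  let ?r = "(q, p')" and ?n = "Suc (bsize B)"
  have n: "bsize B' = ?n" by (simp add: B')
  have qP: "q \<in> P" using q unfolding least_pending_def by blast
  have ok: "basis_ok B'" unfolding B' by (rule basis_ok_add_element[OF I(1) p'(1,4)])
  have vp: "valid_pair B (fst r)" if "r \<in> set rs" for r using I(5)[OF that] unfolding valid_entry_def by blast
  have entry: "entry_sig B' r = entry_sig B r" if "r \<in> set rs" for r
    unfolding B' by (rule entry_sig_add_element[OF vp[OF that]])
  have entry_new: "entry_sig B' ?r = S"
    using entry_sig_add_element[of B ?r p'] I(2)[OF qP] S by (simp add: B' entry_sig_def)
  have im: "poly_image (bgen B') (snd r) = poly_image (bgen B) (snd r)" if "r \<in> set rs" for r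
    using add_element_image[of "snd r" B p'] I(5)[OF that] unfolding B' valid_entry_def by blast
  have new: "yields_element B' ?r ?n"
    using add_element_image[OF p'(1), of p'] unfolding yields_element_def phi_basis B'
    by (simp add: add_element_def)
  have "m \<le> bsize B" using I(1) by (simp add: basis_ok_def)
  have "\<exists>l. m < l \<and> l \<le> ?n \<and> yields_element B' ?r l"
    using new \<open>m \<le> bsize B\<close> by (intro exI[of _ ?n]) simp
  then have valid_new: "valid_entry B' ?r"
    using entry_new p' I(2)[OF qP] add_element_image[OF p'(1), of p', folded B']
      valid_pair_add_element[of B q p', folded B'] free_module_mono[OF _ p'(1), of ?n]
    unfolding valid_entry_def by (auto simp: n)
  have pairs: "psig B' (fst q') (snd q') = psig B (fst q') (snd q')" if "q' \<in> left_over B P S" for q'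
  proof -
    have "valid_pair B q'" using I(2) that unfolding left_over_def by blast
    then show ?thesis unfolding B' using add_element_pair(1) valid_pairD by blast
  qed
  have larger: "M.lt S (psig B' (fst q') (snd q'))" if q': "q' \<in> left_over B P S \<union> N" for q'
  proof (cases "q' \<in> left_over B P S")
    case True
    then show ?thesis using L(2)[OF True] pairs[OF True] by simp
  next
    case False
    then obtain i where "q' = (i, ?n)" "i \<in> {1..bsize B}" "preg B' i ?n"
      using q' unfolding N n by auto
    then show ?thesis
      using new_spair_larger[OF I(1) ok[unfolded B'], of i] nred p'(3) unfolding B' by simp
  qed
  have dom: "psig B' (fst q') (snd q') \<in> mdom m" if "valid_pair B' q'" for q'
    by (rule valid_pair_psig_in[OF ok that])
  have vpairs: "valid_pair B' q'" if "q' \<in> left_over B P S \<union> N" for q'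
  proof (cases "q' \<in> left_over B P S")
    case True
    then show ?thesis using I(2) valid_pair_add_element[of B q' p', folded B'] unfolding left_over_def by blast
  next
    case False
    then show ?thesis using that unfolding N valid_pair_def by auto
  qed
  have lt: "M.lt (entry_sig B r) S" "entry_sig B r \<in> mdom m" if "r \<in> set rs" for r
    using L(5)[OF that] valid_pair_psig_in[OF I(1) vp[OF that]] unfolding entry_sig_def by auto
  show ?thesis unfolding sb_inv_def
  proof (intro conjI ballI allI impI)
    show "basis_ok B'" by (rule ok)
    show "valid_pair B' q'" if "q' \<in> left_over B P S \<union> N" for q' using vpairs[OF that] .
    show "processed B' (left_over B P S \<union> N) Y"
      by (rule processed_new_element[OF inv q S p' nred B' N])
    show "koszul_exp B' p \<or> (\<exists>r\<in>set (rs @ [?r]). entry_sig B' r = p \<and> poly_image (bgen B') (snd r) = 0)"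
      if p: "p \<in> Y" for p
    proof (cases "koszul_exp B p")
      case True
      then have "koszul_exp B' p" unfolding B' by (rule koszul_exp_mono)
      then show ?thesis ..
    next
      case False
      then obtain r where "r \<in> set rs" "entry_sig B r = p" "poly_image (bgen B) (snd r) = 0"
        using I(4)[OF p] by blast
      then show ?thesis using entry im by auto
    qed
    show "valid_entry B' r" if "r \<in> set (rs @ [?r])" for r
    proof (cases "r = ?r")
      case False
      then have r: "r \<in> set rs" using that by auto
      then show ?thesis
        using valid_entry_add_element[OF I(1) ok[unfolded B'] I(5)[OF r]] lt(1)[OF r] p'(3) B' by simp
    qed (simp add: valid_new)
    show "sorted_wrt (\<lambda>r r'. M.lt (entry_sig B' r) (entry_sig B' r')) (rs @ [?r])"
    proof -
      have "sorted_wrt (\<lambda>r r'. M.lt (entry_sig B' r) (entry_sig B' r')) rs"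
        by (rule sorted_wrt_mono_rel[OF _ I(6)]) (simp add: entry)
      then show ?thesis using lt(1) entry entry_new by (simp add: sorted_wrt_append)
    qed
    show "M.lt (entry_sig B' r) (psig B' (fst q') (snd q'))"
      if "r \<in> set (rs @ [?r])" "q' \<in> left_over B P S \<union> N" for r q'
    proof (cases "r = ?r")
      case True
      then show ?thesis using larger[OF that(2)] entry_new by simp
    next
      case False
      then have r: "r \<in> set rs" using that by auto
      show ?thesis
        using M.lt_le_trans[OF lt(2)[OF r] L(1) dom[OF vpairs[OF that(2)]] lt(1)[OF r]
            M.lt_imp_le[OF larger[OF that(2)]]] entry[OF r] by simp
    qed
    show "\<exists>r\<in>set (rs @ [?r]). yields_element B' r l" if "m < l \<and> l \<le> bsize B'" for l
    proof (cases "l = ?n")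
      case True
      then show ?thesis using new by auto
    next
      case False
      then have l: "l \<in> {1..bsize B}" "m < l" "l \<le> bsize B" using that n by auto
      then obtain r where "r \<in> set rs" "yields_element B r l" using I(8) by blast
      then show ?thesis using yields_element_add_element[OF I(5) l(1), of r p'] B' by auto
    qed
    show "sexp B' l \<noteq> sexp B' l'" if ll: "m < l \<and> l < l' \<and> l' \<le> bsize B'" for l l'
    proof -
      have l: "l \<in> {1..bsize B}" using ll n by auto
      have sl: "sexp B' l = sexp B l" unfolding B' by (rule add_element_exps(2)[OF l])
      show ?thesis
      proof (cases "l' = ?n")
        case True
        \<comment> \<open>An element added earlier has the signature of its entry, which lies below
          \<open>S\<close>.\<close>
        obtain r where r: "r \<in> set rs" "yields_element B r l" using I(8)[of l] l ll by auto
        have "sexp B l = entry_sig B r" by (rule yields_element_sexp[OF I(5)[OF r(1)] r(2)])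
        then have "M.lt (sexp B l) S" using lt(1)[OF r(1)] by simp
        moreover have "sexp B' l' = S" using True p'(3) by (simp add: B' add_element_new)
        ultimately show ?thesis using sl by auto
      next
        case False
        then have l': "l' \<in> {1..bsize B}" using ll n by auto
        then have "sexp B' l' = sexp B l'" unfolding B' by (rule add_element_exps(2))
        then show ?thesis using sl I(9)[of l l'] ll l' by auto
      qed
    qed
  qed
qed

section \<open>Steps of the algorithm\<close>

definition known :: "('v, 'k) sb_state \<Rightarrow> (nat \<times> ('v \<Rightarrow>\<^sub>0 nat)) set" where
  "known st = {p. \<exists>c. c \<noteq> 0 \<and> mterm p c \<in> syzs st}"

definition state_inv :: "('v, 'k) sb_state \<Rightarrow> bool" where
  "state_inv st \<longleftrightarrow> syzs st \<subseteq> module_terms m \<and> sb_inv (basis st) (pairs st) (known st) (reductions st)"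

lemma sig_spair:
  assumes B: "basis_ok B" and q: "valid_pair B q"
  obtains c where "c \<noteq> 0" "sig leM B (spair leR B q) = mterm (psig B (fst q) (snd q)) c"
proof -
  note V = valid_pairD[OF q]
  note s = spair_facts(2)[OF B V(1,2)] spair_facts(3,4)[OF B V(1,2,4)]
  show ?thesis using sig_eq(1,2)[OF B s(1,2)] s(3) that by simp
qed

lemma signature_criterion_iff:
  assumes "syzs st \<subseteq> module_terms m" "c \<noteq> 0"
  shows "signature_criterion (syzs st) (mterm S c) \<longleftrightarrow> (\<exists>p\<in>known st. \<exists>h. S = shift p h)"
proof
  assume "signature_criterion (syzs st) (mterm S c)"
  then obtain s where s: "s \<in> syzs st" "term_dvd s (mterm S c)" unfolding signature_criterion_def by blast
  then obtain p d where p: "s = mterm p d" "d \<noteq> 0" using assms(1) module_terms_iff by blast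
  with s have "p \<in> known st" unfolding known_def by blast
  moreover have "\<exists>h. S = shift p h" using s(2) unfolding p(1) term_dvd_mterm_iff[OF p(2) assms(2)] .
  ultimately show "\<exists>p\<in>known st. \<exists>h. S = shift p h" by blast
next
  assume "\<exists>p\<in>known st. \<exists>h. S = shift p h"
  then obtain p d where p: "d \<noteq> 0" "mterm p d \<in> syzs st" "\<exists>h. S = shift p h" unfolding known_def by blast
  then show "signature_criterion (syzs st) (mterm S c)"
    unfolding signature_criterion_def using term_dvd_mterm_iff[OF p(1) assms(2)] by blast
qed

lemma known_insert:
  assumes "c \<noteq> 0" shows "{p. \<exists>d. d \<noteq> 0 \<and> mterm p d \<in> insert (mterm S c) (syzs st)} = insert S (known st)"
  using assms by (auto simp: known_def mterm_eq_iff)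

text \<open>The algorithm speaks of terms with coefficients, the invariant of exponents; every
  ingredient of a step is translated here.\<close>

lemma step_translation:
  assumes inv: "state_inv st" and q: "minimal_pair leR leM st q"
  defines "S \<equiv> psig (basis st) (fst q) (snd q)"
    and "T \<equiv> sig leM (basis st) (spair leR (basis st) q)"
  shows "\<exists>c. c \<noteq> 0 \<and> T = mterm S c" "least_pending (basis st) (pairs st) q"
    "remaining_pairs leR leM st T = left_over (basis st) (pairs st) S"
    "eliminated leR leM st T \<longleftrightarrow> elim_exp (basis st) (known st) S"
    "koszul_signature leM (basis st) T \<longleftrightarrow> koszul_exp (basis st) S"
    "{p. \<exists>d. d \<noteq> 0 \<and> mterm p d \<in> insert T (syzs st)} = insert S (known st)"
    "insert T (syzs st) \<subseteq> module_terms m"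
proof -
  let ?B = "basis st"
  have syzs: "syzs st \<subseteq> module_terms m" and "sb_inv ?B (pairs st) (known st) (reductions st)"
    using inv unfolding state_inv_def by auto
  note I = sb_invD[OF this(2)]
  have qP: "q \<in> pairs st" using q unfolding minimal_pair_def by blast
  obtain c where c: "c \<noteq> 0" "T = mterm S c"
    using sig_spair[OF I(1) I(2)[OF qP]] unfolding S_def T_def by blast
  then show "\<exists>c. c \<noteq> 0 \<and> T = mterm S c" by blast
  have Sm: "S \<in> mdom m" unfolding S_def by (rule valid_pair_psig_in[OF I(1) I(2)[OF qP]])
  have "lem S (psig ?B (fst q') (snd q'))" if q': "q' \<in> pairs st" for q'
  proof -
    obtain d where d: "d \<noteq> 0" "sig leM ?B (spair leR ?B q') = mterm (psig ?B (fst q') (snd q')) d"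
      by (rule sig_spair[OF I(1) I(2)[OF q']])
    have "leM T (sig leM ?B (spair leR ?B q'))" using q q' unfolding minimal_pair_def T_def by blast
    then show ?thesis
      unfolding d(2) c(2) leM_mterm_iff[OF c(1) d(1) Sm valid_pair_psig_in[OF I(1) I(2)[OF q']]] .
  qed
  with qP show "least_pending ?B (pairs st) q" unfolding least_pending_def S_def by blast
  have "simeq vscale (sig leM ?B (spair leR ?B q')) T \<longleftrightarrow> psig ?B (fst q') (snd q') = S"
    if q': "q' \<in> pairs st" for q'
  proof -
    obtain d where d: "d \<noteq> 0" "sig leM ?B (spair leR ?B q') = mterm (psig ?B (fst q') (snd q')) d"
      by (rule sig_spair[OF I(1) I(2)[OF q']])
    show ?thesis unfolding d(2) c(2) by (rule simeq_mterm_iff[OF d(1) c(1)])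
  qed
  then show "remaining_pairs leR leM st T = left_over ?B (pairs st) S"
    unfolding remaining_pairs_def left_over_def by blast
  show k: "koszul_signature leM ?B T \<longleftrightarrow> koszul_exp ?B S"
    unfolding c(2) by (rule koszul_signature_iff[OF I(1) c(1)])
  show "eliminated leR leM st T \<longleftrightarrow> elim_exp ?B (known st) S"
    unfolding eliminated_def elim_exp_def k
    unfolding c(2) signature_criterion_iff[OF syzs c(1)] singular_criterion_iff[OF I(1) c(1)] ..
  show "{p. \<exists>d. d \<noteq> 0 \<and> mterm p d \<in> insert T (syzs st)} = insert S (known st)"
    unfolding c(2) by (rule known_insert[OF c(1)])
  show "insert T (syzs st) \<subseteq> module_terms m"
    using syzs Sm c by (simp add: mterm_in_module_terms)
qed

lemma state_inv_init: "state_inv (sb_init leR leM m g)"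
proof -
  let ?B = "input_basis m g"
  have ok: "basis_ok ?B"
    using gens_nonzero
    by (auto simp: basis_ok_def input_basis_def poly_image_single intro: single_in_free_module)
  have n: "bsize ?B = m" by (simp add: input_basis_def)
  let ?P = "{(i, j) | i j. 1 \<le> i \<and> i < j \<and> j \<le> m \<and> regular_spair leR leM ?B (i, j)}"
  have P: "q \<in> ?P \<longleftrightarrow> valid_pair ?B q" for q
  proof (cases q)
    case (Pair i j)
    show ?thesis
      using spair_facts(1)[OF ok, of i j] by (auto simp: Pair valid_pair_def n)
  qed
  have "sb_inv ?B ?P {} []"
    unfolding sb_inv_def
  proof (intro conjI)
    show "processed ?B ?P {}"
      unfolding processed_def
    proof (intro conjI ballI impI)
      show "?P \<subseteq> {1..bsize ?B} \<times> {1..bsize ?B}" by (auto simp: n)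
      fix i j assume "i \<in> {1..bsize ?B}" "j \<in> {1..bsize ?B}" "i < j" "preg ?B i j" "(i, j) \<notin> ?P"
      \<comment> \<open>Every regular pair of the input is pending, so there is nothing to
        resolve.\<close>
      then show "resolved ?B {} i j" using P[of "(i, j)"] by (simp add: valid_pair_def)
    qed simp
    show "\<forall>q\<in>?P. valid_pair ?B q" using P by blast
  qed (use ok n in auto)
  then show ?thesis by (simp add: state_inv_def sb_init_def known_def)
qed

lemma reduction_facts:
  assumes inv: "state_inv st" and q: "minimal_pair leR leM st q"
    and res: "regular_reduction_result leR leM (basis st) (spair leR (basis st) q) p'"
  shows "p' \<in> free_module (bsize (basis st))" "phi (basis st) p' \<noteq> 0"
    "spp (phi (basis st) p') = psig (basis st) (fst q) (snd q)"
    "poly_image (bgen (basis st)) p' \<noteq> 0 \<Longrightarrow>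
      \<not> reg_reducible (basis st) (lpp (poly_image (bgen (basis st)) p')) (psig (basis st) (fst q) (snd q))"
proof -
  let ?B = "basis st"
  have "sb_inv ?B (pairs st) (known st) (reductions st)" using inv unfolding state_inv_def by blast
  note I = sb_invD[OF this]
  have "q \<in> pairs st" using q unfolding minimal_pair_def by blast
  note V = valid_pairD[OF I(2)[OF this]]
  note s = spair_facts(2)[OF I(1) V(1,2)] spair_facts(3,4)[OF I(1) V(1,2,4)]
  note R = regular_reduction_result_facts[OF I(1) s(1)[simplified] s(2)[simplified] res]
  show "p' \<in> free_module (bsize ?B)" "phi ?B p' \<noteq> 0" using R by auto
  show "spp (phi ?B p') = psig ?B (fst q) (snd q)" using R(3) s(3) by simp
  show "\<not> reg_reducible ?B (lpp (poly_image (bgen ?B) p')) (psig ?B (fst q) (snd q))"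
    if "poly_image (bgen ?B) p' \<noteq> 0" using R(4)[OF that] s(3) by simp
qed

lemma state_inv_step:
  assumes "sb_step leR leM st st'" "state_inv st"
  shows "state_inv st'"
  using assms
proof (cases rule: sb_step.cases)
  case (eliminate p T)
  note t = step_translation[OF assms(2) eliminate(2), folded eliminate(3)]
  have syzs: "syzs st \<subseteq> module_terms m"
    and inv: "sb_inv (basis st) (pairs st) (known st) (reductions st)"
    using assms(2) unfolding state_inv_def by auto
  let ?S = "psig (basis st) (fst p) (snd p)"
  have k: "known st' = (if koszul_exp (basis st) ?S then insert ?S (known st) else known st)"
  proof -
    have "syzs st' = (if koszul_exp (basis st) ?S then insert T (syzs st) else syzs st)"
      using t(5) by (simp add: eliminate(1))
    with t(6) show ?thesis
      by (cases "koszul_exp (basis st) ?S") (simp_all only: known_def[of st'] known_def[of st] if_True if_False)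
  qed
  have "sb_inv (basis st) (left_over (basis st) (pairs st) ?S) (known st') (reductions st)"
    unfolding k using sb_inv_eliminate[OF inv t(2) HOL.refl] eliminate(4) t(4) by simp
  then show ?thesis
    unfolding state_inv_def using t(3,7) syzs by (simp add: eliminate(1))
next
  case (to_zero p T p')
  note t = step_translation[OF assms(2) to_zero(2), folded to_zero(3)]
  have inv: "sb_inv (basis st) (pairs st) (known st) (reductions st)"
    using assms(2) unfolding state_inv_def by auto
  note R = reduction_facts[OF assms(2) to_zero(2,5)]
  have k: "known st' = insert (psig (basis st) (fst p) (snd p)) (known st)"
  proof -
    have "syzs st' = insert T (syzs st)" by (simp add: to_zero(1))
    with t(6) show ?thesis by (simp only: known_def[of st'])
  qed
  have ne: "\<not> elim_exp (basis st) (known st) (psig (basis st) (fst p) (snd p))" using to_zero(4) t(4) by simp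
  have "sb_inv (basis st) (left_over (basis st) (pairs st) (psig (basis st) (fst p) (snd p)))
      (known st') (reductions st @ [(p, p')])"
    unfolding k by (rule sb_inv_to_zero[OF inv t(2) HOL.refl ne R(1-3) to_zero(6)])
  then show ?thesis
    unfolding state_inv_def using t(3,7) by (simp add: to_zero(1))
next
  case (singular p T p')
  note t = step_translation[OF assms(2) singular(2), folded singular(3)]
  have inv: "sb_inv (basis st) (pairs st) (known st) (reductions st)"
    using assms(2) unfolding state_inv_def by auto
  note R = reduction_facts[OF assms(2) singular(2,5)]
  have ne: "\<not> elim_exp (basis st) (known st) (psig (basis st) (fst p) (snd p))" using singular(4) t(4) by simp
  \<comment> \<open>The premise of this rule is contradictory: a nonzero result that passed the
    criteria is never singular top reducible.\<close>
  have "\<not> singular_top_reducible leR leM (basis st) p'"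
    using not_singular_reducible[OF inv t(2) HOL.refl ne R(1-3) singular(6) R(4)[OF singular(6)]]
      singular_top_reducible_iff[OF sb_invD(1)[OF inv] R(1) singular(6)] R(3) by simp
  with singular(7) show ?thesis by blast
next
  case (new_element p T p' B')
  note t = step_translation[OF assms(2) new_element(2), folded new_element(3)]
  have syzs: "syzs st \<subseteq> module_terms m"
    and inv: "sb_inv (basis st) (pairs st) (known st) (reductions st)"
    using assms(2) unfolding state_inv_def by auto
  note R = reduction_facts[OF assms(2) new_element(2,5)]
  have k: "known st' = known st" unfolding known_def new_element(1) by simp
  have ok: "basis_ok B'"
    unfolding new_element(8) by (rule basis_ok_add_element[OF sb_invD(1)[OF inv] R(1) new_element(6)])
  have "regular_spair leR leM B' (i, bsize B') \<longleftrightarrow> preg B' i (bsize B')" if "1 \<le> i" "i < bsize B'" for i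
    by (rule spair_facts(1)[OF ok]) (use that in auto)
  then have N: "{(i, bsize B') | i. 1 \<le> i \<and> i < bsize B' \<and> regular_spair leR leM B' (i, bsize B')} =
      {(i, bsize B') | i. 1 \<le> i \<and> i < bsize B' \<and> preg B' i (bsize B')}"
    by blast
  have "sb_inv B' (left_over (basis st) (pairs st) (psig (basis st) (fst p) (snd p)) \<union>
      {(i, bsize B') | i. 1 \<le> i \<and> i < bsize B' \<and> preg B' i (bsize B')}) (known st)
      (reductions st @ [(p, p')])"
    by (rule sb_inv_new_element[OF inv t(2) HOL.refl R(1-3) new_element(6) R(4)[OF new_element(6)]
          new_element(8) HOL.refl])
  then show ?thesis
    unfolding state_inv_def k using t(3) syzs N by (simp add: new_element(1))
qed

lemma sb_computes_inv:
  assumes "sb_computes leR leM m g st"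
  shows "sb_inv (basis st) {} (known st) (reductions st)"
proof -
  have "(sb_step leR leM)\<^sup>*\<^sup>* (sb_init leR leM m g) st" "pairs st = {}"
    using assms unfolding sb_computes_def by auto
  from this(1) have "state_inv st"
    by (induction rule: rtranclp_induct) (auto intro: state_inv_init state_inv_step)
  with \<open>pairs st = {}\<close> show ?thesis unfolding state_inv_def by simp
qed

lemma yields_syzygy_iff:
  assumes "basis_ok B" "valid_entry B r" "c \<noteq> 0"
  shows "yields_syzygy leR leM B r (mterm p c) \<longleftrightarrow> entry_sig B r = p \<and> poly_image (bgen B) (snd r) = 0"
proof -
  have "valid_pair B (fst r)" using assms(2) unfolding valid_entry_def by blast
  then obtain d where "d \<noteq> 0" "sig leM B (spair leR B (fst r)) = mterm (entry_sig B r) d"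
    using sig_spair[OF assms(1)] unfolding entry_sig_def by blast
  then show ?thesis using assms(3) by (simp add: yields_syzygy_def simeq_mterm_iff)
qed

end

section \<open>Matching reductions with new basis elements and minimal generators\<close>

theorem theorem6:
  fixes leR :: "('v::finite, 'k::field) pol \<Rightarrow> ('v, 'k) pol \<Rightarrow> bool"
    and leM :: "('v, 'k) fvec \<Rightarrow> ('v, 'k) fvec \<Rightarrow> bool"
    and m n :: nat
    and g :: "nat \<Rightarrow> ('v, 'k) pol"
    and st :: "('v, 'k) sb_state"
    and B :: "('v, 'k) ext_basis"
    and rs :: "((nat \<times> nat) \<times> ('v, 'k) fvec) list"
    and H :: "('v, 'k) fvec set"
  assumes "term_order_on (*) monomials leR"
    and "term_order_on vscale (module_terms m) leM"
    and "compatible_orders m leR leM"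
    and "\<forall>i\<in>{1..m}. g i \<noteq> 0"
    and "sb_computes leR leM m g st"
    and "B = basis st" and "n = bsize B" and "rs = reductions st"
    and "H = initial_syzygies leM m g"
  shows
    "(\<forall>i. m < i \<and> i \<le> n \<longrightarrow> (\<exists>!k. k < length rs \<and> yields_element B (rs ! k) i)) \<and>
     (\<forall>T. minimal_generator m H T \<and> \<not> koszul_signature leM B T \<longrightarrow>
        (\<exists>!k. k < length rs \<and> yields_syzygy leR leM B (rs ! k) T)) \<and>
     (\<forall>k < length rs.
        (\<exists>!i. m < i \<and> i \<le> n \<and> yields_element B (rs ! k) i) \<and>
          \<not> (\<exists>T. minimal_generator m H T \<and> \<not> koszul_signature leM B T \<and>
                 yields_syzygy leR leM B (rs ! k) T) \<or>
        \<not> (\<exists>i. m < i \<and> i \<le> n \<and> yields_element B (rs ! k) i) \<and>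
          (\<exists>T. minimal_generator m H T \<and> \<not> koszul_signature leM B T \<and>
               yields_syzygy leR leM B (rs ! k) T))"
proof -
  interpret sb_input leR leM m g
    by unfold_locales (use assms(1-4) in blast)+
  let ?H = "initial_syzygies leM m g"
  show ?thesis
    unfolding \<open>n = bsize B\<close> \<open>H = ?H\<close>
  proof (intro conjI allI impI)
    note I = sb_invD[OF sb_computes_inv[OF assms(5), folded assms(6,8)]]
    \<comment> \<open>Entry signatures strictly increase along the list, so a signature determines
      its position.\<close>
    have eq: "k = k'" if "k < length rs" "k' < length rs" "entry_sig B (rs ! k) = entry_sig B (rs ! k')" for k k'
      using that sorted_wrt_nth_less[OF I(6), of k k'] sorted_wrt_nth_less[OF I(6), of k' k]
      by (metis M.lt_irrefl linorder_neqE_nat)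
    {
      fix i assume i: "m < i \<and> i \<le> bsize B"
      then obtain r where "r \<in> set rs" "yields_element B r i" using I(8) by blast
      then obtain k where k: "k < length rs" "yields_element B (rs ! k) i" by (metis in_set_conv_nth)
      show "\<exists>!k. k < length rs \<and> yields_element B (rs ! k) i"
      proof (rule ex1I[of _ k])
        fix k' assume k': "k' < length rs \<and> yields_element B (rs ! k') i"
        then have "entry_sig B (rs ! k') = entry_sig B (rs ! k)"
          using k yields_element_sexp[OF I(5)] by (metis nth_mem)
        then show "k' = k" using eq k(1) k' by blast
      qed (use k in blast)
    next
      fix T assume T: "minimal_generator m ?H T \<and> \<not> koszul_signature leM B T"
      then obtain p c where p: "c \<noteq> 0" "T = mterm p c" "min_syz_exp p"
        unfolding minimal_generator_iff by blast
      have nk: "\<not> koszul_exp B p" using T koszul_signature_iff[OF I(1) p(1)] p(2) by blast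
      have "p \<in> syz_exps" using p(3) unfolding min_syz_exp_def by blast
      \<comment> \<open>With no pair pending, every syzygy exponent is a multiple of a known
        one.\<close>
      then obtain q h where q: "q \<in> known st" "p = shift q h"
        using syz_exp_known[OF I(1,3)] unfolding none_pending_def by blast
      then have "q \<in> syz_exps" using I(3) unfolding processed_def by blast
      \<comment> \<open>Minimality turns divisibility into equality; as \<open>p\<close> is no
        Koszul signature, it became known through a reduction to zero.\<close>
      then have "p = q" by (rule min_syz_exp_dvd[OF p(3) _ q(2)])
      then obtain r where "r \<in> set rs" "entry_sig B r = p" "poly_image (bgen B) (snd r) = 0"
        using I(4)[OF q(1)] nk by blast
      then obtain k where k: "k < length rs" "entry_sig B (rs ! k) = p" "poly_image (bgen B) (snd (rs ! k)) = 0"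
        by (metis in_set_conv_nth)
      have iff: "yields_syzygy leR leM B (rs ! k) T \<longleftrightarrow> entry_sig B (rs ! k) = p \<and> poly_image (bgen B) (snd (rs ! k)) = 0"
        if "k < length rs" for k
        unfolding p(2) by (rule yields_syzygy_iff[OF I(1) I(5)[OF nth_mem[OF that]] p(1)])
      show "\<exists>!k. k < length rs \<and> yields_syzygy leR leM B (rs ! k) T"
      proof (rule ex1I[of _ k])
        fix k' assume "k' < length rs \<and> yields_syzygy leR leM B (rs ! k') T"
        then show "k' = k" using iff k eq by metis
      qed (use k iff in blast)
    next
      fix k assume k: "k < length rs"
      let ?r = "rs ! k"
      have valid: "valid_entry B ?r" by (rule I(5)[OF nth_mem[OF k]])
      show "(\<exists>!i. m < i \<and> i \<le> bsize B \<and> yields_element B ?r i) \<and>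
            \<not> (\<exists>T. minimal_generator m ?H T \<and> \<not> koszul_signature leM B T \<and>
                   yields_syzygy leR leM B ?r T) \<or>
          \<not> (\<exists>i. m < i \<and> i \<le> bsize B \<and> yields_element B ?r i) \<and>
            (\<exists>T. minimal_generator m ?H T \<and> \<not> koszul_signature leM B T \<and>
                 yields_syzygy leR leM B ?r T)"
      proof (cases "poly_image (bgen B) (snd ?r) = 0")
        case True
        \<comment> \<open>Basis elements are nonzero, so a result with image 0 is none of
          them.\<close>
        have "\<not> yields_element B ?r i" if "m < i" "i \<le> bsize B" for i
          using True basis_ok_gen(3)[OF I(1), of i] that unfolding yields_element_def by auto
        moreover have "min_syz_exp (entry_sig B ?r)" "\<not> koszul_exp B (entry_sig B ?r)"
          using valid True unfolding valid_entry_def by auto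
        then have "minimal_generator m ?H (mterm (entry_sig B ?r) 1) \<and>
            \<not> koszul_signature leM B (mterm (entry_sig B ?r) 1) \<and>
            yields_syzygy leR leM B ?r (mterm (entry_sig B ?r) 1)"
          using True yields_syzygy_iff[OF I(1) valid] koszul_signature_iff[OF I(1)]
          unfolding minimal_generator_iff by (metis one_neq_zero)
        ultimately show ?thesis by blast
      next
        case False
        then obtain i where i: "m < i" "i \<le> bsize B" "yields_element B ?r i"
          using valid unfolding valid_entry_def by auto
        have "\<exists>!i. m < i \<and> i \<le> bsize B \<and> yields_element B ?r i"
        proof (rule ex1I[of _ i])
          fix i' assume i': "m < i' \<and> i' \<le> bsize B \<and> yields_element B ?r i'"
          \<comment> \<open>Both elements have the signature of the entry, but added elements have
            pairwise distinct signatures.\<close>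
          then have "sexp B i' = sexp B i" using yields_element_sexp[OF valid] i by metis
          then show "i' = i" using I(9)[of i i'] I(9)[of i' i] i i' by (metis linorder_neqE_nat)
        qed (use i in blast)
        moreover have "\<not> yields_syzygy leR leM B ?r T" for T using False unfolding yields_syzygy_def by blast
        ultimately show ?thesis by blast
      qed
    }
  qed
qed

end
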